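(* Suppose $K$ is a number field. Let $\{v_1,v_2,\ldots,v_n\}$ be the complete list of Archimedean places of $K$ and let $\{\alpha_1,\alpha_2,\ldots,\alpha_{n-1}\}$ be a fundamental set of units in $K$. For each non-Archimedean place $v$ of $K$, let $\beta_v\in\mathcal O_K$ be such that $\|\beta_v\|_v<1$ and $\|\beta_v\|_w=1$ for all non-Archimedean places $w\ne v$ of $K$. Finally, let $(y_v)_{v\in M_K}$ be a family of real numbers. Then $$\sum_{v\in M_K}y_v\log\|\alpha\|_v\in\mathbb Q\quad\text{for all }\alpha\in K^\times$$ if and only if the following two conditions hold: (i) We have $$\begin{pmatrix}\log\|\alpha_1\|_{v_1}&\log\|\alpha_1\|_{v_2}&\cdots&\log\|\alpha_1\|_{v_n}\\ \log\|\alpha_2\|_{v_1}&\log\|\alpha_2\|_{v_2}&\cdots&\log\|\alpha_2\|_{v_n}\\ \vdots&\vdots&\ddots&\vdots\\ \log\|\alpha_{n-1}\|_{v_1}&\log\|\alpha_{n-1}\|_{v_2}&\cdots&\log\|\alpha_{n-1}\|_{v_n}\end{pmatrix}\begin{pmatrix} y_{v_1} \\ y_{v_2} \\ \vdots \\ y_{v_n} \end{pmatrix}\in\mathbb Q^{n-1}.$$ (ii) For all non-Archimedean places $v$ of $K$, $$y_v\log\|\beta_v\|_v+\sum_{i=1}^n y_{v_i}\log\|\beta_v\|_{v_i}\in\mathbb Q.$$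
   Context: For a number field $K$, $\mathcal O_K$ is its ring of integers and $M_K$ is the set of all places of $K$ (Archimedean and non-Archimedean). For $v\in M_K$, $K_v$ is the completion of $K$ at $v$, $p_v$ is the place of $\mathbb Q$ below $v$, and $\|\cdot\|_v$ is the unique extension to $K_v$ of the usual $p_v$-adic absolute value on $\mathbb Q_{p_v}$ (the usual absolute value if $p_v=\infty$). If $K$ has $n$ Archimedean places, elements $\alpha_1,\ldots,\alpha_{n-1}\in\mathcal O_K^\times$ form a fundamental set of units in $K$ if there is a root of unity $\zeta$ such that $\{\zeta,\alpha_1,\ldots,\alpha_{n-1}\}$ generates the group $\mathcal O_K^\times$. *)

theory Defs
  imports
    "HOL-Analysis.Analysis"
    "HOL-Algebra.QuotRing"
    "HOL-Algebra.Generated_Groups"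
    "HOL-Decision_Procs.Algebra_Aux"
    "HOL-Computational_Algebra.Computational_Algebra"
begin

text \<open>A number field is a whole type of class \<open>field_char_0\<close>. Such a type becomes a
  HOL-Algebra ring record through \<open>cring_class_ops\<close>, so that absolute values on the field and
  on its completions are instances of one notion.\<close>

definition number_field :: "'a::field_char_0 itself \<Rightarrow> bool" where
  "number_field _ \<longleftrightarrow>
     (\<exists>B. finite_dimensional_vector_space (\<lambda>(q::rat) (x::'a). of_rat q * x) B)"

definition ring_of_integers :: "'a::field_char_0 ring" where
  "ring_of_integers = cring_class_ops\<lparr>carrier := {x. algebraic_int x}\<rparr>"

definition absolute_value :: "('a, 'b) ring_scheme \<Rightarrow> ('a \<Rightarrow> real) \<Rightarrow> bool" where
  "absolute_value R f \<longleftrightarrow>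
     (\<forall>x\<in>carrier R. 0 \<le> f x \<and> (f x = 0 \<longleftrightarrow> x = \<zero>\<^bsub>R\<^esub>)) \<and>
     (\<forall>x\<in>carrier R. \<forall>y\<in>carrier R.
        f (x \<otimes>\<^bsub>R\<^esub> y) = f x * f y \<and> f (x \<oplus>\<^bsub>R\<^esub> y) \<le> f x + f y)"

definition nontrivial_abs :: "('a::field \<Rightarrow> real) set" where
  "nontrivial_abs = {f. absolute_value cring_class_ops f \<and> (\<exists>x. x \<noteq> 0 \<and> f x \<noteq> 1)}"

definition abs_equiv :: "(('a::field \<Rightarrow> real) \<times> ('a \<Rightarrow> real)) set" where
  "abs_equiv = {(f, g). f \<in> nontrivial_abs \<and> g \<in> nontrivial_abs \<and>
     (\<exists>s>0. \<forall>x. g x = f x powr s)}"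

type_synonym 'a place = "('a \<Rightarrow> real) set"

definition places :: "'a::field place set" where
  "places = nontrivial_abs // abs_equiv"

definition nonarchimedean :: "'a::field place \<Rightarrow> bool" where
  "nonarchimedean v \<longleftrightarrow> (\<forall>f\<in>v. \<forall>x y. f (x + y) \<le> max (f x) (f y))"

definition arch_places :: "'a::field place set" where
  "arch_places = {v \<in> places. \<not> nonarchimedean v}"

definition nonarch_places :: "'a::field place set" where
  "nonarch_places = {v \<in> places. nonarchimedean v}"

definition padic_abs :: "nat \<Rightarrow> rat \<Rightarrow> real" where
  "padic_abs p q = (if q = 0 then 0 else
     (case quotient_of q of (a, b) \<Rightarrow>
        real p powi (int (multiplicity (int p) b) - int (multiplicity (int p) a))))"

definition usual_abs :: "rat place \<Rightarrow> rat \<Rightarrow> real" where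
  "usual_abs p = (THE f. f \<in> p \<and>
     (f = (\<lambda>q. \<bar>real_of_rat q\<bar>) \<or> (\<exists>l. prime l \<and> f = padic_abs l)))"

definition place_below :: "'a::field_char_0 place \<Rightarrow> rat place" where
  "place_below v = (THE p. p \<in> places \<and> (\<forall>f\<in>v. f \<circ> of_rat \<in> p))"

text \<open>The completion is the ring of Cauchy sequences modulo null sequences. Equivalent absolute
  values have the same Cauchy and the same null sequences, so quantifying over all members of the
  place avoids choosing a representative.\<close>

definition cauchy_ring :: "'a::field place \<Rightarrow> (nat \<Rightarrow> 'a) ring" where
  "cauchy_ring v =
     \<lparr>carrier = {s. \<forall>f\<in>v. Metric_space.MCauchy UNIV (\<lambda>x y. f (x - y)) s},
      mult = (\<lambda>s t n. s n * t n), one = (\<lambda>_. 1),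
      zero = (\<lambda>_. 0), add = (\<lambda>s t n. s n + t n)\<rparr>"

definition null_ideal :: "'a::field place \<Rightarrow> (nat \<Rightarrow> 'a) set" where
  "null_ideal v = {s \<in> carrier (cauchy_ring v). \<forall>f\<in>v. (\<lambda>n. f (s n)) \<longlonglongrightarrow> 0}"

definition completion :: "'a::field place \<Rightarrow> (nat \<Rightarrow> 'a) set ring" where
  "completion v = cauchy_ring v Quot null_ideal v"

definition cauchy_class :: "'a::field place \<Rightarrow> (nat \<Rightarrow> 'a) \<Rightarrow> (nat \<Rightarrow> 'a) set" where
  "cauchy_class v s = null_ideal v +>\<^bsub>cauchy_ring v\<^esub> s"

definition usual_abs_completion :: "rat place \<Rightarrow> (nat \<Rightarrow> rat) set \<Rightarrow> real" where
  "usual_abs_completion p X = (THE r. \<forall>s\<in>X. (\<lambda>n. usual_abs p (s n)) \<longlonglongrightarrow> r)"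

text \<open>The completion of the rationals at the place below \<open>v\<close> embeds into the completion at \<open>v\<close>
  by sending the class of a sequence \<open>s\<close> to the class of \<open>of_rat \<circ> s\<close>. Requiring the function to
  be extensional makes the extension unique also as a function on the whole type.\<close>

definition completion_abs :: "'a::field_char_0 place \<Rightarrow> (nat \<Rightarrow> 'a) set \<Rightarrow> real" where
  "completion_abs v = (THE N.
     N \<in> extensional (carrier (completion v)) \<and>
     absolute_value (completion v) N \<and>
     (\<forall>s\<in>carrier (cauchy_ring (place_below v)).
        N (cauchy_class v (of_rat \<circ> s)) =
        usual_abs_completion (place_below v) (cauchy_class (place_below v) s)))"

definition place_norm :: "'a::field_char_0 place \<Rightarrow> 'a \<Rightarrow> real" where
  "place_norm v \<alpha> = completion_abs v (cauchy_class v (\<lambda>_. \<alpha>))"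

text \<open>The elements of the set are listed as \<open>\<alpha> 1, \<dots>, \<alpha> (n - 1)\<close>, where \<open>n\<close> is the number of
  Archimedean places.\<close>

definition fundamental_units :: "(nat \<Rightarrow> 'a::field_char_0) \<Rightarrow> bool" where
  "fundamental_units \<alpha> \<longleftrightarrow>
     (let n = card (arch_places :: 'a place set); I = {1..<n} in
        \<alpha> ` I \<subseteq> Units ring_of_integers \<and>
        (\<exists>\<zeta>. (\<exists>m>0. \<zeta> ^ m = 1) \<and>
          generate (units_of ring_of_integers) (insert \<zeta> (\<alpha> ` I)) = Units ring_of_integers))"

end

theory Submission
  imports Defs
begin

text \<open>The absolute value attached to a place is a normalized member \<open>M\<close> of that place. It exists by
  Ostrowski's theorem on the rational numbers; the extension to the completion is unique because
  a maximal subset of a rational basis that is uniformly independent for \<open>M\<close> spans a dense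
  subspace, so that any extension is bounded by a multiple of \<open>M\<close>, and powers remove the constant.

  An element \<open>x\<close> that is not integral has absolute value greater than one at some
  nonarchimedean place: a subring maximal among those that contain \<open>1 / x\<close> but not \<open>x\<close> is a
  valuation ring, and over a number field its value group is torsion over that of a prime number.
  So the units of the ring of integers are the elements of norm one at all nonarchimedean places.

  The nonzero \<open>a\<close> with rational weighted logarithm form a group that is closed under roots. Since
  value groups are torsion over the integers, a power of any \<open>a\<close> times powers of the \<open>\<beta> w\<close> is a unit,
  so rationality only has to be tested on the \<open>\<beta> w\<close> and on the fundamental units. Neither the
  finiteness of the class number nor the unit theorem is needed.\<close>

section \<open>Absolute values on fields\<close>

text \<open>The norm of a place is defined by a description over functions on the completion, so
  nothing about it can be computed before existence and uniqueness of the extension are settled. A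
  rational basis of the field may become dependent over the completion of the rationals, as it does
  when several places lie over one prime; this is why only a uniformly independent part of the basis
  can supply coordinates.

  The other recurring device is a rational linear relation among the powers of an element, which
  exists by finite dimension. Under an ultrametric absolute value two terms of such a relation have
  the same value, so some power of the element has the value of a rational number. This gives the
  torsion of value groups, turns the valuation ring produced by Zorn's lemma into a real valued
  absolute value, and confines the support of an element to the supports of the coefficients. The
  number of places over one prime is bounded by means of the family \<open>\<beta>\<close>.\<close>

locale abs_val =
  fixes f :: "'a::field \<Rightarrow> real"
  assumes nonneg [simp]: "0 \<le> f x"
    and eq_0_iff [simp]: "f x = 0 \<longleftrightarrow> x = 0"
    and mult: "f (x * y) = f x * f y"
    and triangle: "f (x + y) \<le> f x + f y"
begin

lemma zero [simp]: "f 0 = 0"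
  by simp

lemma pos_iff [simp]: "0 < f x \<longleftrightarrow> x \<noteq> 0"
  using nonneg[of x] eq_0_iff[of x] by linarith

lemma one [simp]: "f 1 = 1"
  using mult[of 1 1] eq_0_iff[of 1] by simp

lemma power: "f (x ^ n) = f x ^ n"
  by (induction n) (simp_all add: mult)

lemma root_of_unity: "x ^ n = 1 \<Longrightarrow> n > 0 \<Longrightarrow> f x = 1"
  using power[of x n] power_eq_imp_eq_base[of "f x" n 1] by simp

lemma minus [simp]: "f (- x) = f x"
proof -
  have "f (-1) = 1"
    by (rule root_of_unity[of _ 2]) simp_all
  then show ?thesis
    using mult[of "-1" x] by simp
qed

lemma diff_commute: "f (x - y) = f (y - x)"
  using minus[of "x - y"] by (simp only: minus_diff_eq)

lemma inverse: "f (inverse x) = inverse (f x)"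
proof (cases "x = 0")
  case False
  then have "f (inverse x) * f x = 1"
    by (simp flip: mult)
  then show ?thesis
    using False by (simp add: field_simps)
qed simp

lemma divide: "f (x / y) = f x / f y"
  by (simp add: divide_inverse mult inverse)

lemma power_int: "f (x powi k) = f x powi k"
  by (simp add: power_int_def power inverse)

lemma prod: "f (prod g A) = (\<Prod>x\<in>A. f (g x))"
  by (induction A rule: infinite_finite_induct) (simp_all add: mult)

lemma sum_le: "f (sum g A) \<le> (\<Sum>x\<in>A. f (g x))"
proof (induction A rule: infinite_finite_induct)
  case (insert x A)
  then show ?case
    using triangle[of "g x" "sum g A"] by simp
qed simp_all

lemma triangle_diff: "\<bar>f x - f y\<bar> \<le> f (x - y)"
  using triangle[of "x - y" y] triangle[of "y - x" x] diff_commute[of x y] by simp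

lemma of_nat_le: "f (of_nat n) \<le> of_nat n"
proof (induction n)
  case (Suc n)
  then show ?case
    using triangle[of 1 "of_nat n"] by simp
qed simp

lemma of_int_eq_of_nat: "f (of_int i) = f (of_nat (nat \<bar>i\<bar>))"
  by (cases "i \<ge> 0") (simp_all add: of_nat_nat)

end

lemma absolute_value_class_iff: "absolute_value cring_class_ops f \<longleftrightarrow> abs_val f"
  by (auto simp: absolute_value_def abs_val_def carrier_class plus_class times_class zero_class)

text \<open>Exponential growth beats linear growth; this removes the polynomial factors
  that arise from counting terms.\<close>

lemma le_of_power_le_linear:
  fixes x z a b :: real
  assumes "0 \<le> z" and bound: "\<And>k::nat. x ^ k \<le> (a * k + b) * z ^ k"
  shows "x \<le> z"
proof (rule ccontr)
  assume "\<not> x \<le> z"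
  then have "z < x" by simp
  have z: "z > 0"
  proof (rule ccontr)
    assume "\<not> z > 0"
    with \<open>0 \<le> z\<close> have "z = 0" by simp
    with bound[of 1] \<open>z < x\<close> show False by simp
  qed
  define d where "d = x / z - 1"
  have d: "d > 0"
    using \<open>z < x\<close> z by (simp add: d_def)
  have q: "(1 + d) ^ k \<le> a * k + b" for k :: nat
    using bound[of k] z by (simp add: d_def power_divide field_simps)
  have "(\<lambda>k::nat. a * (real k * (1 / (1 + d)) ^ k) + b * (1 / (1 + d)) ^ k) \<longlonglongrightarrow> a * 0 + b * 0"
    using d by (intro tendsto_intros powser_times_n_limit_0 LIMSEQ_realpow_zero) simp_all
  then have "(\<lambda>k::nat. (a * k + b) / (1 + d) ^ k) \<longlonglongrightarrow> 0"
    by (simp add: power_divide add_divide_distrib)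
  then have "eventually (\<lambda>k::nat. (a * k + b) / (1 + d) ^ k < 1) sequentially"
    by (rule order_tendstoD) simp
  then obtain k :: nat where "(a * k + b) / (1 + d) ^ k < 1"
    by (auto simp: eventually_sequentially)
  with q[of k] d show False
    by (simp add: field_simps)
qed

lemma (in abs_val) bounded_imp_le_one:
  assumes "\<And>n::nat. f x ^ n \<le> C"
  shows "f x \<le> 1"
  by (rule le_of_power_le_linear[of _ _ 0 C]) (use assms in simp_all)

text \<open>The binomial theorem for \<open>(x + y) ^ n\<close> has only \<open>n + 1\<close> terms. So a bound on the values
  at integers \<open>n choose k\<close> sharpens the triangle inequality.\<close>

lemma (in abs_val) triangle_powr:
  fixes s :: real
  assumes s: "s > 0" and of_nat: "\<And>n. f (of_nat n) \<le> of_nat n powr s"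
  shows "f (x + y) powr (1 / s) \<le> f x powr (1 / s) + f y powr (1 / s)"
proof -
  define X Y where "X = f x powr (1 / s)" and "Y = f y powr (1 / s)"
  have X: "0 \<le> X" "f x = X powr s" and Y: "0 \<le> Y" "f y = Y powr s"
    using s by (simp_all add: X_def Y_def powr_powr)
  have "f (x + y) ^ n \<le> (1 * real n + 1) * ((X + Y) powr s) ^ n" for n
  proof -
    have pw: "(u powr s) ^ k = (u ^ k) powr s" if "0 \<le> u" for u :: real and k
      using that by (induction k) (simp_all add: powr_mult)
    have "f (x + y) ^ n = f (\<Sum>k\<le>n. of_nat (n choose k) * x ^ k * y ^ (n - k))"
      by (simp add: binomial_ring flip: power)
    also have "\<dots> \<le> (\<Sum>k\<le>n. f (of_nat (n choose k) * x ^ k * y ^ (n - k)))"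
      by (rule sum_le)
    also have "\<dots> \<le> (\<Sum>k\<le>n. ((X + Y) ^ n) powr s)"
    proof (rule sum_mono)
      fix k assume "k \<in> {..n}"
      have "f (of_nat (n choose k) * x ^ k * y ^ (n - k))
          = f (of_nat (n choose k)) * (X ^ k) powr s * (Y ^ (n - k)) powr s"
        by (simp add: mult power X Y pw)
      also have "\<dots> \<le> of_nat (n choose k) powr s * (X ^ k) powr s * (Y ^ (n - k)) powr s"
        by (intro mult_right_mono of_nat) simp_all
      also have "\<dots> = (of_nat (n choose k) * X ^ k * Y ^ (n - k)) powr s"
        using X Y by (simp add: powr_mult)
      also have "\<dots> \<le> ((X + Y) ^ n) powr s"
      proof (rule powr_mono2)
        have "of_nat (n choose k) * X ^ k * Y ^ (n - k)
            \<le> (\<Sum>k\<le>n. of_nat (n choose k) * X ^ k * Y ^ (n - k))"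
          using \<open>k \<in> {..n}\<close> X(1) Y(1) by (intro member_le_sum) simp_all
        then show "of_nat (n choose k) * X ^ k * Y ^ (n - k) \<le> (X + Y) ^ n"
          by (subst binomial_ring)
      qed (use s X Y in simp_all)
      finally show "f (of_nat (n choose k) * x ^ k * y ^ (n - k)) \<le> ((X + Y) ^ n) powr s" .
    qed
    also have "\<dots> = (1 * real n + 1) * ((X + Y) powr s) ^ n"
      using X Y by (simp add: pw)
    finally show ?thesis .
  qed
  then have "f (x + y) \<le> (X + Y) powr s"
    by (rule le_of_power_le_linear[of _ _ 1 1, rotated]) simp
  then have "f (x + y) powr (1 / s) \<le> ((X + Y) powr s) powr (1 / s)"
    using s by (intro powr_mono2) simp_all
  then have "f (x + y) powr (1 / s) \<le> X + Y"
    using s X(1) Y(1) by (simp add: powr_powr)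
  then show ?thesis
    unfolding X_def Y_def .
qed

text \<open>Binomial coefficients have value at most 1 here, so each of the n + 1 terms of
  \<open>(x + y) ^ n\<close> is at most the n-th power of the maximum. The factor n + 1 disappears
  on taking roots.\<close>

lemma (in abs_val) ultrametric_of_nat:
  assumes of_nat: "\<And>n. f (of_nat n) \<le> 1"
  shows "f (x + y) \<le> max (f x) (f y)"
proof (rule le_of_power_le_linear[where a = 1 and b = 1])
  fix n :: nat
  let ?m = "max (f x) (f y)"
  have "f (x + y) ^ n = f (\<Sum>k\<le>n. of_nat (n choose k) * x ^ k * y ^ (n - k))"
    by (simp add: binomial_ring flip: power)
  also have "\<dots> \<le> (\<Sum>k\<le>n. f (of_nat (n choose k) * x ^ k * y ^ (n - k)))"
    by (rule sum_le)
  also have "\<dots> \<le> (\<Sum>k\<le>n. ?m ^ n)"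
  proof (rule sum_mono)
    fix k assume "k \<in> {..n}"
    have "f (of_nat (n choose k) * x ^ k * y ^ (n - k)) \<le> 1 * ?m ^ k * ?m ^ (n - k)"
      unfolding mult power by (intro mult_mono of_nat power_mono) (simp_all add: le_max_iff_disj)
    with \<open>k \<in> {..n}\<close> show "f (of_nat (n choose k) * x ^ k * y ^ (n - k)) \<le> ?m ^ n"
      by (simp flip: power_add)
  qed
  finally show "f (x + y) ^ n \<le> (1 * real n + 1) * ?m ^ n"
    by (simp add: add.commute)
qed (simp add: le_max_iff_disj)

lemma (in abs_val) of_nat_le_one_of_ultrametric:
  assumes "\<And>x y. f (x + y) \<le> max (f x) (f y)"
  shows "f (of_nat n) \<le> 1"
proof (induction n)
  case (Suc n)
  then show ?case
    using assms[of 1 "of_nat n"] by simp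
qed simp

locale ultra_val = abs_val +
  assumes ultra: "f (x + y) \<le> max (f x) (f y)"
begin

lemma of_nat_le_one [simp]: "f (of_nat n) \<le> 1"
  by (rule of_nat_le_one_of_ultrametric) (rule ultra)

lemma of_int_le_one [simp]: "f (of_int i) \<le> 1"
  unfolding of_int_eq_of_nat by (rule of_nat_le_one)

lemma sum_le_bound:
  assumes "\<And>x. x \<in> A \<Longrightarrow> f (g x) \<le> c" "0 \<le> c"
  shows "f (sum g A) \<le> c"
  using assms
proof (induction A rule: infinite_finite_induct)
  case (insert x A)
  then have "max (f (g x)) (f (sum g A)) \<le> c" by simp
  with ultra[of "g x" "sum g A"] have "f (g x + sum g A) \<le> c"
    by (rule order_trans)
  then show ?case
    using insert by simp
qed simp_all

lemma sum_less_bound: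
  assumes "\<And>x. x \<in> A \<Longrightarrow> f (g x) < c" "0 < c"
  shows "f (sum g A) < c"
  using assms
proof (induction A rule: infinite_finite_induct)
  case (insert x A)
  then have "max (f (g x)) (f (sum g A)) < c" by simp
  with ultra[of "g x" "sum g A"] have "f (g x + sum g A) < c"
    by (rule le_less_trans)
  then show ?case
    using insert by simp
qed simp_all

end

section \<open>Absolute values of the rational numbers\<close>

lemma padic_abs_of_int:
  "n \<noteq> 0 \<Longrightarrow> padic_abs l (of_int n) = real l powi - int (multiplicity (int l) n)"
  by (simp add: padic_abs_def)

text \<open>Only \<open>g\<close> is assumed to be an absolute value. The function \<open>h\<close>
  stands for an explicit formula such as \<open>padic_abs l q powr s\<close>, of which
  multiplicativity is what can be checked directly.\<close>

lemma multiplicative_rat_eqI: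
  fixes g h :: "rat \<Rightarrow> real"
  assumes g: "abs_val g" and h: "\<And>x y. h (x * y) = h x * h y" "\<And>x. h (- x) = h x" "h 0 = 0"
    "\<And>x. x \<noteq> 0 \<Longrightarrow> h x \<noteq> 0"
    and eq: "\<And>n::nat. n > 0 \<Longrightarrow> g (of_nat n) = h (of_nat n)"
  shows "g = h"
proof
  fix q :: rat
  interpret g: abs_val g by fact
  obtain a b where ab: "q = of_int a / of_int b" "b > 0"
    using quotient_of_div[of q] quotient_of_denom_pos[of q] by (cases "quotient_of q") auto
  have nat: "g (of_nat n) = h (of_nat n)" for n
    using eq[of n] h(3) by (cases "n = 0") simp_all
  have int: "g (of_int i) = h (of_int i)" for i
    using nat[of "nat \<bar>i\<bar>"] h(2)[of "of_int i"] by (cases "i \<ge> 0") auto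
  have "h q * h (of_int b) = h (of_int a)"
    using ab by (simp flip: h(1))
  moreover have "g q * g (of_int b) = g (of_int a)"
    using ab by (simp flip: g.mult)
  ultimately have "g q * h (of_int b) = h q * h (of_int b)"
    by (simp only: int)
  moreover have "h (of_int b) \<noteq> 0"
    using ab by (intro h(4)) simp
  ultimately show "g q = h q"
    by simp
qed

lemma padic_abs_simps:
  assumes "prime l"
  shows padic_abs_mult: "padic_abs l (x * y) = padic_abs l x * padic_abs l y"
    and padic_abs_minus: "padic_abs l (- x) = padic_abs l x"
    and padic_abs_0: "padic_abs l 0 = 0"
    and padic_abs_neq_0: "x \<noteq> 0 \<Longrightarrow> padic_abs l x \<noteq> 0"
    and padic_abs_pos: "x \<noteq> 0 \<Longrightarrow> padic_abs l x > 0"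
    and padic_abs_nonneg: "padic_abs l x \<ge> 0"
proof -
  define P where "P = int l"
  have P: "prime P" "real l = of_int P"
    using assms by (simp_all add: P_def)
  \<comment> \<open>\<open>padic_abs\<close> is defined through lowest terms. Cross multiplication
    and additivity of multiplicities make the formula valid for every fraction, so products need not
    be reduced.\<close>
  have frac: "padic_abs l (of_int a / of_int b) =
      real l powi (int (multiplicity P b) - int (multiplicity P a))" if ab: "a \<noteq> 0" "b \<noteq> 0" for a b
  proof -
    define q where "q = (of_int a / of_int b :: rat)"
    obtain c d where cd: "quotient_of q = (c, d)" by fastforce
    then have "q = of_int c / of_int d" "d > 0"
      by (simp_all add: quotient_of_div quotient_of_denom_pos)
    with ab have "of_int (c * b) = (of_int (a * d) :: rat)" and nz: "c \<noteq> 0"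
      by (auto simp: q_def field_simps)
    then have "c * b = a * d"
      by (simp only: of_int_eq_iff)
    then have "multiplicity P (c * b) = multiplicity P (a * d)"
      by simp
    then have "multiplicity P c + multiplicity P b = multiplicity P a + multiplicity P d"
      using ab nz \<open>d > 0\<close> P by (simp add: prime_elem_multiplicity_mult_distrib)
    then have "int (multiplicity P d) - int (multiplicity P c) = int (multiplicity P b) - int (multiplicity P a)"
      by linarith
    moreover have "q \<noteq> 0"
      using ab by (simp add: q_def)
    ultimately show ?thesis
      unfolding padic_abs_def q_def[symmetric] using cd by (simp add: P_def)
  qed
  have repr: "\<exists>a b. x = of_int a / of_int b \<and> a \<noteq> 0 \<and> b \<noteq> 0" if "x \<noteq> 0" for x :: rat
  proof -
    obtain a b where ab: "quotient_of x = (a, b)" by fastforce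
    then have x: "x = of_int a / of_int b" and "b > 0"
      by (rule quotient_of_div, rule quotient_of_denom_pos)
    moreover have "a \<noteq> 0"
      using that unfolding x by auto
    ultimately show ?thesis
      by blast
  qed
  have l: "real l > 0"
    using assms by (simp add: prime_gt_0_nat)
  show pos: "padic_abs l x > 0" if nz: "x \<noteq> 0" for x
  proof -
    from repr[OF nz] obtain a b where "x = of_int a / of_int b" "a \<noteq> 0" "b \<noteq> 0"
      by (elim exE conjE)
    then show ?thesis
      using l by (simp add: frac zero_less_power_int)
  qed
  show "padic_abs l x \<noteq> 0" if "x \<noteq> 0" for x
    using pos[OF that] by simp
  show 0: "padic_abs l 0 = 0"
    by (simp add: padic_abs_def)
  show "padic_abs l x \<ge> 0" for x
    using pos[of x] 0 by (cases "x = 0") simp_all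
  show "padic_abs l (x * y) = padic_abs l x * padic_abs l y" for x y
  proof (cases "x = 0 \<or> y = 0")
    case False
    then obtain a b c d where x: "x = of_int a / of_int b" "a \<noteq> 0" "b \<noteq> 0"
      and y: "y = of_int c / of_int d" "c \<noteq> 0" "d \<noteq> 0"
      using repr[of x] repr[of y] by blast
    have xy: "x * y = of_int (a * c) / of_int (b * d)"
      by (simp add: x y)
    have "multiplicity P (a * c) = multiplicity P a + multiplicity P c"
      "multiplicity P (b * d) = multiplicity P b + multiplicity P d"
      using x y P by (simp_all add: prime_elem_multiplicity_mult_distrib)
    moreover have "a * c \<noteq> 0" "b * d \<noteq> 0"
      using x y by simp_all
    ultimately have "padic_abs l (x * y) = real l powi
        ((int (multiplicity P b) - int (multiplicity P a)) + (int (multiplicity P d) - int (multiplicity P c)))"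
      unfolding xy by (subst frac) (simp_all add: algebra_simps)
    then show ?thesis
      using x y l by (simp add: frac power_int_add)
  qed (auto simp: 0)
  show "padic_abs l (- x) = padic_abs l x" for x
  proof (cases "x = 0")
    case False
    from repr[OF this] obtain a b where x: "x = of_int a / of_int b" "a \<noteq> 0" "b \<noteq> 0"
      by (elim exE conjE)
    have "padic_abs l (- x) = padic_abs l (of_int (- a) / of_int b)"
      by (simp only: x of_int_minus minus_divide_left)
    also have "\<dots> = padic_abs l x"
      using x by (simp only: frac neg_equal_0_iff_equal multiplicity_uminus_right not_False_eq_True)
    finally show ?thesis .
  qed simp
qed

text \<open>By Bezout 1 is an integral combination of \<open>m\<close> and \<open>l\<close>; if both
  had value below 1, the ultrametric inequality would give 1 a value below 1.\<close>

lemma (in abs_val) of_nat_eq_one_of_coprime: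
  assumes le: "\<And>n. f (of_nat n) \<le> 1" and l: "f (of_nat l) < 1" and "coprime m l"
  shows "f (of_nat m) = 1"
proof (rule ccontr)
  assume "f (of_nat m) \<noteq> 1"
  with le[of m] have m: "f (of_nat m) < 1" by simp
  interpret ultra_val f
    by unfold_locales (rule ultrametric_of_nat[OF le])
  obtain a b :: int where ab: "a * int m + b * int l = 1"
    using \<open>coprime m l\<close> bezout_int[of "int m" "int l"] by auto
  have "f (of_int (a * int m) + of_int (b * int l)) = 1"
    by (simp only: ab one of_int_1 flip: of_int_add)
  moreover have "f (of_int (c * int k)) < 1" if "f (of_nat k) < 1" for c k
  proof -
    have "f (of_int (c * int k)) = f (of_int c) * f (of_nat k)"
      by (simp add: mult)
    also have "\<dots> \<le> 1 * f (of_nat k)"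
      by (intro mult_right_mono) simp_all
    finally show ?thesis
      using that by simp
  qed
  then have "f (of_int (a * int m)) < 1" "f (of_int (b * int l)) < 1"
    using m l by blast+
  ultimately show False
    using ultra[of "of_int (a * int m)" "of_int (b * int l)"] by linarith
qed

lemma padic_abs_of_nat_power_mult:
  assumes l: "prime l" and "\<not> l dvd m"
  shows "padic_abs l (of_nat (l ^ k * m)) = real l powi - int k"
proof -
  have m: "m \<noteq> 0" using assms(2) by (auto intro: ccontr)
  have "multiplicity (int l) (int (l ^ k * m)) = k"
  proof (rule multiplicity_eqI)
    show "int l ^ k dvd int (l ^ k * m)"
      by simp
    have "\<not> l ^ Suc k dvd l ^ k * m"
      using assms prime_gt_0_nat[OF l] by (metis dvd_mult_cancel power_Suc2 zero_less_power)
    then show "\<not> int l ^ Suc k dvd int (l ^ k * m)"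
      by (simp only: int_dvd_int_iff not_False_eq_True flip: of_nat_power)
  qed
  then show ?thesis
    using padic_abs_of_int[of "int (l ^ k * m)" l] m prime_gt_0_nat[OF l] by simp
qed

text \<open>The prime is the least positive integer of value below 1: in a factorization one factor
  again has value below 1, so by minimality it is the whole number. Integers not divisible by it
  have value 1, so the value at \<open>l\<close> determines everything.\<close>

lemma ostrowski_nonarchimedean:
  fixes f :: "rat \<Rightarrow> real" and x
  assumes "abs_val f" and le: "\<And>n. f (of_nat n) \<le> 1" and nontriv: "x \<noteq> 0" "f x \<noteq> 1"
  shows "\<exists>l (s::real). prime l \<and> s > 0 \<and> f = (\<lambda>q. padic_abs l q powr s)"
proof -
  interpret abs_val f by fact
  have "\<exists>n>0. f (of_nat n) < 1"
  proof (rule ccontr)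
    assume "\<not> ?thesis"
    then have eq: "f (of_nat n) = 1" if "n > 0" for n
      using le[of n] that by (meson antisym not_less)
    have "f = (\<lambda>q. if q = 0 then 0 else 1)"
      by (rule multiplicative_rat_eqI) (use assms(1) eq in simp_all)
    then have "f x = (if x = 0 then 0 else 1)"
      by (rule fun_cong)
    with nontriv show False by simp
  qed
  define l where "l = (LEAST n. n > 0 \<and> f (of_nat n) < 1)"
  have l: "l > 0" "f (of_nat l) < 1"
    using LeastI_ex[OF \<open>\<exists>n>0. f (of_nat n) < 1\<close>] by (simp_all add: l_def)
  have least: "l \<le> n" if "n > 0" "f (of_nat n) < 1" for n
    unfolding l_def by (rule Least_le) (use that in simp)
  have "prime l"
    unfolding prime_nat_iff
  proof (intro conjI allI impI)
    show "1 < l"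
      using l by (cases "l = 1") simp_all
  next
    fix a assume "a dvd l"
    then obtain b where ab: "a * b = l" by (auto elim: dvdE)
    have "f (of_nat a) * f (of_nat b) < 1"
      using l by (simp flip: mult ab)
    then have "f (of_nat a) < 1 \<or> f (of_nat b) < 1"
      using le[of a] le[of b] by (cases "f (of_nat a) = 1") auto
    then have "l \<le> a \<or> l \<le> b"
      using least ab l(1) by (metis gr0I mult_is_0)
    then have "b = 1 \<or> a = 1"
      using ab l(1) by auto
    then show "a = 1 \<or> a = l"
      using ab by auto
  qed
  \<comment> \<open>Chosen so that \<open>f\<close> takes the value \<open>l powr - s\<close> at
    \<open>l\<close>, where the l-adic absolute value is 1 / l.\<close>
  define s where "s = - ln (f (of_nat l)) / ln (real l)"
  have l1: "real l > 1"
    using \<open>prime l\<close> prime_gt_1_nat by auto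
  have s: "s > 0"
    using l l1 by (simp add: s_def divide_neg_pos)
  have fl: "f (of_nat l) = real l powr - s"
    using l l1 by (simp add: powr_def s_def)
  have "f = (\<lambda>q. padic_abs l q powr s)"
  proof (rule multiplicative_rat_eqI)
    fix n :: nat assume "n > 0"
    then obtain m where m: "n = l ^ multiplicity l n * m" "\<not> l dvd m"
      using multiplicity_decompose'[of n l] \<open>prime l\<close> by (metis neq0_conv not_prime_unit)
    define k where "k = multiplicity l n"
    have n: "n = l ^ k * m" "\<not> l dvd m"
      using m by (simp_all add: k_def)
    then have "coprime m l"
      using \<open>prime l\<close> by (simp add: prime_imp_coprime coprime_commute)
    then have "f (of_nat m) = 1"
      using le l(2) by (intro of_nat_eq_one_of_coprime)
    then have "f (of_nat n) = f (of_nat l) ^ k"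
      by (simp add: n mult power)
    also have "\<dots> = (real l powr - real k) powr s"
      using l1 by (simp add: fl powr_powr powr_power mult.commute)
    also have "real l powr - real k = real l powi - int k"
      using l1 by (simp add: powr_minus powr_realpow power_int_minus)
    also have "\<dots> = padic_abs l (of_nat n)"
      unfolding n using padic_abs_of_nat_power_mult[OF \<open>prime l\<close> n(2)] by simp
    finally show "f (of_nat n) = padic_abs l (of_nat n) powr s" .
  qed (use assms(1) \<open>prime l\<close> in \<open>simp_all add: padic_abs_mult padic_abs_minus padic_abs_0 padic_abs_neq_0 powr_mult padic_abs_nonneg\<close>)
  with \<open>prime l\<close> s show ?thesis by blast
qed

text \<open>Induction on the number \<open>t\<close> of digits in base \<open>n\<close>: dividing by
  \<open>n\<close> costs a factor \<open>f (of_nat n)\<close>, and the digit split off has value at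
  most \<open>n\<close>. The maximum with 1 keeps the powers increasing in \<open>t\<close>.\<close>

lemma (in abs_val) of_nat_digit_bound:
  fixes n :: nat
  assumes n: "n \<ge> 2" and m: "m < n ^ t"
  shows "f (of_nat m) \<le> real t * real n * max 1 (f (of_nat n)) ^ t"
  using m
proof (induction t arbitrary: m)
  case (Suc t)
  define A where "A = max 1 (f (of_nat n))"
  have A: "A \<ge> 1" "f (of_nat n) \<le> A"
    by (simp_all add: A_def)
  have "m div n < n ^ t"
    using Suc.prems by (simp add: less_mult_imp_div_less mult.commute)
  then have IH: "f (of_nat (m div n)) \<le> real t * real n * A ^ t"
    unfolding A_def by (rule Suc.IH)
  have "f (of_nat m) = f (of_nat n * of_nat (m div n) + of_nat (m mod n))"
    by (simp only: mult_div_mod_eq flip: of_nat_mult of_nat_add)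
  also have "\<dots> \<le> f (of_nat n) * f (of_nat (m div n)) + f (of_nat (m mod n))"
    using triangle[of "of_nat n * of_nat (m div n)"] by (simp add: mult)
  also have "\<dots> \<le> A * (real t * real n * A ^ t) + real n * A ^ Suc t"
  proof (rule add_mono)
    show "f (of_nat n) * f (of_nat (m div n)) \<le> A * (real t * real n * A ^ t)"
      using A IH by (intro mult_mono) auto
    have "f (of_nat (m mod n)) \<le> real (m mod n)"
      by (rule of_nat_le)
    also have "\<dots> \<le> real n"
      using n by (simp add: less_imp_le)
    also have "real n * 1 \<le> real n * A ^ Suc t"
      using A(1) by (intro mult_left_mono one_le_power) simp_all
    finally show "f (of_nat (m mod n)) \<le> real n * A ^ Suc t" by simp
  qed
  also have "\<dots> = real (Suc t) * real n * A ^ Suc t"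
    by (simp add: algebra_simps)
  finally show ?case
    unfolding A_def .
qed simp

text \<open>The digit bound is applied to \<open>m ^ k\<close>, whose number of digits in base
  \<open>n\<close> grows like k times \<open>log n m\<close>. The remaining factor is linear in k
  and does not survive the k-th root.\<close>

lemma (in abs_val) of_nat_le_powr_log:
  fixes m n :: nat
  assumes n: "n \<ge> 2" and m: "m \<ge> 1"
  shows "f (of_nat m) \<le> max 1 (f (of_nat n)) powr log n m"
proof -
  define A L where "A = max 1 (f (of_nat n))" and "L = log n m"
  have A: "A \<ge> 1" by (simp add: A_def)
  have L: "L \<ge> 0"
    using n m by (simp add: L_def)
  have "f (of_nat m) ^ k \<le> (L * n * A * k + n * A) * (A powr L) ^ k" for k
  proof -
    \<comment> \<open>Enough digits to write \<open>m ^ k\<close> in base \<open>n\<close>; the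
      added 1 makes \<open>m ^ k < n ^ t\<close> strict.\<close>
    define t where "t = nat \<lfloor>L * k\<rfloor> + 1"
    have t: "L * k < t" "t \<le> L * k + 1"
      using L unfolding t_def by (simp_all add: of_nat_nat floor_less_iff) linarith+
    have "real (m ^ k) = (real n powr L) ^ k"
      using n m by (simp add: L_def)
    also have "\<dots> = real n powr (L * k)"
      using n by (simp add: powr_power mult.commute)
    also have "\<dots> < real n powr t"
      using t n by simp
    also have "\<dots> = real (n ^ t)"
      using n by (simp add: powr_realpow)
    finally have "m ^ k < n ^ t"
      by (simp only: of_nat_less_iff)
    then have "f (of_nat (m ^ k)) \<le> real t * real n * A ^ t"
      unfolding A_def by (rule of_nat_digit_bound[OF n])
    also have "A ^ t = A powr t"
      using A by (simp add: powr_realpow)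
    also have "real t * real n * A powr t \<le> (L * k + 1) * real n * A powr (L * k + 1)"
      using t A L by (intro mult_mono powr_mono) simp_all
    also have "\<dots> = (L * n * A * k + n * A) * (A powr L) ^ k"
      using A by (simp add: powr_add powr_power algebra_simps)
    finally show ?thesis
      by (simp add: power)
  qed
  then show ?thesis
    unfolding A_def L_def by (rule le_of_power_le_linear[rotated]) simp
qed

text \<open>One integer \<open>n \<ge> 2\<close> of value at most 1 would, taken as the base, bound
  all integers by 1. So all of them exceed 1, and the logarithmic bound read in both directions
  shows that \<open>ln (f (of_nat m)) / ln m\<close> is the same for all
  \<open>m \<ge> 2\<close>.\<close>

lemma ostrowski_archimedean:
  fixes f :: "rat \<Rightarrow> real"
  assumes "abs_val f" and gt: "f (of_nat n0) > 1"
  shows "\<exists>s>0. f = (\<lambda>q. \<bar>real_of_rat q\<bar> powr s)"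
proof -
  interpret abs_val f by fact
  have gt1: "f (of_nat n) > 1" if n: "n \<ge> 2" for n
  proof (rule ccontr)
    assume "\<not> ?thesis"
    then have "max 1 (f (of_nat n)) = 1" by simp
    moreover have "n0 \<ge> 1"
      using gt by (cases n0) simp_all
    ultimately have "f (of_nat n0) \<le> 1"
      using of_nat_le_powr_log[OF n, of n0] by simp
    with gt show False by simp
  qed
  have le: "ln (f (of_nat m)) / ln m \<le> ln (f (of_nat n)) / ln n" if mn: "m \<ge> 2" "n \<ge> 2" for m n :: nat
  proof -
    have "f (of_nat m) \<le> f (of_nat n) powr log n m"
      using of_nat_le_powr_log[of n m] mn gt1[of n] by simp
    then have "ln (f (of_nat m)) \<le> ln (f (of_nat n) powr log n m)"
      using gt1[OF mn(1)] mn by (intro ln_mono) auto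
    also have "\<dots> = log n m * ln (f (of_nat n))"
      using gt1[OF mn(2)] by (simp add: ln_powr)
    finally show ?thesis
      using mn by (simp add: log_def field_simps)
  qed
  define s where "s = ln (f 2) / ln 2"
  have s: "s > 0"
    using gt1[of 2] by (simp add: s_def)
  have fn: "f (of_nat n) = real n powr s" if "n > 0" for n
  proof (cases "n = 1")
    case False
    with that have n: "n \<ge> 2" by simp
    with le[of n 2] le[of 2 n] have "ln (f (of_nat n)) / ln n = s"
      by (simp add: s_def)
    then have "ln (f (of_nat n)) = s * ln n"
      using n by (simp add: field_simps)
    then have "exp (ln (f (of_nat n))) = exp (s * ln n)"
      by simp
    then show ?thesis
      using gt1[OF n] n by (simp add: powr_def)
  qed simp
  have "f = (\<lambda>q. \<bar>real_of_rat q\<bar> powr s)"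
    by (rule multiplicative_rat_eqI)
      (use assms(1) fn in \<open>simp_all add: of_rat_mult of_rat_minus abs_mult powr_mult\<close>)
  with s show ?thesis by blast
qed

section \<open>Places and normalized absolute values\<close>

lemma nontrivial_abs_iff: "f \<in> nontrivial_abs \<longleftrightarrow> abs_val f \<and> (\<exists>x. x \<noteq> 0 \<and> f x \<noteq> 1)"
  by (simp add: nontrivial_abs_def absolute_value_class_iff)

lemma equiv_abs_equiv: "equiv nontrivial_abs (abs_equiv :: (('a::field \<Rightarrow> real) \<times> _) set)"
proof (rule equivI)
  show "abs_equiv \<subseteq> nontrivial_abs \<times> (nontrivial_abs :: ('a \<Rightarrow> real) set)"
    by (auto simp: abs_equiv_def)
  show "refl_on nontrivial_abs (abs_equiv :: (('a \<Rightarrow> real) \<times> _) set)"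
    by (rule refl_onI) (auto simp: abs_equiv_def nontrivial_abs_iff abs_val_def intro!: exI[of _ 1])
  show "sym (abs_equiv :: (('a \<Rightarrow> real) \<times> _) set)"
  proof (rule symI)
    fix f g :: "'a \<Rightarrow> real" assume fg: "(f, g) \<in> abs_equiv"
    then obtain s where s: "s > 0" "\<forall>x. g x = f x powr s" and nt: "f \<in> nontrivial_abs" "g \<in> nontrivial_abs"
      by (auto simp: abs_equiv_def)
    interpret abs_val f
      using nt by (simp add: nontrivial_abs_iff)
    have "\<forall>x. f x = g x powr (1 / s)"
      using s by (simp add: powr_powr)
    then show "(g, f) \<in> abs_equiv"
      using nt s by (auto simp: abs_equiv_def intro!: exI[of _ "1 / s"])
  qed
  show "trans (abs_equiv :: (('a \<Rightarrow> real) \<times> _) set)"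
    by (rule transI) (auto simp: abs_equiv_def powr_powr intro: mult_pos_pos)
qed

lemma place_of_abs:
  assumes "f \<in> nontrivial_abs"
  shows "abs_equiv `` {f} \<in> places" "f \<in> abs_equiv `` {f}"
  unfolding places_def using assms by (rule quotientI, rule equiv_class_self[OF equiv_abs_equiv])

lemma place_nonempty:
  assumes "v \<in> places"
  obtains f where "f \<in> v"
  using assms equiv_abs_equiv unfolding places_def by (metis equals0I in_quotient_imp_non_empty)

lemma place_eq_class:
  assumes "v \<in> places" "f \<in> v"
  shows "f \<in> nontrivial_abs" "v = abs_equiv `` {f}"
proof -
  obtain g where g: "v = abs_equiv `` {g}"
    using assms(1) unfolding places_def by (rule quotientE)
  with assms(2) have gf: "(g, f) \<in> abs_equiv"
    by simp
  then show "f \<in> nontrivial_abs"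
    by (auto simp: abs_equiv_def)
  show "v = abs_equiv `` {f}"
    unfolding g by (rule equiv_class_eq[OF equiv_abs_equiv gf])
qed

lemma place_abs_val: "v \<in> places \<Longrightarrow> f \<in> v \<Longrightarrow> abs_val f"
  using place_eq_class(1) nontrivial_abs_iff by blast

lemma place_powr:
  assumes "v \<in> places" "f \<in> v" "g \<in> v"
  obtains s where "s > 0" "\<And>x. g x = f x powr s"
proof -
  have "(f, g) \<in> abs_equiv"
    using assms place_eq_class(2)[OF assms(1,2)] by auto
  then show ?thesis
    using that by (auto simp: abs_equiv_def)
qed

text \<open>A power with exponent above 1 can violate the triangle inequality, hence the separate
  assumption that \<open>g\<close> is an absolute value.\<close>

lemma place_powrI:
  assumes "v \<in> places" "f \<in> v" "s > 0" "abs_val g" and g: "\<And>x. g x = f x powr s"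
  shows "g \<in> v"
proof -
  interpret abs_val f
    using assms(1,2) by (rule place_abs_val)
  have f: "f \<in> nontrivial_abs"
    using assms(1,2) by (rule place_eq_class)
  then obtain x where "x \<noteq> 0" "f x \<noteq> 1"
    by (auto simp: nontrivial_abs_iff)
  then have "g x \<noteq> 1"
    using \<open>s > 0\<close> by (auto simp: g powr_def)
  with \<open>x \<noteq> 0\<close> have "g \<in> nontrivial_abs"
    using assms by (auto simp: nontrivial_abs_iff)
  then have "(f, g) \<in> abs_equiv"
    using f assms by (auto simp: abs_equiv_def)
  then show ?thesis
    using place_eq_class(2)[OF assms(1,2)] by auto
qed

section \<open>Linear relations over the rationals and restriction of absolute values\<close>

lemma number_field_dependent:
  fixes g :: "'i \<Rightarrow> 'a::field_char_0"
  assumes B: "finite_dimensional_vector_space (\<lambda>(q::rat) (x::'a). of_rat q * x) B"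
    and I: "finite I" "card B < card I"
  obtains q :: "'i \<Rightarrow> rat" and j where "j \<in> I" "q j \<noteq> 0" "(\<Sum>i\<in>I. of_rat (q i) * g i) = 0"
proof -
  interpret finite_dimensional_vector_space "\<lambda>(q::rat) (x::'a). of_rat q * x" B
    by fact
  show ?thesis
  proof (cases "inj_on g I")
    case True
    then have "card (g ` I) = card I"
      by (rule card_image)
    have "dependent (g ` I)"
    proof (rule ccontr)
      assume "\<not> dependent (g ` I)"
      then have "card (g ` I) \<le> dim (UNIV :: 'a set)"
        by (intro independent_card_le_dim) auto
      then show False
        using I \<open>card (g ` I) = card I\<close> by (simp add: dim_UNIV)
    qed
    then obtain u where u: "\<exists>y\<in>g ` I. u y \<noteq> 0" "(\<Sum>y\<in>g ` I. of_rat (u y) * y) = 0"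
      using I by (auto simp: dependent_finite)
    then show ?thesis
      using True that[of _ "u \<circ> g"] by (auto simp: sum.reindex)
  next
    case False
    \<comment> \<open>Dependence of a set does not see repetitions in a family, so two equal members
      need their own relation, with coefficients 1 and -1.\<close>
    then obtain i j where ij: "i \<in> I" "j \<in> I" "i \<noteq> j" "g i = g j"
      by (auto simp: inj_on_def)
    have "(\<Sum>k\<in>I. of_rat ((if k = i then 1 else 0) - (if k = j then 1 else 0)) * g k)
        = (\<Sum>k\<in>I. (if k = i then g k else 0)) - (\<Sum>k\<in>I. (if k = j then g k else 0))"
      by (subst sum_subtractf[symmetric], rule sum.cong) auto
    also have "\<dots> = 0"
      using I ij by simp
    finally show ?thesis
      using ij that[of i "\<lambda>k. (if k = i then 1 else 0) - (if k = j then 1 else 0)"] by simp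
  qed
qed

lemma number_field_spanning:
  assumes "number_field TYPE('a::field_char_0)"
  obtains B :: "'a::field_char_0 set" where "finite B" "\<And>x. \<exists>q. x = (\<Sum>b\<in>B. of_rat (q b) * b)"
proof -
  from assms obtain B :: "'a set"
    where "finite_dimensional_vector_space (\<lambda>(q::rat) (x::'a). of_rat q * x) B"
    by (auto simp: number_field_def)
  then interpret finite_dimensional_vector_space "\<lambda>(q::rat) (x::'a). of_rat q * x" B .
  have "x \<in> span B" for x
    using span_Basis by simp
  then have "\<exists>q. x = (\<Sum>b\<in>B. of_rat (q b) * b)" for x
    unfolding span_finite[OF finite_Basis] by auto
  then show ?thesis
    using that finite_Basis by blast
qed

lemma abs_val_of_rat:
  assumes "abs_val (f :: 'a::field_char_0 \<Rightarrow> real)"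
  shows "abs_val (f \<circ> of_rat)"
proof -
  interpret abs_val f by fact
  show ?thesis
    by unfold_locales (simp_all add: mult of_rat_mult of_rat_add triangle)
qed

text \<open>If \<open>f\<close> were trivial on the rationals, expanding \<open>x ^ n\<close> in a
  fixed spanning set would bound all powers of \<open>x\<close> at once. Then \<open>f\<close> is at
  most 1 everywhere, and inverses turn this into equality. This is why a place of the field has a
  place below it.\<close>

lemma nontrivial_abs_of_rat:
  assumes "number_field TYPE('a::field_char_0)" and "f \<in> nontrivial_abs"
  shows "(f :: 'a \<Rightarrow> real) \<circ> of_rat \<in> nontrivial_abs"
proof -
  interpret abs_val f
    using assms by (simp add: nontrivial_abs_iff)
  obtain B :: "'a set" where B: "finite B" "\<And>x. \<exists>q. x = (\<Sum>b\<in>B. of_rat (q b) * b)"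
    using number_field_spanning[OF assms(1)] by blast
  have "\<exists>q. q \<noteq> 0 \<and> f (of_rat q) \<noteq> 1"
  proof (rule ccontr)
    assume "\<not> ?thesis"
    then have triv: "f (of_rat q) \<le> 1" for q
      by (cases "q = 0") auto
    have le: "f x \<le> 1" for x
    proof (rule bounded_imp_le_one)
      fix n :: nat
      obtain q where q: "x ^ n = (\<Sum>b\<in>B. of_rat (q b) * b)"
        using B(2) by blast
      have "f x ^ n = f (\<Sum>b\<in>B. of_rat (q b) * b)"
        by (simp flip: power q)
      also have "\<dots> \<le> (\<Sum>b\<in>B. f (of_rat (q b) * b))"
        by (rule sum_le)
      also have "\<dots> \<le> (\<Sum>b\<in>B. 1 * f b)"
        unfolding mult by (intro sum_mono mult_right_mono triv) simp
      finally show "f x ^ n \<le> (\<Sum>b\<in>B. 1 * f b)" .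
    qed
    have "f x = 1" if "x \<noteq> 0" for x
    proof (rule antisym[OF le])
      have "1 = f x * f (inverse x)"
        using that by (simp flip: mult)
      also have "\<dots> \<le> f x * 1"
        by (intro mult_left_mono le) simp
      finally show "1 \<le> f x" by simp
    qed
    with assms(2) show False
      by (auto simp: nontrivial_abs_iff)
  qed
  then show ?thesis
    using abs_val_of_rat[of f] abs_val_axioms by (auto simp: nontrivial_abs_iff)
qed

text \<open>The candidates among which \<open>usual_abs\<close> selects the member of a rational
  place.\<close>

definition standard_abs :: "(rat \<Rightarrow> real) set" where
  "standard_abs = insert (\<lambda>q. \<bar>real_of_rat q\<bar>) {padic_abs l |l. prime l}"

text \<open>The final bound on integers is what \<open>triangle_powr\<close> requires, so that the
  root with exponent \<open>1 / s\<close> is again an absolute value, and this for any extension of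
  \<open>f\<close> to a larger field.\<close>

lemma ostrowski:
  assumes "f \<in> nontrivial_abs"
  obtains g s where "g \<in> standard_abs" "s > 0" "f = (\<lambda>q. g q powr s)"
    "\<And>n. f (of_nat n) \<le> of_nat n powr s"
proof -
  interpret abs_val f
    using assms by (simp add: nontrivial_abs_iff)
  show ?thesis
  proof (cases "\<forall>n. f (of_nat n) \<le> 1")
    case True
    from assms obtain x where "x \<noteq> 0" "f x \<noteq> 1"
      by (auto simp: nontrivial_abs_iff)
    with ostrowski_nonarchimedean[OF abs_val_axioms, of x] True
    obtain l s where l: "prime l" "s > 0" "f = (\<lambda>q. padic_abs l q powr s)"
      by auto
    have "f (of_nat n) \<le> of_nat n powr s" for n
    proof (cases "n = 0")
      case False
      have "f (of_nat n) \<le> 1"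
        using True by simp
      also have "1 \<le> real n powr s"
        using False l by (intro ge_one_powr_ge_zero) auto
      finally show ?thesis .
    qed simp
    with l show ?thesis
      using that[of "padic_abs l" s] by (auto simp: standard_abs_def)
  next
    case False
    then obtain n where "f (of_nat n) > 1"
      by (auto simp: not_le)
    with ostrowski_archimedean[OF abs_val_axioms]
    obtain s where s: "s > 0" "f = (\<lambda>q. \<bar>real_of_rat q\<bar> powr s)"
      by blast
    then have "f (of_nat n) \<le> of_nat n powr s" for n
      by simp
    with s show ?thesis
      using that[of "\<lambda>q. \<bar>real_of_rat q\<bar>" s] by (auto simp: standard_abs_def)
  qed
qed

text \<open>Ostrowski's exponent \<open>s\<close> of the restriction is divided out on the whole
  field. For \<open>s < 1\<close> this raises to a power above 1, where the triangle inequality is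
  no longer automatic and comes from \<open>triangle_powr\<close>.\<close>

lemma normalized_abs_exists:
  assumes "number_field TYPE('a::field_char_0)" and "(v :: 'a place) \<in> places"
  obtains M where "M \<in> v" "M \<circ> of_rat \<in> standard_abs"
proof -
  obtain f where f: "f \<in> v"
    using assms(2) by (rule place_nonempty)
  then have nt: "f \<in> nontrivial_abs"
    using assms place_eq_class by blast
  interpret abs_val f
    using nt by (simp add: nontrivial_abs_iff)
  obtain g s where g: "g \<in> standard_abs" and s: "s > 0" and fg: "f \<circ> of_rat = (\<lambda>q. g q powr s)"
    and le: "\<And>n. (f \<circ> of_rat) (of_nat n) \<le> of_nat n powr s"
    by (rule ostrowski[OF nontrivial_abs_of_rat[OF assms(1) nt]]) (rule that)
  define M where "M = (\<lambda>x. f x powr (1 / s))"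
  have "abs_val M"
  proof
    show "M (x + y) \<le> M x + M y" for x y
      unfolding M_def using s le by (intro triangle_powr) (simp_all add: comp_def)
  qed (simp_all add: M_def mult powr_mult)
  then have "M \<in> v"
    using s by (intro place_powrI[OF assms(2) f, of "1 / s"]) (simp_all add: M_def)
  moreover have "M \<circ> of_rat = g"
  proof
    fix q
    have "g q \<ge> 0"
      using g padic_abs_nonneg by (auto simp: standard_abs_def)
    then show "(M \<circ> of_rat) q = g q"
      using fun_cong[OF fg, of q] s unfolding M_def comp_def by (simp only: powr_powr) simp
  qed
  ultimately show ?thesis
    using that g by simp
qed

text \<open>Equivalent absolute values agree on which elements have value below 1. A prime
  \<open>l\<close> has value below 1 for its own p-adic absolute value and for no other candidate,
  so a place contains at most one of them.\<close>

lemma usual_abs_eq: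
  assumes p: "p \<in> places" and g: "g \<in> p" "g \<in> standard_abs"
  shows "usual_abs p = g"
  unfolding usual_abs_def
proof (rule the_equality)
  show "g \<in> p \<and> (g = (\<lambda>q. \<bar>real_of_rat q\<bar>) \<or> (\<exists>l. prime l \<and> g = padic_abs l))"
    using g by (auto simp: standard_abs_def)
next
  fix h assume h: "h \<in> p \<and> (h = (\<lambda>q. \<bar>real_of_rat q\<bar>) \<or> (\<exists>l. prime l \<and> h = padic_abs l))"
  obtain s where s: "s > 0" "\<And>x. h x = g x powr s"
    using place_powr[OF p g(1)] h by blast
  have lt: "h x < 1 \<longleftrightarrow> g x < 1" for x
  proof -
    have "g x \<ge> 0"
      using g padic_abs_nonneg by (auto simp: standard_abs_def)
    then show ?thesis
      using s powr_less_mono2[of s "g x" 1] powr_mono2[of s 1 "g x"] by fastforce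
  qed
  have self: "padic_abs l (of_nat l) < 1" if "prime l" for l
  proof -
    have "padic_abs l (of_nat l) = inverse (real l)"
      using padic_abs_of_nat_power_mult[OF that, of 1 1] prime_gt_1_nat[OF that]
      by (simp add: power_int_minus)
    then show ?thesis
      using prime_gt_1_nat[OF that] by (simp add: inverse_less_1_iff)
  qed
  have other: "padic_abs l (of_nat m) = 1" if "prime l" "prime m" "l \<noteq> m" for l m
    using padic_abs_of_nat_power_mult[OF that(1), of m 0] that primes_dvd_imp_eq[of l m] by auto
  have usual: "\<not> \<bar>real_of_rat (of_nat l)\<bar> < 1" if "prime l" for l
    using prime_gt_1_nat[OF that] by simp
  show "h = g"
    using h g(2) lt self other usual unfolding standard_abs_def
    by (smt (verit) insert_iff mem_Collect_eq)
qed

lemma place_below_eq: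
  assumes "number_field TYPE('a::field_char_0)" and v: "(v :: 'a place) \<in> places" and f: "f \<in> v"
  shows "place_below v = abs_equiv `` {f \<circ> of_rat}"
  unfolding place_below_def
proof (rule the_equality)
  have nt: "g \<circ> of_rat \<in> nontrivial_abs" if "g \<in> v" for g
    using nontrivial_abs_of_rat assms(1) place_eq_class(1)[OF v that] by blast
  show "abs_equiv `` {f \<circ> of_rat} \<in> places \<and> (\<forall>g\<in>v. g \<circ> of_rat \<in> abs_equiv `` {f \<circ> of_rat})"
  proof (intro conjI ballI)
    show "abs_equiv `` {f \<circ> of_rat} \<in> places"
      using nt[OF f] by (rule place_of_abs)
    fix g assume g: "g \<in> v"
    obtain s where "s > 0" "\<And>x. g x = f x powr s"
      using place_powr[OF v f g] by blast
    then show "g \<circ> of_rat \<in> abs_equiv `` {f \<circ> of_rat}"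
      using nt[OF f] nt[OF g] by (auto simp: abs_equiv_def)
  qed
  fix p :: "rat place" assume "p \<in> places \<and> (\<forall>g\<in>v. g \<circ> of_rat \<in> p)"
  then show "p = abs_equiv `` {f \<circ> of_rat}"
    using f place_eq_class(2) by blast
qed

section \<open>Completions\<close>

text \<open>Fixing one member \<open>M\<close> replaces the quantification over all members, which
  the Cauchy ring and the null ideal use, by ordinary estimates.\<close>

locale valued_place = abs_val M for M :: "'a::field \<Rightarrow> real" +
  fixes v :: "'a place"
  assumes place: "v \<in> places" and mem: "M \<in> v"
begin

definition cau :: "(nat \<Rightarrow> 'a) \<Rightarrow> bool" where
  "cau s \<longleftrightarrow> (\<forall>e>0. \<exists>N. \<forall>m\<ge>N. \<forall>n\<ge>N. M (s m - s n) < e)"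

lemma cauD: "cau s \<Longrightarrow> e > 0 \<Longrightarrow> \<exists>N. \<forall>m\<ge>N. \<forall>n\<ge>N. M (s m - s n) < e"
  by (simp add: cau_def)

text \<open>Any other member is a power of \<open>M\<close> with some exponent \<open>a > 0\<close>,
  so the tolerance \<open>e\<close> for it corresponds to \<open>e powr (1 / a)\<close> for
  \<open>M\<close>.\<close>

lemma carrier_cauchy_ring: "carrier (cauchy_ring v) = {s. cau s}"
proof -
  have eq: "Metric_space.MCauchy UNIV (\<lambda>x y. f (x - y)) s \<longleftrightarrow>
      (\<forall>e>0. \<exists>N. \<forall>m\<ge>N. \<forall>n\<ge>N. f (s m - s n) < e)" if "f \<in> v" for f s
  proof -
    interpret f: abs_val f
      using place that by (rule place_abs_val)
    interpret Metric_space UNIV "\<lambda>x y. f (x - y)"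
    proof
      show "f (x - y) = f (y - x)" for x y
        by (rule f.diff_commute)
      show "f (x - z) \<le> f (x - y) + f (y - z)" for x y z
        using f.triangle[of "x - y" "y - z"] by simp
    qed simp_all
    show ?thesis
      unfolding MCauchy_def by auto
  qed
  have powr: "\<exists>N. \<forall>m\<ge>N. \<forall>n\<ge>N. f (s m - s n) < e" if f: "f \<in> v" and s: "cau s" and e: "e > 0" for f s e
  proof -
    obtain a where a: "a > 0" "\<And>x. f x = M x powr a"
      using place mem f by (rule place_powr) auto
    obtain N where N: "\<forall>m\<ge>N. \<forall>n\<ge>N. M (s m - s n) < e powr (1 / a)"
      using cauD[OF s, of "e powr (1 / a)"] e by auto
    have "f x < e" if "M x < e powr (1 / a)" for x
      using powr_less_mono2[OF a(1) nonneg that] a e by (simp add: powr_powr)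
    with N show ?thesis by blast
  qed
  show ?thesis
    using eq powr mem by (auto simp: cauchy_ring_def cau_def)
qed

lemma cau_const: "cau (\<lambda>_. x)"
  by (simp add: cau_def)

lemma null_imp_cau:
  assumes "(\<lambda>n. M (s n)) \<longlonglongrightarrow> 0"
  shows "cau s"
  unfolding cau_def
proof (intro allI impI)
  fix e :: real assume "e > 0"
  then have "\<forall>\<^sub>F n in sequentially. M (s n) < e / 2"
    using assms by (intro order_tendstoD(2)[of _ 0]) auto
  then obtain N where N: "\<And>n. n \<ge> N \<Longrightarrow> M (s n) < e / 2"
    by (auto simp: eventually_sequentially)
  have "M (s m - s n) < e" if "m \<ge> N" "n \<ge> N" for m n
    using triangle[of "s m" "- s n"] N[OF that(1)] N[OF that(2)] by simp
  then show "\<exists>N. \<forall>m\<ge>N. \<forall>n\<ge>N. M (s m - s n) < e"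
    by blast
qed

lemma null_ideal_eq: "null_ideal v = {s. (\<lambda>n. M (s n)) \<longlonglongrightarrow> 0}"
proof -
  have "(\<lambda>n. f (s n)) \<longlonglongrightarrow> 0" if f: "f \<in> v" and s: "(\<lambda>n. M (s n)) \<longlonglongrightarrow> 0" for f s
  proof -
    obtain a where a: "a > 0" "\<And>x. f x = M x powr a"
      using place mem f by (rule place_powr) auto
    have "(\<lambda>n. M (s n) powr a) \<longlonglongrightarrow> 0 powr a"
      using s a by (intro tendsto_powr') auto
    then show ?thesis
      using a by simp
  qed
  then show ?thesis
    unfolding null_ideal_def carrier_cauchy_ring using mem null_imp_cau by blast
qed

lemma class_eq: "cauchy_class v s = {t. (\<lambda>n. M (t n - s n)) \<longlonglongrightarrow> 0}"
proof -
  have "t \<in> cauchy_class v s \<longleftrightarrow> (\<exists>h. (\<lambda>n. M (h n)) \<longlonglongrightarrow> 0 \<and> t = (\<lambda>n. h n + s n))" for t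
    by (auto simp: cauchy_class_def a_r_coset_def r_coset_def null_ideal_eq) (auto simp: cauchy_ring_def)
  also have "\<dots> t \<longleftrightarrow> (\<lambda>n. M (t n - s n)) \<longlonglongrightarrow> 0" for t
    by (auto intro!: exI[of _ "\<lambda>n. t n - s n"])
  finally show ?thesis by blast
qed

lemma null_add:
  assumes "(\<lambda>n. M (s n)) \<longlonglongrightarrow> 0" "(\<lambda>n. M (t n)) \<longlonglongrightarrow> 0"
  shows "(\<lambda>n. M (s n + t n)) \<longlonglongrightarrow> 0"
proof (rule Lim_null_comparison)
  show "(\<lambda>n. M (s n) + M (t n)) \<longlonglongrightarrow> 0"
    using tendsto_add[OF assms] by simp
qed (auto simp: triangle)

lemma null_minus: "(\<lambda>n. M (s n - t n)) \<longlonglongrightarrow> 0 \<longleftrightarrow> (\<lambda>n. M (t n - s n)) \<longlonglongrightarrow> 0"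
proof -
  have "(\<lambda>n. M (s n - t n)) = (\<lambda>n. M (t n - s n))"
    by (rule ext) (rule diff_commute)
  then show ?thesis by simp
qed

lemma self_in_class: "s \<in> cauchy_class v s"
  by (simp add: class_eq)

lemma class_eq_iff: "cauchy_class v s = cauchy_class v t \<longleftrightarrow> (\<lambda>n. M (s n - t n)) \<longlonglongrightarrow> 0"
proof
  assume "cauchy_class v s = cauchy_class v t"
  then show "(\<lambda>n. M (s n - t n)) \<longlonglongrightarrow> 0"
    using self_in_class[of s] by (simp add: class_eq)
next
  assume st: "(\<lambda>n. M (s n - t n)) \<longlonglongrightarrow> 0"
  then have ts: "(\<lambda>n. M (t n - s n)) \<longlonglongrightarrow> 0"
    by (rule null_minus[THEN iffD1])
  have "(\<lambda>n. M (x n - q n)) \<longlonglongrightarrow> 0"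
    if "(\<lambda>n. M (x n - p n)) \<longlonglongrightarrow> 0" "(\<lambda>n. M (p n - q n)) \<longlonglongrightarrow> 0" for x p q :: "nat \<Rightarrow> 'a"
    using null_add[OF that] by simp
  with st ts show "cauchy_class v s = cauchy_class v t"
    unfolding class_eq by blast
qed

lemma carrier_completion: "carrier (completion v) = cauchy_class v ` {s. cau s}"
  by (auto simp: completion_def FactRing_def A_RCOSETS_def RCOSETS_def cauchy_class_def
      a_r_coset_def carrier_cauchy_ring)

lemma zero_completion: "\<zero>\<^bsub>completion v\<^esub> = cauchy_class v (\<lambda>_. 0)"
  by (simp add: completion_def FactRing_def class_eq null_ideal_eq)

lemma cau_convergent:
  assumes "cau s"
  shows "convergent (\<lambda>n. M (s n))"
proof (rule Cauchy_convergent, rule metric_CauchyI)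
  fix e :: real assume "e > 0"
  then obtain N where "\<forall>m\<ge>N. \<forall>n\<ge>N. M (s m - s n) < e"
    using cauD[OF assms] by blast
  then show "\<exists>N. \<forall>m\<ge>N. \<forall>n\<ge>N. dist (M (s m)) (M (s n)) < e"
    unfolding dist_real_def using triangle_diff le_less_trans by blast
qed

lemma cau_bounded:
  assumes "cau s"
  obtains B where "B > 0" "\<And>n. M (s n) \<le> B"
proof -
  have "Bseq (\<lambda>n. M (s n))"
    using cau_convergent[OF assms] by (rule convergent_imp_Bseq)
  then show ?thesis
    using that by (auto elim!: BseqE)
qed

lemma cau_add:
  assumes "cau s" "cau t"
  shows "cau (\<lambda>n. s n + t n)"
  unfolding cau_def
proof (intro allI impI)
  fix e :: real assume "e > 0"
  then obtain N1 N2 where N: "\<forall>m\<ge>N1. \<forall>n\<ge>N1. M (s m - s n) < e / 2" "\<forall>m\<ge>N2. \<forall>n\<ge>N2. M (t m - t n) < e / 2"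
    using cauD[OF assms(1), of "e / 2"] cauD[OF assms(2), of "e / 2"] by auto
  have "M (s m + t m - (s n + t n)) < e" if "m \<ge> max N1 N2" "n \<ge> max N1 N2" for m n
  proof -
    have "M (s m + t m - (s n + t n)) \<le> M (s m - s n) + M (t m - t n)"
      using triangle[of "s m - s n" "t m - t n"] by (simp add: algebra_simps)
    moreover have "M (s m - s n) < e / 2" "M (t m - t n) < e / 2"
      using N that by simp_all
    ultimately show ?thesis by simp
  qed
  then show "\<exists>N. \<forall>m\<ge>N. \<forall>n\<ge>N. M (s m + t m - (s n + t n)) < e"
    by blast
qed

lemma cau_mult:
  assumes "cau s" "cau t"
  shows "cau (\<lambda>n. s n * t n)"
  unfolding cau_def
proof (intro allI impI)
  fix e :: real assume e: "e > 0"
  obtain A where A: "A > 0" "\<And>n. M (s n) \<le> A"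
    using cau_bounded[OF assms(1)] by blast
  obtain B where B: "B > 0" "\<And>n. M (t n) \<le> B"
    using cau_bounded[OF assms(2)] by blast
  obtain N1 N2 where N: "\<forall>m\<ge>N1. \<forall>n\<ge>N1. M (s m - s n) < e / (2 * B)"
      "\<forall>m\<ge>N2. \<forall>n\<ge>N2. M (t m - t n) < e / (2 * A)"
    using cauD[OF assms(1), of "e / (2 * B)"] cauD[OF assms(2), of "e / (2 * A)"] A B e by auto
  have "M (s m * t m - s n * t n) < e" if "m \<ge> max N1 N2" "n \<ge> max N1 N2" for m n
  proof -
    have "M (s m * t m - s n * t n) = M (s m * (t m - t n) + (s m - s n) * t n)"
      by (simp add: algebra_simps)
    also have "\<dots> \<le> M (s m) * M (t m - t n) + M (s m - s n) * M (t n)"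
      using triangle by (simp flip: mult)
    also have "\<dots> \<le> A * M (t m - t n) + M (s m - s n) * B"
      using A B by (intro add_mono mult_mono) (auto intro: less_imp_le)
    also have "\<dots> < A * (e / (2 * A)) + (e / (2 * B)) * B"
      using A B N that by (intro add_strict_mono mult_strict_left_mono mult_strict_right_mono) auto
    also have "\<dots> = e"
      using A B by simp
    finally show ?thesis .
  qed
  then show "\<exists>N. \<forall>m\<ge>N. \<forall>n\<ge>N. M (s m * t m - s n * t n) < e"
    by blast
qed

lemma cau_power: "cau s \<Longrightarrow> cau (\<lambda>n. s n ^ k)"
  by (induction k) (simp_all add: cau_const cau_mult)

lemma cau_sum: "(\<And>x. x \<in> A \<Longrightarrow> cau (g x)) \<Longrightarrow> cau (\<lambda>n. \<Sum>x\<in>A. g x n)"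
  by (induction A rule: infinite_finite_induct) (simp_all add: cau_const cau_add)

text \<open>A Cauchy sequence that is not null stays away from 0 eventually. Finitely many terms may
  still vanish, where \<open>inverse 0 = 0\<close>; so the product with the inverse is 1 only up to
  a null sequence.\<close>

lemma cau_inverse:
  assumes "cau s" and nz: "\<not> (\<lambda>n. M (s n)) \<longlonglongrightarrow> 0"
  shows "cau (\<lambda>n. inverse (s n))" "(\<lambda>n. M (s n * inverse (s n) - 1)) \<longlonglongrightarrow> 0"
proof -
  obtain r where r: "(\<lambda>n. M (s n)) \<longlonglongrightarrow> r"
    using cau_convergent[OF assms(1)] by (auto simp: convergent_def)
  have "r \<ge> 0"
    using r by (rule LIMSEQ_le_const) simp
  with nz r have "r > 0"
    by (cases "r = 0") auto
  then have "\<forall>\<^sub>F n in sequentially. M (s n) > r / 2"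
    using r by (intro order_tendstoD(1)[of _ r]) auto
  then obtain N0 where N0: "\<And>n. n \<ge> N0 \<Longrightarrow> M (s n) > r / 2"
    by (auto simp: eventually_sequentially)
  have nz: "s n \<noteq> 0" if "n \<ge> N0" for n
    using N0[OF that] \<open>r > 0\<close> by auto
  have "\<forall>\<^sub>F n in sequentially. 0 = M (s n * inverse (s n) - 1)"
    using nz unfolding eventually_sequentially by (intro exI[of _ N0]) simp
  with tendsto_const show "(\<lambda>n. M (s n * inverse (s n) - 1)) \<longlonglongrightarrow> 0"
    by (rule Lim_transform_eventually)
  show "cau (\<lambda>n. inverse (s n))"
    unfolding cau_def
  proof (intro allI impI)
    fix e :: real assume e: "e > 0"
    \<comment> \<open>A lower bound for \<open>M (s m) * M (s n)\<close> at late indices, the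
      denominator of a difference of inverses.\<close>
    define c where "c = r / 2 * (r / 2)"
    have c: "c > 0" using \<open>r > 0\<close> by (simp add: c_def)
    obtain N1 where N1: "\<forall>m\<ge>N1. \<forall>n\<ge>N1. M (s m - s n) < e * c"
      using cauD[OF assms(1), of "e * c"] e c by auto
    have "M (inverse (s m) - inverse (s n)) < e" if "m \<ge> max N0 N1" "n \<ge> max N0 N1" for m n
    proof -
      have mn: "m \<ge> N0" "n \<ge> N0" "m \<ge> N1" "n \<ge> N1" using that by simp_all
      have "(inverse (s m) - inverse (s n)) * (s m * s n) = s n - s m"
        using nz[OF mn(1)] nz[OF mn(2)] by (simp add: field_simps)
      then have "M (inverse (s m) - inverse (s n)) * (M (s m) * M (s n)) = M (s n - s m)"
        by (simp flip: mult)
      also have "\<dots> < e * c"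
        using N1 mn by blast
      finally have lt: "M (inverse (s m) - inverse (s n)) * (M (s m) * M (s n)) < e * c" .
      have "M (inverse (s m) - inverse (s n)) * c \<le> M (inverse (s m) - inverse (s n)) * (M (s m) * M (s n))"
        unfolding c_def using N0[OF mn(1)] N0[OF mn(2)] \<open>r > 0\<close>
        by (intro mult_left_mono mult_mono) auto
      with lt have "M (inverse (s m) - inverse (s n)) * c < e * c"
        by simp
      then show ?thesis using c by simp
    qed
    then show "\<exists>N. \<forall>m\<ge>N. \<forall>n\<ge>N. M (inverse (s m) - inverse (s n)) < e"
      by blast
  qed
qed

lemma null_mult:
  assumes "cau s" "(\<lambda>n. M (t n)) \<longlonglongrightarrow> 0"
  shows "(\<lambda>n. M (s n * t n)) \<longlonglongrightarrow> 0"
proof -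
  obtain r where "(\<lambda>n. M (s n)) \<longlonglongrightarrow> r"
    using cau_convergent[OF assms(1)] by (auto simp: convergent_def)
  from tendsto_mult[OF this assms(2)] show ?thesis
    by (simp add: mult)
qed

lemma cau_class:
  assumes "cau s" "t \<in> cauchy_class v s"
  shows "cau t"
proof -
  have "cau (\<lambda>n. t n - s n)"
    using assms(2) null_imp_cau by (simp add: class_eq)
  from cau_add[OF this assms(1)] show ?thesis by simp
qed

lemma add_completion:
  assumes "cau s" "cau t"
  shows "cauchy_class v s \<oplus>\<^bsub>completion v\<^esub> cauchy_class v t = cauchy_class v (\<lambda>n. s n + t n)"
proof -
  have "cauchy_class v s \<oplus>\<^bsub>completion v\<^esub> cauchy_class v t
      = {\<lambda>n. h n + k n |h k. h \<in> cauchy_class v s \<and> k \<in> cauchy_class v t}"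
    by (auto simp: completion_def FactRing_def set_add_def set_mult_def cauchy_ring_def)
  also have "\<dots> = cauchy_class v (\<lambda>n. s n + t n)"
  proof (intro subset_antisym subsetI)
    fix u assume "u \<in> {\<lambda>n. h n + k n |h k. h \<in> cauchy_class v s \<and> k \<in> cauchy_class v t}"
    then obtain h k where u: "u = (\<lambda>n. h n + k n)"
      and hk: "(\<lambda>n. M (h n - s n)) \<longlonglongrightarrow> 0" "(\<lambda>n. M (k n - t n)) \<longlonglongrightarrow> 0"
      by (auto simp: class_eq)
    have "h n - s n + (k n - t n) = u n - (s n + t n)" for n
      by (simp add: u)
    then have "(\<lambda>n. M (u n - (s n + t n))) \<longlonglongrightarrow> 0"
      using null_add[OF hk] by (simp only:)
    then show "u \<in> cauchy_class v (\<lambda>n. s n + t n)"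
      by (simp add: class_eq)
  next
    fix u assume "u \<in> cauchy_class v (\<lambda>n. s n + t n)"
    then have "(\<lambda>n. u n - s n) \<in> cauchy_class v t"
      by (simp add: class_eq algebra_simps)
    moreover have "u = (\<lambda>n. s n + (u n - s n))"
      by simp
    ultimately have "\<exists>h k. u = (\<lambda>n. h n + k n) \<and> h \<in> cauchy_class v s \<and> k \<in> cauchy_class v t"
      using self_in_class[of s] by (intro exI conjI)
    then show "u \<in> {\<lambda>n. h n + k n |h k. h \<in> cauchy_class v s \<and> k \<in> cauchy_class v t}"
      by simp
  qed
  finally show ?thesis .
qed

text \<open>The product in a quotient ring is a union of cosets over all representatives. They
  coincide, because \<open>h * k - s * t\<close> equals \<open>h * (k - t) + t * (h - s)\<close> and
  Cauchy sequences times null sequences are null.\<close>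

lemma mult_completion:
  assumes "cau s" "cau t"
  shows "cauchy_class v s \<otimes>\<^bsub>completion v\<^esub> cauchy_class v t = cauchy_class v (\<lambda>n. s n * t n)"
proof -
  have "cauchy_class v s \<otimes>\<^bsub>completion v\<^esub> cauchy_class v t
      = (\<Union>h\<in>cauchy_class v s. \<Union>k\<in>cauchy_class v t. cauchy_class v (\<lambda>n. h n * k n))"
    unfolding cauchy_class_def by (simp add: completion_def FactRing_def rcoset_mult_def) (simp add: cauchy_ring_def)
  also have "\<dots> = (\<Union>h\<in>cauchy_class v s. \<Union>k\<in>cauchy_class v t. cauchy_class v (\<lambda>n. s n * t n))"
  proof (intro SUP_cong refl)
    fix h k assume h: "h \<in> cauchy_class v s" and k: "k \<in> cauchy_class v t"
    have "(\<lambda>n. M (h n * (k n - t n) + t n * (h n - s n))) \<longlonglongrightarrow> 0"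
      using h k assms cau_class by (intro null_add null_mult) (auto simp: class_eq)
    then show "cauchy_class v (\<lambda>n. h n * k n) = cauchy_class v (\<lambda>n. s n * t n)"
      unfolding class_eq_iff by (simp add: algebra_simps)
  qed
  also have "\<dots> = cauchy_class v (\<lambda>n. s n * t n)"
    using self_in_class by blast
  finally show ?thesis .
qed

section \<open>The absolute value on the completion\<close>

definition L :: "(nat \<Rightarrow> 'a) \<Rightarrow> real" where
  "L s = lim (\<lambda>n. M (s n))"

lemma tendsto_L: "cau s \<Longrightarrow> (\<lambda>n. M (s n)) \<longlonglongrightarrow> L s"
  unfolding L_def using cau_convergent convergent_LIMSEQ_iff by blast

lemma L_eqI: "(\<lambda>n. M (s n)) \<longlonglongrightarrow> r \<Longrightarrow> L s = r"
  unfolding L_def by (rule limI)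

lemma L_class:
  assumes "cau s" "t \<in> cauchy_class v s"
  shows "L t = L s"
proof -
  have "(\<lambda>n. M (t n - s n)) \<longlonglongrightarrow> 0"
    using assms by (simp add: class_eq)
  then have "(\<lambda>n. M (t n) - M (s n)) \<longlonglongrightarrow> 0"
    by (rule Lim_null_comparison[rotated]) (auto simp: triangle_diff)
  from tendsto_add[OF this tendsto_L[OF assms(1)]] show ?thesis
    by (intro L_eqI) simp
qed

lemma L_mult: "cau s \<Longrightarrow> cau t \<Longrightarrow> L (\<lambda>n. s n * t n) = L s * L t"
  by (rule L_eqI) (simp add: mult tendsto_mult tendsto_L)

lemma L_power: "cau s \<Longrightarrow> L (\<lambda>n. s n ^ k) = L s ^ k"
  by (rule L_eqI) (simp add: power tendsto_power tendsto_L)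

lemma L_add: "cau s \<Longrightarrow> cau t \<Longrightarrow> L (\<lambda>n. s n + t n) \<le> L s + L t"
  by (rule LIMSEQ_le[OF tendsto_L tendsto_add[OF tendsto_L tendsto_L]]) (auto simp: cau_add triangle)

lemma L_nonneg: "cau s \<Longrightarrow> 0 \<le> L s"
  by (rule LIMSEQ_le_const[OF tendsto_L]) auto

lemma L_const [simp]: "L (\<lambda>_. x) = M x"
  by (rule L_eqI) simp

text \<open>The chosen representative is immaterial by \<open>L_class\<close>. The restriction
  provides the extensionality that \<open>completion_abs\<close> demands.\<close>

definition completed_abs :: "(nat \<Rightarrow> 'a) set \<Rightarrow> real" where
  "completed_abs = restrict (\<lambda>X. L (SOME s. s \<in> X \<and> cau s)) (carrier (completion v))"

lemma completed_abs_class: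
  assumes "cau s"
  shows "completed_abs (cauchy_class v s) = L s"
proof -
  define t where "t = (SOME t. t \<in> cauchy_class v s \<and> cau t)"
  have "t \<in> cauchy_class v s \<and> cau t"
    unfolding t_def by (rule someI[of _ s]) (simp add: assms self_in_class)
  then have "L t = L s"
    using L_class[OF assms] by blast
  then show ?thesis
    using assms by (simp add: completed_abs_def carrier_completion t_def)
qed

lemma absolute_value_completed_abs: "absolute_value (completion v) completed_abs"
proof -
  have "L s = 0 \<longleftrightarrow> cauchy_class v s = cauchy_class v (\<lambda>_. 0)" if "cau s" for s
    using tendsto_L[OF that] L_eqI[of s 0] by (auto simp: class_eq_iff)
  then show ?thesis
    by (auto simp: absolute_value_def carrier_completion zero_completion mult_completion add_completion
        completed_abs_class cau_add cau_mult L_mult L_add L_nonneg)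
qed

end

section \<open>Uniqueness of the extension to the completion\<close>

locale normalized_place = valued_place M v for M :: "'a::field_char_0 \<Rightarrow> real" and v +
  assumes number_field: "number_field TYPE('a)" and standard: "M \<circ> of_rat \<in> standard_abs"
begin

text \<open>If \<open>b\<close> cannot be added to a maximal uniformly independent set
  \<open>E\<close>, some combinations over \<open>insert b E\<close> are small compared with one of
  their coefficients. Independence of \<open>E\<close> keeps the coefficient of \<open>b\<close>
  from being negligible, and dividing by it exhibits \<open>b\<close> as a limit of combinations of
  \<open>E\<close>.\<close>

lemma finite_dense_basis:
  obtains E :: "'a set" and c where "finite E" "c > 0"
    "\<And>q e. e \<in> E \<Longrightarrow> c * M (of_rat (q e)) \<le> M (\<Sum>e\<in>E. of_rat (q e) * e)"
    "\<And>x \<epsilon>. \<epsilon> > 0 \<Longrightarrow> \<exists>q. M (x - (\<Sum>e\<in>E. of_rat (q e) * e)) < \<epsilon>"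
proof -
  obtain B :: "'a set" where B: "finite B" "\<And>x. \<exists>q. x = (\<Sum>b\<in>B. of_rat (q b) * b)"
    using number_field by (rule number_field_spanning) auto
  define P where "P E \<longleftrightarrow> (\<exists>c>0. \<forall>q. \<forall>e\<in>E. c * M (of_rat (q e)) \<le> M (\<Sum>e\<in>E. of_rat (q e) * e))"
    for E :: "'a set"
  have "finite {E. E \<subseteq> B \<and> P E}"
    using B(1) by (auto intro: finite_subset[of _ "Pow B"])
  moreover have "{} \<in> {E. E \<subseteq> B \<and> P E}"
    by (auto simp: P_def intro: exI[of _ 1])
  ultimately obtain E where E: "E \<subseteq> B" "P E" and max: "\<And>F. F \<subseteq> B \<Longrightarrow> P F \<Longrightarrow> E \<subseteq> F \<Longrightarrow> E = F"
    using finite_has_maximal[of "{E. E \<subseteq> B \<and> P E}"] by (metis (mono_tags, lifting) empty_iff mem_Collect_eq)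
  have finE: "finite E"
    using E(1) B(1) by (rule finite_subset)
  obtain c where c: "c > 0" "\<And>q e. e \<in> E \<Longrightarrow> c * M (of_rat (q e)) \<le> M (\<Sum>e\<in>E. of_rat (q e) * e)"
    using E(2) by (auto simp: P_def)
  have basis: "\<exists>q. M (b - (\<Sum>e\<in>E. of_rat (q e) * e)) < \<epsilon>" if b: "b \<in> B" and \<epsilon>: "\<epsilon> > 0" for b \<epsilon>
  proof (cases "b \<in> E")
    case True
    have "(\<Sum>e\<in>E. of_rat (if e = b then 1 else 0) * e) = (\<Sum>e\<in>E. if e = b then b else 0)"
      by (rule sum.cong) auto
    also have "\<dots> = b"
      using True finE by simp
    finally show ?thesis
      using \<epsilon> by (intro exI[of _ "\<lambda>e. if e = b then 1 else 0"]) simp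
  next
    case False
    \<comment> \<open>\<open>K\<close> bounds the ratio of the large coefficient \<open>q a\<close>
      to that of \<open>b\<close>: the summand 1 serves \<open>a = b\<close>, the summand
      \<open>2 * M b / c\<close> serves \<open>a \<in> E\<close>.\<close>
    define K where "K = 1 + 2 * M b / c"
    have K: "K \<ge> 1" "K > 0"
      using c(1) by (simp_all add: K_def add_pos_nonneg)
    \<comment> \<open>The part \<open>c / 2\<close> allows the small combination to be absorbed on
      the left in the estimate of \<open>q a\<close>; the part \<open>\<epsilon> / K\<close> gives
      the final error.\<close>
    define \<delta> where "\<delta> = min (c / 2) (\<epsilon> / K)"
    have \<delta>: "\<delta> > 0" "\<delta> \<le> c / 2" "\<delta> * K \<le> \<epsilon>"
      using c(1) K \<epsilon> by (simp_all add: \<delta>_def min_def field_simps)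
    have "\<not> P (insert b E)"
      using max[of "insert b E"] b E(1) False by auto
    then obtain q a where a: "a \<in> insert b E"
      and lt: "M (\<Sum>e\<in>insert b E. of_rat (q e) * e) < \<delta> * M (of_rat (q a))"
      using \<delta>(1) unfolding P_def not_all by (meson not_le)
    define S T Q where "S = (\<Sum>e\<in>E. of_rat (q e) * e)" and "T = M (of_rat (q b) * b + S)" and "Q = M (of_rat (q b))"
    have lt: "T < \<delta> * M (of_rat (q a))"
      using lt False finE by (simp add: T_def S_def)
    have "M (of_rat (q a)) \<le> Q * K"
    proof (cases "a = b")
      case True
      then show ?thesis
        using K mult_left_mono[OF K(1), of Q] by (simp add: Q_def)
    next
      case False
      with a have "a \<in> E" by simp
      have "c * M (of_rat (q a)) \<le> M S"
        unfolding S_def by (rule c(2)) fact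
      also have "M S \<le> T + Q * M b"
        using triangle[of "of_rat (q b) * b + S" "- (of_rat (q b) * b)"] by (simp add: T_def Q_def mult)
      also have "\<dots> \<le> c / 2 * M (of_rat (q a)) + Q * M b"
        using lt mult_right_mono[OF \<delta>(2), of "M (of_rat (q a))"] by simp
      finally have "M (of_rat (q a)) \<le> Q * (2 * M b / c)"
        using c(1) by (simp add: field_simps)
      also have "\<dots> \<le> Q * K"
        by (intro mult_left_mono) (simp_all add: K_def Q_def)
      finally show ?thesis .
    qed
    then have TQ: "T < \<delta> * (Q * K)"
      using lt \<delta>(1) by (meson less_le_trans mult_left_mono less_imp_le)
    have "T \<ge> 0" by (simp add: T_def)
    with TQ have "Q \<noteq> 0"
      by auto
    then have Q: "Q > 0" and qb: "q b \<noteq> 0"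
      by (auto simp: Q_def)
    have "b - (\<Sum>e\<in>E. of_rat (- (q e / q b)) * e) = b + (\<Sum>e\<in>E. of_rat (q e / q b) * e)"
      by (simp add: of_rat_minus sum_negf)
    also have "\<dots> = (of_rat (q b) * b + S) / of_rat (q b)"
      using qb by (simp add: S_def add_divide_distrib sum_divide_distrib of_rat_divide)
    finally have "M (b - (\<Sum>e\<in>E. of_rat (- (q e / q b)) * e)) = T / Q"
      by (simp add: divide T_def Q_def)
    also have "\<dots> < \<delta> * K"
      using TQ Q by (simp add: field_simps)
    also have "\<dots> \<le> \<epsilon>"
      by (rule \<delta>)
    finally show ?thesis
      by (intro exI[of _ "\<lambda>e. - (q e / q b)"])
  qed
  have dense: "\<exists>q. M (x - (\<Sum>e\<in>E. of_rat (q e) * e)) < \<epsilon>" if \<epsilon>: "\<epsilon> > 0" for x \<epsilon>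
  proof -
    obtain r where r: "x = (\<Sum>b\<in>B. of_rat (r b) * b)"
      using B(2) by blast
    define R where "R = (\<Sum>b\<in>B. M (of_rat (r b)))"
    have R: "R \<ge> 0"
      by (simp add: R_def sum_nonneg)
    \<comment> \<open>The total error is \<open>R * \<eta>\<close>; the added 1 keeps it strictly
      below \<open>\<epsilon>\<close> and covers \<open>R = 0\<close>.\<close>
    define \<eta> where "\<eta> = \<epsilon> / (1 + R)"
    have \<eta>: "\<eta> > 0"
      using R \<epsilon> by (simp add: \<eta>_def)
    then have "\<forall>b\<in>B. \<exists>q. M (b - (\<Sum>e\<in>E. of_rat (q e) * e)) < \<eta>"
      using basis by blast
    then obtain p where p: "\<forall>b\<in>B. M (b - (\<Sum>e\<in>E. of_rat (p b e) * e)) < \<eta>"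
      by metis
    have "(\<Sum>e\<in>E. of_rat (\<Sum>b\<in>B. r b * p b e) * e) = (\<Sum>e\<in>E. \<Sum>b\<in>B. of_rat (r b) * (of_rat (p b e) * e))"
      by (simp add: of_rat_sum of_rat_mult sum_distrib_right mult.assoc)
    also have "\<dots> = (\<Sum>b\<in>B. of_rat (r b) * (\<Sum>e\<in>E. of_rat (p b e) * e))"
      by (subst sum.swap) (simp add: sum_distrib_left)
    finally have "x - (\<Sum>e\<in>E. of_rat (\<Sum>b\<in>B. r b * p b e) * e)
        = (\<Sum>b\<in>B. of_rat (r b) * (b - (\<Sum>e\<in>E. of_rat (p b e) * e)))"
      by (simp add: r right_diff_distrib sum_subtractf)
    then have "M (x - (\<Sum>e\<in>E. of_rat (\<Sum>b\<in>B. r b * p b e) * e))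
        \<le> (\<Sum>b\<in>B. M (of_rat (r b)) * M (b - (\<Sum>e\<in>E. of_rat (p b e) * e)))"
      using sum_le by (simp flip: mult)
    also have "\<dots> \<le> (\<Sum>b\<in>B. M (of_rat (r b)) * \<eta>)"
      using p by (intro sum_mono mult_left_mono) (auto intro: less_imp_le)
    also have "\<dots> = R * \<eta>"
      by (simp add: R_def sum_distrib_right)
    also have "\<dots> < \<epsilon>"
      using R \<epsilon> by (simp add: \<eta>_def field_simps)
    finally show ?thesis
      by (intro exI[of _ "\<lambda>e. \<Sum>b\<in>B. r b * p b e"])
  qed
  show ?thesis
    using that[OF finE c] dense by blast
qed

text \<open>In effect the completion is spanned by \<open>E\<close> over the completion of the
  rationals. Terms are approximated within 1 / (n + 1) by rational combinations of \<open>E\<close>;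
  the uniform bound for differences makes each coordinate sequence Cauchy, and the bound for the
  terms themselves passes to the limit.\<close>

lemma cau_coordinates:
  obtains E :: "'a set" and c where "finite E" "c > 0"
    "\<And>s. cau s \<Longrightarrow> \<exists>q. (\<forall>e\<in>E. cau (\<lambda>n. of_rat (q n e)) \<and> c * L (\<lambda>n. of_rat (q n e)) \<le> L s) \<and>
        cauchy_class v s = cauchy_class v (\<lambda>n. \<Sum>e\<in>E. of_rat (q n e) * e)"
proof -
  obtain E :: "'a set" and c where E: "finite E" and c: "c > 0"
    and indep: "\<And>q e. e \<in> E \<Longrightarrow> c * M (of_rat (q e)) \<le> M (\<Sum>e\<in>E. of_rat (q e) * e)"
    and dense: "\<And>x \<epsilon>. \<epsilon> > 0 \<Longrightarrow> \<exists>q. M (x - (\<Sum>e\<in>E. of_rat (q e) * e)) < \<epsilon>"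
    using finite_dense_basis by blast
  have "\<exists>q. (\<forall>e\<in>E. cau (\<lambda>n. of_rat (q n e)) \<and> c * L (\<lambda>n. of_rat (q n e)) \<le> L s) \<and>
      cauchy_class v s = cauchy_class v (\<lambda>n. \<Sum>e\<in>E. of_rat (q n e) * e)" if s: "cau s" for s
  proof -
    have "\<forall>n. \<exists>q. M (s n - (\<Sum>e\<in>E. of_rat (q e) * e)) < inverse (real (Suc n))"
      by (intro allI dense) simp
    then obtain q where q: "\<And>n. M (s n - (\<Sum>e\<in>E. of_rat (q n e) * e)) < inverse (real (Suc n))"
      by metis
    define t where "t n = (\<Sum>e\<in>E. of_rat (q n e) * e)" for n
    have "(\<lambda>n. M (s n - t n)) \<longlonglongrightarrow> 0"
    proof (rule Lim_null_comparison)
      show "(\<lambda>n. inverse (real (Suc n))) \<longlonglongrightarrow> 0"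
        by (rule LIMSEQ_inverse_real_of_nat)
      show "\<forall>\<^sub>F n in sequentially. norm (M (s n - t n)) \<le> inverse (real (Suc n))"
        using less_imp_le[OF q] by (simp add: t_def)
    qed
    then have cls: "cauchy_class v s = cauchy_class v t"
      by (simp add: class_eq_iff)
    then have t: "cau t"
      using s cau_class self_in_class by blast
    have Lt: "L t = L s"
      using cls s L_class self_in_class by blast
    have "cau (\<lambda>n. of_rat (q n e)) \<and> c * L (\<lambda>n. of_rat (q n e)) \<le> L s" if e: "e \<in> E" for e
    proof
      show *: "cau (\<lambda>n. of_rat (q n e))"
        unfolding cau_def
      proof (intro allI impI)
        fix \<epsilon> :: real assume "\<epsilon> > 0"
        then obtain N where N: "\<forall>m\<ge>N. \<forall>n\<ge>N. M (t m - t n) < c * \<epsilon>"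
          using cauD[OF t, of "c * \<epsilon>"] c by auto
        have "M (of_rat (q m e) - of_rat (q n e)) < \<epsilon>" if "m \<ge> N" "n \<ge> N" for m n
        proof -
          have "c * M (of_rat (q m e - q n e)) \<le> M (\<Sum>e\<in>E. of_rat (q m e - q n e) * e)"
            by (rule indep[OF e])
          also have "\<dots> = M (t m - t n)"
            by (simp add: t_def of_rat_diff left_diff_distrib sum_subtractf)
          also have "\<dots> < c * \<epsilon>"
            using N that by blast
          finally show ?thesis
            using c by (simp add: of_rat_diff)
        qed
        then show "\<exists>N. \<forall>m\<ge>N. \<forall>n\<ge>N. M (of_rat (q m e) - of_rat (q n e)) < \<epsilon>"
          by blast
      qed
      have "c * L (\<lambda>n. of_rat (q n e)) \<le> L t"
      proof (rule LIMSEQ_le[OF tendsto_mult_left[OF tendsto_L[OF *]] tendsto_L[OF t]])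
        show "\<exists>N. \<forall>n\<ge>N. c * M (of_rat (q n e)) \<le> M (t n)"
          using indep[OF e] by (auto simp: t_def)
      qed
      then show "c * L (\<lambda>n. of_rat (q n e)) \<le> L s"
        by (simp add: Lt)
    qed
    with cls show ?thesis
      unfolding t_def by blast
  qed
  with E c that show ?thesis by blast
qed

text \<open>Coordinates yield an upper bound only. Since both sides are multiplicative and a class
  that is not null has an inverse, the upper bound for the inverse is a lower bound for
  \<open>s\<close>.\<close>

lemma extension_unique:
  assumes N: "absolute_value (completion v) N"
    and rat: "\<And>q. cau (\<lambda>n. of_rat (q n)) \<Longrightarrow> N (cauchy_class v (\<lambda>n. of_rat (q n))) = L (\<lambda>n. of_rat (q n))"
    and s: "cau s"
  shows "N (cauchy_class v s) = L s"
proof -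
  define N' where "N' s = N (cauchy_class v s)" for s
  have N'_nonneg: "0 \<le> N' s" and N'_0_iff: "N' s = 0 \<longleftrightarrow> cauchy_class v s = cauchy_class v (\<lambda>_. 0)"
    if "cau s" for s
    using N that by (auto simp: N'_def absolute_value_def carrier_completion zero_completion)
  have N'_mult: "N' (\<lambda>n. s n * t n) = N' s * N' t" and N'_add: "N' (\<lambda>n. s n + t n) \<le> N' s + N' t"
    if "cau s" "cau t" for s t
  proof -
    have "cauchy_class v s \<in> carrier (completion v)" "cauchy_class v t \<in> carrier (completion v)"
      using that by (auto simp: carrier_completion)
    then show "N' (\<lambda>n. s n * t n) = N' s * N' t" "N' (\<lambda>n. s n + t n) \<le> N' s + N' t"
      using N by (simp_all add: N'_def absolute_value_def that flip: mult_completion add_completion)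
  qed
  have N'_sum: "N' (\<lambda>n. \<Sum>x\<in>A. g x n) \<le> (\<Sum>x\<in>A. N' (g x))" if "\<And>x. x \<in> A \<Longrightarrow> cau (g x)" "finite A" for A :: "'a set" and g
    using that(2,1)
  proof (induction A rule: finite_induct)
    case empty
    then show ?case
      using N'_0_iff[OF cau_const[of 0]] by simp
  next
    case (insert x A)
    then have "N' (\<lambda>n. g x n + (\<Sum>x\<in>A. g x n)) \<le> N' (g x) + N' (\<lambda>n. \<Sum>x\<in>A. g x n)"
      by (intro N'_add cau_sum) auto
    with insert show ?case by simp
  qed
  have N'_1: "N' (\<lambda>_. 1) = 1"
    using N'_mult[OF cau_const[of 1] cau_const[of 1]] N'_0_iff[OF cau_const[of 1]]
    by (simp add: class_eq_iff LIMSEQ_const_iff)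
  have N'_power: "N' (\<lambda>n. s n ^ k) = N' s ^ k" if "cau s" for s k
    by (induction k) (simp_all add: N'_1 N'_mult cau_power that)
  obtain E :: "'a set" and c where E: "finite E" and c: "c > 0"
    and coord: "\<And>s. cau s \<Longrightarrow> \<exists>q. (\<forall>e\<in>E. cau (\<lambda>n. of_rat (q n e)) \<and> c * L (\<lambda>n. of_rat (q n e)) \<le> L s) \<and>
        cauchy_class v s = cauchy_class v (\<lambda>n. \<Sum>e\<in>E. of_rat (q n e) * e)"
    using cau_coordinates by blast
  \<comment> \<open>\<open>C\<close> depends on \<open>E\<close> and \<open>c\<close> alone, so the
    bound can be applied to every power of \<open>s\<close>.\<close>
  define C where "C = (\<Sum>e\<in>E. N' (\<lambda>_. e) / c)"
  have bound: "N' s \<le> C * L s" if s: "cau s" for s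
  proof -
    obtain q where q: "\<And>e. e \<in> E \<Longrightarrow> cau (\<lambda>n. of_rat (q n e))" "\<And>e. e \<in> E \<Longrightarrow> c * L (\<lambda>n. of_rat (q n e)) \<le> L s"
      and cls: "cauchy_class v s = cauchy_class v (\<lambda>n. \<Sum>e\<in>E. of_rat (q n e) * e)"
      using coord[OF s] by blast
    have "N' s = N' (\<lambda>n. \<Sum>e\<in>E. of_rat (q n e) * e)"
      unfolding N'_def cls ..
    also have "\<dots> \<le> (\<Sum>e\<in>E. N' (\<lambda>n. of_rat (q n e) * e))"
      using E q by (intro N'_sum cau_mult cau_const) auto
    also have "\<dots> = (\<Sum>e\<in>E. L (\<lambda>n. of_rat (q n e)) * N' (\<lambda>_. e))"
      using q rat by (intro sum.cong refl) (simp add: N'_mult cau_const, simp add: N'_def)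
    also have "\<dots> \<le> (\<Sum>e\<in>E. L s / c * N' (\<lambda>_. e))"
      using q c by (intro sum_mono mult_right_mono N'_nonneg cau_const) (simp add: field_simps)
    also have "\<dots> = C * L s"
      by (simp add: C_def sum_distrib_left mult.commute)
    finally show ?thesis .
  qed
  have le: "N' s \<le> L s" if s: "cau s" for s
  proof (rule le_of_power_le_linear)
    show "N' s ^ k \<le> (0 * real k + C) * L s ^ k" for k
      using bound[OF cau_power[OF s, of k]] by (simp add: N'_power L_power s)
  qed (rule L_nonneg[OF s])
  have "L s \<le> N' s"
  proof (cases "(\<lambda>n. M (s n)) \<longlonglongrightarrow> 0")
    case True
    then show ?thesis
      using L_eqI N'_nonneg[OF s] by auto
  next
    case False
    note inv = cau_inverse[OF s False]
    have class1: "cauchy_class v (\<lambda>n. s n * inverse (s n)) = cauchy_class v (\<lambda>_. 1)"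
      using inv(2) by (simp only: class_eq_iff)
    have N'_inv: "N' s * N' (\<lambda>n. inverse (s n)) = 1"
      using N'_mult[OF s inv(1)] N'_1 by (simp only: N'_def class1)
    have L_inv: "L s * L (\<lambda>n. inverse (s n)) = 1"
      using L_mult[OF s inv(1)] L_class[OF cau_const self_in_class[of "\<lambda>n. s n * inverse (s n)", unfolded class1]]
      by simp
    have "L s * (N' s * N' (\<lambda>n. inverse (s n))) \<le> L s * (N' s * L (\<lambda>n. inverse (s n)))"
      by (intro mult_left_mono le[OF inv(1)] L_nonneg[OF s] N'_nonneg[OF s])
    also have "\<dots> = N' s * (L s * L (\<lambda>n. inverse (s n)))"
      by (rule mult.left_commute)
    finally show ?thesis
      by (simp add: N'_inv L_inv)
  qed
  with le[OF s] show ?thesis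
    by (simp add: N'_def)
qed

text \<open>The restriction of \<open>M\<close> puts the completion of the rationals under the same
  locale, so Cauchy sequences and limits there are compared with those of the field by composing
  with \<open>of_rat\<close>.\<close>

sublocale below: valued_place "M \<circ> of_rat" "place_below v"
proof -
  have nt: "M \<circ> of_rat \<in> nontrivial_abs"
    using number_field place_eq_class(1)[OF place mem] by (rule nontrivial_abs_of_rat)
  interpret abs_val "M \<circ> of_rat"
    using nt by (simp add: nontrivial_abs_iff)
  show "valued_place (M \<circ> of_rat) (place_below v)"
    using place_of_abs[OF nt] by unfold_locales (simp_all only: place_below_eq[OF number_field place mem])
qed

lemma below_cau: "below.cau q \<longleftrightarrow> cau (\<lambda>n. of_rat (q n))"
  by (simp add: below.cau_def cau_def of_rat_diff)

lemma below_L: "below.L q = L (\<lambda>n. of_rat (q n))"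
  by (simp add: below.L_def L_def)

lemma usual_abs_completion_eq:
  assumes "cau (\<lambda>n. of_rat (q n))"
  shows "usual_abs_completion (place_below v) (cauchy_class (place_below v) q) = L (\<lambda>n. of_rat (q n))"
proof -
  have usual: "usual_abs (place_below v) = M \<circ> of_rat"
    using below.place below.mem standard by (rule usual_abs_eq)
  have q: "below.cau q"
    using assms by (simp add: below_cau)
  have lim: "(\<lambda>n. (M \<circ> of_rat) (t n)) \<longlonglongrightarrow> below.L q" if "t \<in> cauchy_class (place_below v) q" for t
    using below.tendsto_L[OF below.cau_class[OF q that]] below.L_class[OF q that] by simp
  have "usual_abs_completion (place_below v) (cauchy_class (place_below v) q) = below.L q"
    unfolding usual_abs_completion_def usual
  proof (rule the_equality)
    fix r assume "\<forall>s\<in>cauchy_class (place_below v) q. (\<lambda>n. (M \<circ> of_rat) (s n)) \<longlonglongrightarrow> r"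
    then have "(\<lambda>n. (M \<circ> of_rat) (q n)) \<longlonglongrightarrow> r"
      using below.self_in_class by blast
    then show "r = below.L q"
      using lim[OF below.self_in_class] LIMSEQ_unique by blast
  qed (use lim in blast)
  then show ?thesis
    by (simp add: below_L)
qed

lemma completed_abs_extensional: "completed_abs \<in> extensional (carrier (completion v))"
  by (simp add: completed_abs_def)

lemma completion_abs_eq: "completion_abs v = completed_abs"
  unfolding completion_abs_def
proof (rule the_equality)
  have carrier: "q \<in> carrier (cauchy_ring (place_below v)) \<longleftrightarrow> cau (\<lambda>n. of_rat (q n))" for q
    by (simp add: below.carrier_cauchy_ring below_cau)
  show "completed_abs \<in> extensional (carrier (completion v)) \<and> absolute_value (completion v) completed_abs \<and>
      (\<forall>s\<in>carrier (cauchy_ring (place_below v)). completed_abs (cauchy_class v (of_rat \<circ> s)) =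
        usual_abs_completion (place_below v) (cauchy_class (place_below v) s))"
    using absolute_value_completed_abs
    by (auto simp: carrier usual_abs_completion_eq completed_abs_class comp_def completed_abs_extensional)
  fix N assume N: "N \<in> extensional (carrier (completion v)) \<and> absolute_value (completion v) N \<and>
      (\<forall>s\<in>carrier (cauchy_ring (place_below v)). N (cauchy_class v (of_rat \<circ> s)) =
        usual_abs_completion (place_below v) (cauchy_class (place_below v) s))"
  then have "N (cauchy_class v (\<lambda>n. of_rat (q n))) = L (\<lambda>n. of_rat (q n))" if "cau (\<lambda>n. of_rat (q n))" for q
    using that by (auto simp: carrier usual_abs_completion_eq comp_def)
  then have "N (cauchy_class v s) = L s" if "cau s" for s
    using N that extension_unique by blast
  then have "N X = completed_abs X" if "X \<in> carrier (completion v)" for X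
    using that by (auto simp: carrier_completion completed_abs_class)
  then show "N = completed_abs"
    using N completed_abs_extensional by (intro extensionalityI) auto
qed

lemma place_norm_eq: "place_norm v = M"
  by (rule ext) (simp add: place_norm_def completion_abs_eq completed_abs_class cau_const)

end

text \<open>Later arguments about norms rest on these two facts, which hide the completions: the
  norm is an absolute value in its place, and it restricts to a usual absolute value.\<close>

lemma place_norm:
  assumes "number_field TYPE('a::field_char_0)" and "(v :: 'a place) \<in> places"
  shows "place_norm v \<in> v" "place_norm v \<circ> of_rat \<in> standard_abs"
proof -
  obtain M where M: "M \<in> v" "M \<circ> of_rat \<in> standard_abs"
    using assms by (rule normalized_abs_exists)
  interpret abs_val M
    using assms(2) M(1) by (rule place_abs_val)
  interpret normalized_place M v
    by unfold_locales (use assms M in auto)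
  show "place_norm v \<in> v" "place_norm v \<circ> of_rat \<in> standard_abs"
    using M by (simp_all only: place_norm_eq)
qed

section \<open>Valuation rings\<close>

locale subring_of_field =
  fixes R :: "'a::field set"
  assumes one [simp]: "1 \<in> R" and uminus [simp]: "x \<in> R \<Longrightarrow> - x \<in> R"
    and add: "x \<in> R \<Longrightarrow> y \<in> R \<Longrightarrow> x + y \<in> R"
    and mult: "x \<in> R \<Longrightarrow> y \<in> R \<Longrightarrow> x * y \<in> R"
begin

lemma zero [simp]: "0 \<in> R"
  using add[OF one uminus[OF one]] by simp

lemma diff: "x \<in> R \<Longrightarrow> y \<in> R \<Longrightarrow> x - y \<in> R"
  using add[of x "- y"] by simp

lemma power: "x \<in> R \<Longrightarrow> x ^ n \<in> R"
  by (induction n) (simp_all add: mult)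

lemma sum: "(\<And>i. i \<in> I \<Longrightarrow> g i \<in> R) \<Longrightarrow> sum g I \<in> R"
  by (induction I rule: infinite_finite_induct) (simp_all add: add)

lemma of_nat: "of_nat n \<in> R"
  by (induction n) (simp_all add: add)

lemma of_int: "of_int i \<in> R"
  by (cases i) (auto intro: of_nat diff)

text \<open>Values at \<open>z\<close> of polynomials over \<open>R\<close> of degree below
  \<open>m\<close>. The bound is explicit because the valuation property is proved by minimizing
  it.\<close>

definition combinations :: "'a \<Rightarrow> nat \<Rightarrow> 'a set" where
  "combinations z m = {\<Sum>i<m. c i * z ^ i |c. \<forall>i. c i \<in> R}"

lemma combinationsI: "(\<And>i. c i \<in> R) \<Longrightarrow> (\<Sum>i<m. c i * z ^ i) \<in> combinations z m"
  by (auto simp: combinations_def)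

lemma combinations_add:
  assumes "x \<in> combinations z m" "y \<in> combinations z m"
  shows "x + y \<in> combinations z m"
proof -
  obtain c d where "x = (\<Sum>i<m. c i * z ^ i)" "y = (\<Sum>i<m. d i * z ^ i)" and cd: "\<And>i. c i \<in> R" "\<And>i. d i \<in> R"
    using assms by (auto simp: combinations_def)
  then have "x + y = (\<Sum>i<m. (c i + d i) * z ^ i)"
    by (simp add: sum.distrib distrib_right)
  then show ?thesis
    using cd by (auto simp only: intro!: combinationsI add)
qed

lemma combinations_scale:
  assumes "x \<in> combinations z m" "r \<in> R"
  shows "r * x \<in> combinations z m"
proof -
  obtain c where "x = (\<Sum>i<m. c i * z ^ i)" and c: "\<And>i. c i \<in> R"
    using assms by (auto simp: combinations_def)
  then have "r * x = (\<Sum>i<m. (r * c i) * z ^ i)"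
    by (simp add: sum_distrib_left mult.assoc)
  then show ?thesis
    using c assms(2) by (auto simp only: intro!: combinationsI mult)
qed

lemma combinations_power:
  assumes "i < m"
  shows "z ^ i \<in> combinations z m"
proof -
  have "(\<Sum>j<m. (if j = i then 1 else 0) * z ^ j) = (\<Sum>j<m. if j = i then z ^ i else 0)"
    by (rule sum.cong) auto
  also have "\<dots> = z ^ i"
    using assms by simp
  finally have eq: "(\<Sum>j<m. (if j = i then 1 else 0) * z ^ j) = z ^ i" .
  have "(\<Sum>j<m. (if j = i then 1 else 0) * z ^ j) \<in> combinations z m"
    by (rule combinationsI) simp
  then show ?thesis
    by (simp only: eq)
qed

lemma combinations_0: "combinations z 0 = {0}"
  by (auto simp: combinations_def intro: exI[of _ "\<lambda>_. 0"])

lemma combinations_sum: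
  "(\<And>x. x \<in> A \<Longrightarrow> g x \<in> combinations z m) \<Longrightarrow> sum g A \<in> combinations z m"
proof (induction A rule: infinite_finite_induct)
  case (insert x A)
  then show ?case by (simp add: combinations_add)
qed (use combinationsI[where c = "\<lambda>_. 0"] in simp_all)

lemma combinations_mono: "m \<le> n \<Longrightarrow> combinations z m \<subseteq> combinations z n"
proof
  fix x assume "m \<le> n" "x \<in> combinations z m"
  then obtain c where "x = (\<Sum>i<m. c i * z ^ i)" "\<And>i. c i \<in> R"
    by (auto simp: combinations_def)
  with \<open>m \<le> n\<close> show "x \<in> combinations z n"
    by (auto intro!: combinations_sum combinations_scale combinations_power)
qed

definition adjoin :: "'a \<Rightarrow> 'a set" where
  "adjoin z = (\<Union>m. combinations z m)"

lemma adjoin_base: "R \<subseteq> adjoin z"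
proof
  fix x assume "x \<in> R"
  then have "x * z ^ 0 \<in> combinations z 1"
    by (intro combinations_scale combinations_power) auto
  then show "x \<in> adjoin z"
    by (auto simp: adjoin_def)
qed

lemma adjoin_self: "z \<in> adjoin z"
  using combinations_power[of 1 2 z] by (auto simp: adjoin_def)

lemma subring_adjoin: "subring_of_field (adjoin z)"
proof
  show "1 \<in> adjoin z"
    using adjoin_base[of z] one by blast
  show "- x \<in> adjoin z" if "x \<in> adjoin z" for x
    using that combinations_scale[of x z _ "- 1"] by (auto simp: adjoin_def)
  show "x + y \<in> adjoin z" if xy: "x \<in> adjoin z" "y \<in> adjoin z" for x y
  proof -
    obtain m n where "x \<in> combinations z m" "y \<in> combinations z n"
      using xy by (auto simp: adjoin_def)
    then have "x + y \<in> combinations z (max m n)"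
      using combinations_mono[of m "max m n" z] combinations_mono[of n "max m n" z]
      by (intro combinations_add) auto
    then show ?thesis
      by (auto simp: adjoin_def)
  qed
  show "x * y \<in> adjoin z" if xy: "x \<in> adjoin z" "y \<in> adjoin z" for x y
  proof -
    obtain m n c d where "x = (\<Sum>i<m. c i * z ^ i)" "y = (\<Sum>i<n. d i * z ^ i)"
      and cd: "\<And>i. c i \<in> R" "\<And>i. d i \<in> R"
      using xy by (auto simp: adjoin_def combinations_def)
    then have "x * y = (\<Sum>i<m. \<Sum>j<n. (c i * d j) * z ^ (i + j))"
      by (simp add: sum_product power_add mult.assoc mult.left_commute)
    also have "\<dots> \<in> combinations z (m + n)"
      using cd by (intro combinations_sum combinations_scale combinations_power mult) auto
    finally show ?thesis
      by (auto simp: adjoin_def)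
  qed
qed

end

text \<open>By maximality every element outside \<open>R\<close> generates \<open>x\<close> over
  \<open>R\<close>; each later step exploits such an expression of \<open>x\<close>.\<close>

locale maximal_excluding = subring_of_field +
  fixes x :: 'a
  assumes inverse_mem: "inverse x \<in> R" and not_mem: "x \<notin> R"
    and maximal: "subring_of_field S \<Longrightarrow> R \<subseteq> S \<Longrightarrow> x \<notin> S \<Longrightarrow> S = R"
begin

lemma nonzero: "x \<noteq> 0"
  using not_mem by auto

lemma mem_adjoin: "z \<notin> R \<Longrightarrow> x \<in> adjoin z"
  using maximal[OF subring_adjoin adjoin_base, of z] adjoin_self by auto

text \<open>This says that \<open>inverse x\<close> lies in the Jacobson radical of
  \<open>R\<close>. Otherwise \<open>x\<close> would be a polynomial in \<open>inverse u\<close>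
  with \<open>u = 1 - inverse x * a\<close>, so \<open>x * u ^ m\<close> would lie in
  \<open>R\<close>; but \<open>u ^ m\<close> is 1 modulo \<open>inverse x\<close>, hence
  \<open>x * u ^ m\<close> differs from \<open>x\<close> by an element of \<open>R\<close>.\<close>

lemma inverse_one_minus:
  assumes a: "a \<in> R"
  shows "inverse (1 - inverse x * a) \<in> R" "1 - inverse x * a \<noteq> 0"
proof -
  define t u where "t = inverse x" and "u = 1 - t * a"
  have tx: "x * t = 1"
    using nonzero by (simp add: t_def)
  show "1 - inverse x * a \<noteq> 0"
  proof
    assume "1 - inverse x * a = 0"
    then have "a = x" using nonzero by (simp add: field_simps)
    with a not_mem show False by simp
  qed
  then have u0: "u \<noteq> 0" by (simp add: u_def t_def)
  have uR: "u \<in> R"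
    using a inverse_mem by (simp add: u_def t_def diff mult)
  have "inverse u \<in> R"
  proof (rule ccontr)
    assume "inverse u \<notin> R"
    then obtain m c where x: "x = (\<Sum>i<m. c i * inverse u ^ i)" and c: "\<And>i. c i \<in> R"
      using mem_adjoin[of "inverse u"] by (auto simp: adjoin_def combinations_def)
    have "x * u ^ m = (\<Sum>i<m. c i * u ^ (m - i))"
      unfolding x sum_distrib_right
      using u0 by (intro sum.cong refl) (simp add: power_diff power_inverse divide_inverse mult.assoc mult.commute)
    also have "\<dots> \<in> R"
      by (intro sum mult power c uR)
    finally have xu: "x * u ^ m \<in> R" .
    \<comment> \<open>The congruence of \<open>u ^ m\<close> with 1 modulo the ideal generated by
      \<open>t\<close>.\<close>
    have "\<exists>b\<in>R. u ^ m = 1 - t * b" for m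
    proof (induction m)
      case 0
      show ?case by (intro bexI[of _ 0]) simp_all
    next
      case (Suc m)
      then obtain b where b: "b \<in> R" "u ^ m = 1 - t * b" by blast
      have "u ^ Suc m = u ^ m - t * (a * u ^ m)"
        by (simp add: u_def algebra_simps)
      then have "u ^ Suc m = 1 - t * (b + a * u ^ m)"
        by (simp only: b(2)) (simp add: algebra_simps)
      moreover have "b + a * u ^ m \<in> R"
        using a b uR by (intro add mult power)
      ultimately show ?case by blast
    qed
    then obtain b where b: "b \<in> R" "u ^ m = 1 - t * b" by blast
    have "x = x * u ^ m + b"
      using tx by (simp add: b(2) right_diff_distrib flip: mult.assoc)
    with add[OF xu b(1)] not_mem show False by simp
  qed
  then show "inverse (1 - inverse x * a) \<in> R"
    by (simp add: u_def t_def)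
qed

text \<open>The expression of \<open>x\<close> in powers of \<open>inverse z\<close>, multiplied by
  \<open>z ^ n / x\<close>, expresses a unit multiple of \<open>z ^ n\<close> through lower powers
  of \<open>z\<close>. For \<open>n \<le> m\<close> this eliminates the top power in the expression
  of \<open>x\<close> in powers of \<open>z\<close>.\<close>

lemma combinations_descent:
  assumes z: "z \<noteq> 0" and x_z: "x \<in> combinations z (Suc m)"
    and x_inv: "x \<in> combinations (inverse z) (Suc n)" and n: "n \<le> m"
  shows "x \<in> combinations z m"
proof -
  define t where "t = inverse x"
  have tx: "t * x = 1" using nonzero by (simp add: t_def)
  obtain a where a: "x = (\<Sum>i<Suc m. a i * z ^ i)" "\<And>i. a i \<in> R"
    using x_z by (auto simp: combinations_def)
  obtain b where b: "x = (\<Sum>i<Suc n. b i * inverse z ^ i)" "\<And>i. b i \<in> R"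
    using x_inv by (auto simp: combinations_def)
  \<comment> \<open>The constant term \<open>b 0\<close> contributes \<open>t * b 0 * z ^ n\<close>;
    moved to the left it leaves the factor \<open>1 - t * b 0\<close>, which \<open>u\<close>
    cancels within \<open>R\<close>.\<close>
  define u where "u = inverse (1 - t * b 0)"
  have u: "u \<in> R" "u * (1 - t * b 0) = 1"
    using inverse_one_minus[OF b(2)[of 0]] by (simp_all add: u_def t_def)
  have "z ^ n = t * (\<Sum>i<Suc n. b i * z ^ (n - i))"
  proof -
    have "z ^ n = t * x * z ^ n" by (simp add: tx)
    also have "\<dots> = t * (\<Sum>i<Suc n. b i * inverse z ^ i * z ^ n)"
      by (simp only: b(1) mult.assoc sum_distrib_right)
    also have "(\<Sum>i<Suc n. b i * inverse z ^ i * z ^ n) = (\<Sum>i<Suc n. b i * z ^ (n - i))"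
      using z by (intro sum.cong refl) (simp add: power_diff power_inverse divide_inverse mult.assoc mult.commute)
    finally show ?thesis .
  qed
  also have "\<dots> = t * b 0 * z ^ n + t * (\<Sum>i<n. b (Suc i) * z ^ (n - Suc i))"
    by (simp add: sum.lessThan_Suc_shift distrib_left mult.assoc del: sum.lessThan_Suc)
  finally have "z ^ n * (1 - t * b 0) = t * (\<Sum>i<n. b (Suc i) * z ^ (n - Suc i))"
    by (simp add: algebra_simps)
  then have "z ^ n = u * (t * (\<Sum>i<n. b (Suc i) * z ^ (n - Suc i)))"
  proof -
    assume "z ^ n * (1 - t * b 0) = t * (\<Sum>i<n. b (Suc i) * z ^ (n - Suc i))"
    moreover have "u * (z ^ n * (1 - t * b 0)) = z ^ n * (u * (1 - t * b 0))"
      by (rule mult.left_commute)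
    then have "z ^ n = u * (z ^ n * (1 - t * b 0))"
      by (simp only: u(2) mult_1_right)
    ultimately show ?thesis by (simp only:)
  qed
  then have "z ^ (m - n) * z ^ n = z ^ (m - n) * (u * (t * (\<Sum>i<n. b (Suc i) * z ^ (n - Suc i))))"
    by simp
  also have "\<dots> = (\<Sum>i<n. (u * t * b (Suc i)) * (z ^ (m - n) * z ^ (n - Suc i)))"
    by (simp add: sum_distrib_left mult_ac)
  also have "\<dots> = (\<Sum>i<n. (u * t * b (Suc i)) * z ^ (m - Suc i))"
    using n by (intro sum.cong refl) (simp flip: power_add)
  also have "\<dots> \<in> combinations z m"
    using u(1) b(2) inverse_mem n by (intro combinations_sum combinations_scale combinations_power mult) (auto simp: t_def)
  finally have "z ^ m \<in> combinations z m"
    using n by (simp flip: power_add)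
  then have "a m * z ^ m \<in> combinations z m"
    using a(2) by (intro combinations_scale)
  moreover have "(\<Sum>i<m. a i * z ^ i) \<in> combinations z m"
    using a(2) by (rule combinationsI)
  ultimately show ?thesis
    by (simp add: a(1) combinations_add)
qed

text \<open>If neither \<open>z\<close> nor \<open>inverse z\<close> lies in \<open>R\<close>, both
  generate \<open>x\<close>. Of two expressions of minimal length, the one that is not shorter can
  be shortened by means of the other.\<close>

lemma valuation: "z \<in> R \<or> inverse z \<in> R"
proof (rule ccontr)
  assume nz: "\<not> ?thesis"
  then have z: "z \<noteq> 0" by auto
  define P Q where "P m \<longleftrightarrow> x \<in> combinations z m" and "Q m \<longleftrightarrow> x \<in> combinations (inverse z) m" for m
  define m n where "m = (LEAST m. P m)" and "n = (LEAST n. Q n)"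
  have ex: "Ex P" "Ex Q"
    using nz mem_adjoin[of z] mem_adjoin[of "inverse z"] by (auto simp: P_def Q_def adjoin_def)
  have P: "P m" "\<And>k. k < m \<Longrightarrow> \<not> P k" and Q: "Q n" "\<And>k. k < n \<Longrightarrow> \<not> Q k"
    unfolding m_def n_def using LeastI_ex[OF ex(1)] LeastI_ex[OF ex(2)] not_less_Least by blast+
  have "m \<noteq> 0"
    using P(1) nonzero by (intro notI) (simp add: P_def combinations_0)
  moreover have "n \<noteq> 0"
    using Q(1) nonzero by (intro notI) (simp add: Q_def combinations_0)
  ultimately obtain m' n' where mn: "m = Suc m'" "n = Suc n'"
    by (meson not0_implies_Suc)
  show False
  proof (cases "n' \<le> m'")
    case True
    then have "P m'"
      using combinations_descent[OF z, of m' n'] P(1) Q(1) by (simp add: P_def Q_def mn)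
    with P(2)[of m'] mn show False by simp
  next
    case False
    then have "Q n'"
      using combinations_descent[of "inverse z" n' m'] z P(1) Q(1) by (simp add: P_def Q_def mn)
    with Q(2)[of n'] mn show False by simp
  qed
qed

end

text \<open>Zorn's lemma applies because two elements of the union of a chain lie in a common
  member, so the union is a subring.\<close>

lemma maximal_excluding_exists:
  assumes "subring_of_field R0" "inverse x \<in> R0" "x \<notin> R0"
  obtains R where "maximal_excluding R x"
proof -
  define S where "S = {R. subring_of_field R \<and> inverse x \<in> R \<and> x \<notin> R}"
  have "\<exists>R\<in>S. \<forall>T\<in>S. R \<subseteq> T \<longrightarrow> T = R"
  proof (rule subset_Zorn_nonempty)
    show "S \<noteq> {}"
      using assms by (auto simp: S_def)
    fix C assume C: "C \<noteq> {}" "subset.chain S C"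
    have CS: "subring_of_field R \<and> inverse x \<in> R \<and> x \<notin> R" if "R \<in> C" for R
      using C(2) that by (auto simp: S_def subset_chain_def)
    have two: "\<exists>R\<in>C. y \<in> R \<and> z \<in> R" if yz: "y \<in> \<Union>C" "z \<in> \<Union>C" for y z
    proof -
      obtain A B where AB: "A \<in> C" "y \<in> A" "B \<in> C" "z \<in> B"
        using yz by blast
      then have "A \<subseteq> B \<or> B \<subseteq> A"
        using C(2) by (auto simp: subset_chain_def)
      with AB show ?thesis by blast
    qed
    have "subring_of_field (\<Union>C)"
    proof
      show "1 \<in> \<Union>C"
        using C(1) CS subring_of_field.one by blast
      show "- y \<in> \<Union>C" if "y \<in> \<Union>C" for y
        using that CS subring_of_field.uminus by blast
      show "y + z \<in> \<Union>C" if "y \<in> \<Union>C" "z \<in> \<Union>C" for y z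
        using two[OF that] CS subring_of_field.add by blast
      show "y * z \<in> \<Union>C" if "y \<in> \<Union>C" "z \<in> \<Union>C" for y z
        using two[OF that] CS subring_of_field.mult by blast
    qed
    then show "\<Union>C \<in> S"
      using C(1) CS by (auto simp: S_def)
  qed
  then obtain R where R: "R \<in> S" "\<And>T. T \<in> S \<Longrightarrow> R \<subseteq> T \<Longrightarrow> T = R"
    by blast
  then have "maximal_excluding R x"
    by (auto simp: S_def maximal_excluding_def maximal_excluding_axioms_def)
  then show ?thesis by (rule that)
qed

locale valuation_ring = subring_of_field R for R :: "'a::field set" +
  assumes valuation: "z \<in> R \<or> inverse z \<in> R"
begin

definition unit_elem :: "'a \<Rightarrow> bool" where
  "unit_elem z \<longleftrightarrow> z \<noteq> 0 \<and> z \<in> R \<and> inverse z \<in> R"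

lemma unit_elem_mult: "unit_elem y \<Longrightarrow> unit_elem z \<Longrightarrow> unit_elem (y * z)"
  by (simp add: unit_elem_def mult nonzero_inverse_mult_distrib)

lemma unit_elem_inverse: "unit_elem z \<Longrightarrow> unit_elem (inverse z)"
  by (simp add: unit_elem_def)

lemma unit_elem_uminus: "unit_elem z \<Longrightarrow> unit_elem (- z)"
  by (simp add: unit_elem_def)

lemma unit_elem_divide: "unit_elem y \<Longrightarrow> unit_elem z \<Longrightarrow> unit_elem (y / z)"
  by (simp add: divide_inverse unit_elem_mult unit_elem_inverse)

lemma unit_elem_power: "unit_elem z \<Longrightarrow> unit_elem (z ^ n)"
  by (induction n) (simp_all add: unit_elem_mult, simp add: unit_elem_def)

text \<open>The maximal ideal: in a valuation ring \<open>inverse z \<notin> R\<close> already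
  forces \<open>z \<in> R\<close>.\<close>

definition nonunits :: "'a set" where
  "nonunits = {z. z = 0 \<or> inverse z \<notin> R}"

lemma unit_elem_iff: "unit_elem z \<longleftrightarrow> z \<in> R \<and> z \<notin> nonunits"
  by (auto simp: unit_elem_def nonunits_def)

lemma nonunits_mult:
  assumes r: "r \<in> R" and z: "z \<in> nonunits"
  shows "r * z \<in> nonunits"
proof (rule ccontr)
  assume "r * z \<notin> nonunits"
  then have "r * z \<noteq> 0" "inverse (r * z) \<in> R"
    by (auto simp: nonunits_def)
  then have "r * inverse (r * z) \<in> R"
    using r by (intro mult)
  moreover have "r * inverse (r * z) = inverse z"
    using \<open>r * z \<noteq> 0\<close> by (simp add: field_simps)
  ultimately have "inverse z \<in> R"
    by (simp only:)
  then show False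
    using z \<open>r * z \<noteq> 0\<close> by (auto simp: nonunits_def)
qed

text \<open>One of two nonzero elements divides the other in \<open>R\<close>, so the sum is a
  multiple of one of them.\<close>

lemma nonunits_add:
  assumes "y \<in> nonunits" "z \<in> nonunits"
  shows "y + z \<in> nonunits"
proof -
  have *: "y + z \<in> nonunits" if "y / z \<in> R" "z \<noteq> 0" "z \<in> nonunits" for y z
  proof -
    have "y + z = (1 + y / z) * z"
      using that(2) by (simp add: field_simps)
    then show ?thesis
      using that by (auto intro!: nonunits_mult add)
  qed
  show ?thesis
  proof (cases "y = 0 \<or> z = 0")
    case False
    then have "inverse (y / z) = z / y" by simp
    then have "y / z \<in> R \<or> z / y \<in> R"
      using valuation[of "y / z"] by simp
    then show ?thesis
      using *[of y z] *[of z y] False assms by (auto simp: add.commute)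
  qed (use assms in auto)
qed

lemma nonunits_sum: "(\<And>i. i \<in> I \<Longrightarrow> g i \<in> nonunits) \<Longrightarrow> sum g I \<in> nonunits"
  by (induction I rule: infinite_finite_induct) (simp_all add: nonunits_add, simp_all add: nonunits_def)

text \<open>In a vanishing sum the largest value is attained at least twice.\<close>

lemma sum_eq_0_ratio_unit:
  assumes I: "finite I" and sum0: "(\<Sum>i\<in>I. g i) = 0" and nz: "k \<in> I" "g k \<noteq> 0"
  obtains i j where "i \<in> I" "j \<in> I" "i \<noteq> j" "g i \<noteq> 0" "g j \<noteq> 0" "unit_elem (g i / g j)"
proof -
  define J where "J = {i \<in> I. g i \<noteq> 0}"
  have J: "finite J" "J \<noteq> {}"
    using I nz by (auto simp: J_def)
  \<comment> \<open>A term of largest value: its quotients into all the others lie in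
    \<open>R\<close>.\<close>
  have "\<exists>i\<in>J. \<forall>j\<in>J. g j / g i \<in> R"
    using J
  proof (induction rule: finite_ne_induct)
    case (singleton i)
    show ?case by (cases "g i = 0") simp_all
  next
    case (insert k J)
    then obtain i where i: "i \<in> J" "\<And>j. j \<in> J \<Longrightarrow> g j / g i \<in> R" by blast
    show ?case
    proof (cases "g k / g i \<in> R")
      case True
      with i show ?thesis by auto
    next
      case False
      then have k: "g k / g i \<noteq> 0" by auto
      from False have ik: "g i / g k \<in> R"
        using valuation[of "g k / g i"] by simp
      have "g j / g k \<in> R" if "j \<in> J" for j
      proof -
        have "g j / g k = (g j / g i) * (g i / g k)"
          using k by simp
        then show ?thesis
          using ik i(2)[OF that] by (simp only: mult)
      qed
      moreover have "g k / g k \<in> R"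
        using k by simp
      ultimately show ?thesis by auto
    qed
  qed
  then obtain i where i: "i \<in> J" "\<And>j. j \<in> J \<Longrightarrow> g j / g i \<in> R" by blast
  then have gi: "g i \<noteq> 0" "i \<in> I" by (auto simp: J_def)
  \<comment> \<open>The other terms divided by \<open>g i\<close> sum to -1. If all these quotients
    were nonunits, -1 would be one as well.\<close>
  have "\<exists>j\<in>J - {i}. g j / g i \<notin> nonunits"
  proof (rule ccontr)
    assume "\<not> ?thesis"
    then have "g j / g i \<in> nonunits" if "j \<in> I - {i}" for j
      using that by (cases "g j = 0") (auto simp: J_def, simp add: nonunits_def)
    then have "(\<Sum>j\<in>I - {i}. g j / g i) \<in> nonunits"
      by (rule nonunits_sum)
    moreover have "sum g (I - {i}) = - g i"
      using sum0 gi I by (simp add: sum.remove[of I i] eq_neg_iff_add_eq_0 add.commute)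
    then have "(\<Sum>j\<in>I - {i}. g j / g i) = - 1"
      using gi by (simp flip: sum_divide_distrib)
    ultimately show False
      by (simp add: nonunits_def)
  qed
  then obtain j where "j \<in> J" "j \<noteq> i" "unit_elem (g j / g i)"
    using i(2) by (auto simp: unit_elem_iff)
  then show ?thesis
    using that[of j i] gi by (auto simp: J_def)
qed

end

lemma (in ultra_val) valuation_ring: "valuation_ring {x. f x \<le> 1}"
proof
  show "z \<in> {x. f x \<le> 1} \<or> inverse z \<in> {x. f x \<le> 1}" for z
    by (cases "f z \<le> 1") (simp_all add: inverse inverse_le_1_iff)
qed (use ultra in \<open>auto simp: mult intro: mult_le_one order_trans[OF ultra]\<close>)

lemma (in maximal_excluding) valuation_ring: "valuation_ring R"
  by unfold_locales (rule valuation)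

section \<open>Nonarchimedean places detecting nonintegral elements\<close>

lemma number_field_power_relation:
  assumes "number_field TYPE('a::field_char_0)"
  obtains d where "\<And>z::'a::field_char_0. \<exists>q j. j \<le> d \<and> q j \<noteq> 0 \<and> (\<Sum>i\<le>d. of_rat (q i) * z ^ i) = 0"
proof -
  from assms obtain B :: "'a set"
    where B: "finite_dimensional_vector_space (\<lambda>(q::rat) (x::'a). of_rat q * x) B"
    by (auto simp: number_field_def)
  have "\<exists>q j. j \<le> card B \<and> q j \<noteq> 0 \<and> (\<Sum>i\<le>card B. of_rat (q i) * z ^ i) = 0" for z :: 'a
    by (rule number_field_dependent[OF B, of "{..card B}" "\<lambda>i. z ^ i"]) auto
  then show ?thesis
    using that by blast
qed

locale valuation_ring_over_prime = valuation_ring R for R :: "'a::field_char_0 set" +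
  fixes l :: nat
  assumes number_field: "number_field TYPE('a)"
    and prime: "prime l" and l_nonunit: "inverse (of_nat l) \<notin> R"
begin

abbreviation \<pi> :: 'a where "\<pi> \<equiv> of_nat l"

lemma l_nonzero [simp]: "l \<noteq> 0"
  using prime by auto

text \<open>The prime is a nonunit; if \<open>m\<close> were one too, Bezout would place 1 in the
  maximal ideal.\<close>

lemma of_nat_unit:
  assumes "\<not> l dvd m"
  shows "unit_elem (of_nat m)"
proof (rule ccontr)
  assume "\<not> ?thesis"
  then have m: "of_nat m \<in> nonunits"
    by (simp add: unit_elem_iff of_nat)
  have l: "\<pi> \<in> nonunits"
    using l_nonunit by (simp add: nonunits_def)
  have "coprime m l"
    using assms prime by (simp add: prime_imp_coprime coprime_commute)
  then obtain a b :: int where ab: "a * int m + b * int l = 1"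
    using bezout_int[of "int m" "int l"] by auto
  have "of_int a * of_nat m + of_int b * \<pi> \<in> nonunits"
    by (intro nonunits_add nonunits_mult m l of_int)
  also have "of_int a * of_nat m + of_int b * \<pi> = of_int (a * int m + b * int l)"
    by simp
  finally show False
    by (simp add: ab nonunits_def)
qed

lemma of_rat_unit:
  assumes "q \<noteq> 0"
  obtains k where "unit_elem (of_rat q / \<pi> powi k)"
proof -
  have nat: "\<exists>k. unit_elem (of_nat n / \<pi> ^ k)" if n: "n > 0" for n
  proof -
    obtain m where m: "n = l ^ multiplicity l n * m" "\<not> l dvd m"
      using multiplicity_decompose'[of n l] prime n by (metis neq0_conv not_prime_unit)
    define k where "k = multiplicity l n"
    have "(of_nat n :: 'a) = of_nat (l ^ k * m)"
      using m(1) unfolding k_def by (rule arg_cong)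
    then have "of_nat n / \<pi> ^ k = of_nat m"
      by simp
    then show ?thesis
      using of_nat_unit[OF m(2)] by (intro exI[of _ k]) (simp only:)
  qed
  have int: "\<exists>k. unit_elem (of_int i / \<pi> ^ k)" if i: "i \<noteq> 0" for i
  proof (cases i rule: int_cases2)
    case (nonneg n)
    then show ?thesis
      using nat[of n] i by simp
  next
    case (nonpos n)
    then obtain k where "unit_elem (of_nat n / \<pi> ^ k)"
      using nat[of n] i by auto
    then have "unit_elem (- (of_nat n / \<pi> ^ k))"
      by (rule unit_elem_uminus)
    moreover have "of_int i / \<pi> ^ k = - (of_nat n / \<pi> ^ k)"
      unfolding nonpos(1) of_int_minus of_int_of_nat_eq minus_divide_left ..
    ultimately show ?thesis
      by (intro exI[of _ k]) (simp only:)
  qed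
  obtain a b where ab: "q = of_int a / of_int b" "b > 0"
    using quotient_of_div[of q] quotient_of_denom_pos[of q] by (cases "quotient_of q") auto
  then have "a \<noteq> 0" "b \<noteq> 0"
    using assms by auto
  then obtain i j where ij: "unit_elem (of_int a / \<pi> ^ i)" "unit_elem (of_int b / \<pi> ^ j)"
    using int by blast
  have "of_rat q / \<pi> powi (int i - int j) = (of_int a / \<pi> ^ i) / (of_int b / \<pi> ^ j)"
    by (simp add: ab(1) of_rat_divide power_int_diff)
  then have "unit_elem (of_rat q / \<pi> powi (int i - int j))"
    using unit_elem_divide[OF ij] by (simp only:)
  then show ?thesis
    by (rule that)
qed

text \<open>Two terms of a rational relation among the powers of \<open>z\<close> differ by a unit
  factor. So a positive power of \<open>z\<close> is a unit times a rational number, which is itself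
  a unit times a power of \<open>l\<close>.\<close>

lemma power_unit:
  assumes "z \<noteq> 0"
  obtains n k where "n > 0" "unit_elem (z ^ n / \<pi> powi k)"
proof -
  obtain d where "\<And>z::'a. \<exists>q j. j \<le> d \<and> q j \<noteq> 0 \<and> (\<Sum>i\<le>d. of_rat (q i) * z ^ i) = 0"
    using number_field by (rule number_field_power_relation) blast
  then obtain q m where q: "m \<le> d" "q m \<noteq> 0" "(\<Sum>i\<le>d. of_rat (q i) * z ^ i) = 0"
    by blast
  obtain i0 j0 where ij0: "i0 \<noteq> j0" "q i0 \<noteq> 0" "q j0 \<noteq> 0"
    "unit_elem ((of_rat (q i0) * z ^ i0) / (of_rat (q j0) * z ^ j0))"
    by (rule sum_eq_0_ratio_unit[OF finite_atMost q(3), of m]) (use q assms in \<open>simp, simp, auto intro: that\<close>)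
  obtain i j where ij: "j < i" "q i \<noteq> 0" "q j \<noteq> 0"
    "unit_elem ((of_rat (q i) * z ^ i) / (of_rat (q j) * z ^ j))"
  proof (cases "j0 < i0")
    case True
    then show ?thesis using ij0 that by blast
  next
    case False
    then show ?thesis
      using ij0 that[of i0 j0] unit_elem_inverse[OF ij0(4)] by simp
  qed
  obtain k where k: "unit_elem (of_rat (q i / q j) / \<pi> powi k)"
    using of_rat_unit[of "q i / q j"] ij by auto
  have "z ^ i = z ^ (i - j) * z ^ j"
    using ij(1) by (simp flip: power_add)
  then have "z ^ (i - j) / \<pi> powi (- k) =
      ((of_rat (q i) * z ^ i) / (of_rat (q j) * z ^ j)) / (of_rat (q i / q j) / \<pi> powi k)"
    using assms ij by (simp add: of_rat_divide power_int_minus field_simps)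
  then have "unit_elem (z ^ (i - j) / \<pi> powi (- k))"
    using unit_elem_divide[OF ij(4) k] by (simp only:)
  then show ?thesis
    using that[of "i - j" "- k"] ij(1) by simp
qed

lemma pi_power_nonunit:
  assumes "k > 0"
  shows "\<pi> powi (- k) \<notin> R"
proof
  assume mem: "\<pi> powi (- k) \<in> R"
  define m where "m = nat (k - 1)"
  have k: "k = int (Suc m)"
    using assms by (simp add: m_def)
  have "\<pi> ^ m * \<pi> powi (- k) \<in> R"
    by (intro mult power of_nat mem)
  also have "\<pi> powi (- k) = inverse (\<pi> ^ Suc m)"
    unfolding k by (simp only: power_int_minus power_int_of_nat)
  also have "\<pi> ^ m * inverse (\<pi> ^ Suc m) = inverse \<pi>"
    by (simp add: field_simps)
  finally show False
    using l_nonunit by simp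
qed

lemma pi_power_unit:
  assumes "unit_elem (\<pi> powi k)"
  shows "k = 0"
proof (rule ccontr)
  assume "k \<noteq> 0"
  then consider "k > 0" | "- k > 0" by linarith
  then show False
  proof cases
    case 1
    then show ?thesis
      using pi_power_nonunit[OF 1] assms by (simp add: unit_elem_def power_int_minus)
  next
    case 2
    then show ?thesis
      using pi_power_nonunit[OF 2] assms by (simp add: unit_elem_def)
  qed
qed

text \<open>The additive valuation that sends \<open>l\<close> to 1: if the n-th power of
  \<open>z\<close> is a unit times the k-th power of \<open>l\<close>, its value is k / n. It is
  real so that it can serve as an exponent of \<open>powr\<close>.\<close>

definition exponent :: "'a \<Rightarrow> real" where
  "exponent z = (SOME r. \<exists>n k. n > 0 \<and> unit_elem (z ^ n / \<pi> powi k) \<and> r = real_of_int k / real n)"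

lemma power_unit_power:
  assumes "unit_elem (z ^ n / \<pi> powi k)"
  shows "unit_elem (z ^ (n * m) / \<pi> powi (k * int m))"
proof -
  have "(z ^ n / \<pi> powi k) ^ m = z ^ (n * m) / \<pi> powi (k * int m)"
    by (simp add: power_divide power_mult power_int_mult)
  then show ?thesis
    using unit_elem_power[OF assms, of m] by (simp only:)
qed

text \<open>Two representations are compared at the common power \<open>n * n'\<close>. Their
  quotient is a power of \<open>l\<close> that is a unit, which forces equal exponents.\<close>

lemma exponent_eqI:
  assumes "z \<noteq> 0" "n > 0" "unit_elem (z ^ n / \<pi> powi k)"
  shows "exponent z = real_of_int k / real n"
proof -
  have "\<exists>n k. n > 0 \<and> unit_elem (z ^ n / \<pi> powi k) \<and> exponent z = real_of_int k / real n"
    unfolding exponent_def by (rule someI_ex) (use assms in blast)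
  then obtain n' k' where nk: "n' > 0" "unit_elem (z ^ n' / \<pi> powi k')" "exponent z = real_of_int k' / real n'"
    by blast
  have "(z ^ (n * n') / \<pi> powi (k * int n')) / (z ^ (n' * n) / \<pi> powi (k' * int n)) = \<pi> powi (k' * int n - k * int n')"
    using assms(1) by (simp add: power_int_diff mult.commute[of n'])
  then have "unit_elem (\<pi> powi (k' * int n - k * int n'))"
    using unit_elem_divide[OF power_unit_power[OF assms(3), of n'] power_unit_power[OF nk(2), of n]] by (simp only:)
  then have "k' * int n = k * int n'"
    using pi_power_unit by fastforce
  then have "real_of_int k' * real n = real_of_int k * real n'"
    by (metis of_int_mult of_int_of_nat_eq)
  then show ?thesis
    using assms(2) nk by (simp only: nk(3)) (simp add: frac_eq_eq mult.commute)
qed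

lemma exponent_mult:
  assumes "y \<noteq> 0" "z \<noteq> 0"
  shows "exponent (y * z) = exponent y + exponent z"
proof -
  obtain n k where nk: "n > 0" "unit_elem (y ^ n / \<pi> powi k)"
    using power_unit[OF assms(1)] by blast
  obtain n' k' where nk': "n' > 0" "unit_elem (z ^ n' / \<pi> powi k')"
    using power_unit[OF assms(2)] by blast
  have "(y ^ (n * n') / \<pi> powi (k * int n')) * (z ^ (n' * n) / \<pi> powi (k' * int n))
      = (y * z) ^ (n * n') / \<pi> powi (k * int n' + k' * int n)"
    by (simp add: power_int_add power_mult_distrib mult.commute[of n'])
  then have "unit_elem ((y * z) ^ (n * n') / \<pi> powi (k * int n' + k' * int n))"
    using unit_elem_mult[OF power_unit_power[OF nk(2), of n'] power_unit_power[OF nk'(2), of n]] by (simp only:)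
  then have "exponent (y * z) = real_of_int (k * int n' + k' * int n) / real (n * n')"
    using assms nk nk' by (intro exponent_eqI) simp_all
  also have "\<dots> = real_of_int k / real n + real_of_int k' / real n'"
    using nk nk' by (simp add: field_simps)
  also have "\<dots> = exponent y + exponent z"
    using exponent_eqI[OF assms(1) nk] exponent_eqI[OF assms(2) nk'] by simp
  finally show ?thesis .
qed

text \<open>The exponent is read off from a power of \<open>z\<close>, so membership of
  \<open>z ^ n\<close> has to descend to \<open>z\<close>: if instead
  \<open>inverse z \<in> R\<close>, then \<open>z = z ^ n * inverse z ^ (n - 1)\<close> lies in
  \<open>R\<close> anyway.\<close>

lemma exponent_nonneg_iff:
  assumes "z \<noteq> 0"
  shows "0 \<le> exponent z \<longleftrightarrow> z \<in> R"
proof -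
  obtain n k where nk: "n > 0" "unit_elem (z ^ n / \<pi> powi k)"
    using power_unit[OF assms] by blast
  have "0 \<le> exponent z \<longleftrightarrow> 0 \<le> k"
    using exponent_eqI[OF assms nk] nk(1) by (simp add: zero_le_divide_iff)
  also have "\<dots> \<longleftrightarrow> z \<in> R"
  proof
    assume "0 \<le> k"
    then have "\<pi> powi k \<in> R"
      by (simp add: power_int_def power of_nat)
    then have "z ^ n / \<pi> powi k * \<pi> powi k \<in> R"
      using nk by (intro mult) (simp_all add: unit_elem_def)
    then have zn: "z ^ n \<in> R" by simp
    show "z \<in> R"
    proof (rule ccontr)
      assume "z \<notin> R"
      then have "inverse z \<in> R" using valuation by blast
      then have "z ^ n * inverse z ^ (n - 1) \<in> R"
        by (intro mult[OF zn] power)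
      also have "z ^ n * inverse z ^ (n - 1) = z"
        using assms nk(1) by (cases n) (simp_all add: power_inverse)
      finally show False using \<open>z \<notin> R\<close> by simp
    qed
  next
    assume z: "z \<in> R"
    show "0 \<le> k"
    proof (rule ccontr)
      assume "\<not> 0 \<le> k"
      then have "\<pi> powi k \<notin> R"
        using pi_power_nonunit[of "- k"] by simp
      moreover have "z ^ n * inverse (z ^ n / \<pi> powi k) \<in> R"
        using nk z by (intro mult power) (simp_all only: unit_elem_def)
      moreover have "z ^ n * inverse (z ^ n / \<pi> powi k) = \<pi> powi k"
        using assms by simp
      ultimately show False by simp
    qed
  qed
  finally show ?thesis .
qed

text \<open>The base 2 is arbitrary, since a place is a class up to powers and
  \<open>place_norm\<close> picks out the normalized member.\<close>

definition valuation_abs :: "'a \<Rightarrow> real" where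
  "valuation_abs z = (if z = 0 then 0 else 2 powr - exponent z)"

lemma valuation_abs_le_one_iff: "valuation_abs z \<le> 1 \<longleftrightarrow> z \<in> R"
  using powr_le_cancel_iff[of 2 "- exponent z" 0]
  by (simp add: valuation_abs_def flip: exponent_nonneg_iff)

lemma valuation_abs_mult: "valuation_abs (y * z) = valuation_abs y * valuation_abs z"
  by (simp add: valuation_abs_def exponent_mult flip: powr_add)

text \<open>Dividing by the summand of larger value reduces the claim to closure of \<open>R\<close>
  under addition, applied to \<open>1 + z / y\<close>.\<close>

lemma valuation_abs_ultra: "valuation_abs (y + z) \<le> max (valuation_abs y) (valuation_abs z)"
proof -
  have le: "valuation_abs (y + z) \<le> valuation_abs y"
    if yz: "valuation_abs z \<le> valuation_abs y" "y \<noteq> 0" for y z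
  proof -
    have pos: "valuation_abs y > 0"
      using yz by (simp add: valuation_abs_def)
    have "valuation_abs y * valuation_abs (z / y) = valuation_abs z"
      using yz by (simp flip: valuation_abs_mult)
    with yz pos have "valuation_abs (z / y) \<le> 1"
      by (metis mult_le_cancel_left1 mult.right_neutral mult_le_cancel_left_pos)
    then have "1 + z / y \<in> R"
      by (simp add: valuation_abs_le_one_iff add)
    then have "valuation_abs y * valuation_abs (1 + z / y) \<le> valuation_abs y * 1"
      using pos by (intro mult_left_mono) (simp_all add: valuation_abs_le_one_iff)
    also have "valuation_abs y * valuation_abs (1 + z / y) = valuation_abs (y + z)"
      using yz by (simp add: distrib_left flip: valuation_abs_mult)
    finally show ?thesis by simp
  qed
  show ?thesis
  proof (cases "y = 0 \<or> z = 0")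
    case False
    then show ?thesis
      using le[of z y] le[of y z] by (cases "valuation_abs z \<le> valuation_abs y") (simp_all add: add.commute)
  qed (auto simp: valuation_abs_def)
qed

lemma valuation_abs_nonneg: "0 \<le> valuation_abs z"
  by (simp add: valuation_abs_def)

lemma ultra_val_valuation_abs: "ultra_val valuation_abs"
proof
  show "valuation_abs (y + z) \<le> valuation_abs y + valuation_abs z" for y z
    using valuation_abs_ultra[of y z] valuation_abs_nonneg[of y] valuation_abs_nonneg[of z] by linarith
  show "valuation_abs (y * z) = valuation_abs y * valuation_abs z" for y z
    by (rule valuation_abs_mult)
  show "valuation_abs (y + z) \<le> max (valuation_abs y) (valuation_abs z)" for y z
    by (rule valuation_abs_ultra)
qed (simp_all add: valuation_abs_def)

end

section \<open>From a nonintegral element to a place\<close>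

lemma subring_Ints: "subring_of_field (\<int> :: 'a::field_char_0 set)"
  by unfold_locales auto

text \<open>An expression of \<open>x\<close> as an integral polynomial in \<open>inverse x\<close>,
  multiplied by a power of \<open>x\<close>, becomes a monic integral equation for
  \<open>x\<close>.\<close>

lemma not_mem_adjoin_inverse:
  assumes "\<not> algebraic_int (x :: 'a::field_char_0)"
  shows "x \<notin> subring_of_field.adjoin \<int> (inverse x)"
proof
  interpret subring_of_field "\<int> :: 'a set" by (rule subring_Ints)
  assume "x \<in> adjoin (inverse x)"
  then obtain m c where x: "x = (\<Sum>i<m. c i * inverse x ^ i)" and c: "\<And>i. c i \<in> \<int>"
    by (auto simp: adjoin_def combinations_def)
  have x0: "x \<noteq> 0"
    using assms by auto
  have "x ^ Suc m = (\<Sum>i<m. c i * inverse x ^ i) * x ^ m"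
    by (subst power_Suc, subst (1) x) (rule refl)
  also have "\<dots> = (\<Sum>i<m. c i * x ^ (m - i))"
    unfolding sum_distrib_right using x0
    by (intro sum.cong refl) (simp add: power_diff power_inverse divide_inverse mult.assoc mult.commute)
  finally have rel: "x ^ Suc m = (\<Sum>i<m. c i * x ^ (m - i))" .
  \<comment> \<open>The exponents \<open>m - i\<close> do not exceed \<open>m\<close>, so
    subtracting \<open>r\<close> from the monomial of degree \<open>Suc m\<close> keeps it
    monic.\<close>
  define r where "r = (\<Sum>i<m. monom (c i) (m - i))"
  define p where "p = monom 1 (Suc m) - r"
  have "degree r \<le> m"
    unfolding r_def by (intro degree_sum_le) (auto intro: order_trans[OF degree_monom_le])
  then have r: "degree r < degree (monom (1::'a) (Suc m))"
    by (simp add: degree_monom_eq)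
  have "lead_coeff p = 1"
    using r lead_coeff_add_le[of "- r" "monom 1 (Suc m)"]
    by (simp add: p_def degree_diff_less coeff_eq_0 degree_monom_eq degree_add_eq_left flip: add_uminus_conv_diff)
  moreover have "coeff p i \<in> \<int>" for i
    using c by (auto simp: p_def r_def coeff_sum)
  moreover have "poly p x = 0"
    using rel by (simp add: p_def r_def poly_sum poly_monom)
  ultimately have "algebraic_int x"
    by (intro algebraic_int.intros) auto
  with assms show False by simp
qed

text \<open>If every prime were invertible in \<open>R\<close>, then \<open>R\<close> would contain
  the rationals. A rational equation for \<open>x\<close>, divided by its leading coefficient and by
  the power of \<open>x\<close> one below the degree, would make \<open>x\<close> a polynomial in
  \<open>inverse x\<close> and hence an element of \<open>R\<close>.\<close>

lemma maximal_excluding_prime: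
  assumes nf: "number_field TYPE('a::field_char_0)" and "maximal_excluding R (x :: 'a)"
  obtains l where "prime l" "inverse (of_nat l) \<notin> R"
proof (rule ccontr)
  interpret maximal_excluding R x by fact
  assume "\<not> thesis"
  then have inv: "inverse (of_nat l) \<in> R" if "prime l" for l
    using that \<open>\<And>l. prime l \<Longrightarrow> inverse (of_nat l) \<notin> R \<Longrightarrow> thesis\<close> by blast
  have nat: "inverse (of_nat n) \<in> R" if "n > 0" for n
    using that
  proof (induction n rule: less_induct)
    case (less n)
    show ?case
    proof (cases "n = 1")
      case False
      then obtain l where l: "prime l" "l dvd n"
        using prime_factor_nat by blast
      then obtain m where m: "n = l * m" by (auto elim: dvdE)
      with less.prems have "m > 0" "m < n"
        using prime_gt_1_nat[OF l(1)] by auto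
      then have "inverse (of_nat l) * inverse (of_nat m) \<in> R"
        using less.IH inv[OF l(1)] by (intro mult) auto
      then show ?thesis
        by (simp add: m)
    qed simp
  qed
  have rat: "of_rat q \<in> R" for q
  proof -
    obtain a b where ab: "q = of_int a / of_int b" "b > 0"
      using quotient_of_div[of q] quotient_of_denom_pos[of q] by (cases "quotient_of q") auto
    then have "of_rat q = of_int a * inverse (of_nat (nat b))"
      by (simp add: of_rat_divide) (simp add: divide_inverse)
    also have "\<dots> \<in> R"
      using ab by (intro mult of_int nat) simp
    finally show ?thesis .
  qed
  obtain d where "\<And>z::'a. \<exists>q j. j \<le> d \<and> q j \<noteq> 0 \<and> (\<Sum>i\<le>d. of_rat (q i) * z ^ i) = 0"
    using nf by (rule number_field_power_relation) blast
  then obtain q j0 where q: "j0 \<le> d" "q j0 \<noteq> 0" "(\<Sum>i\<le>d. of_rat (q i) * x ^ i) = 0"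
    by blast
  \<comment> \<open>The true degree: the relation may end in zero coefficients, and the leading one
    has to be divided out.\<close>
  define j where "j = Max {j. j \<le> d \<and> q j \<noteq> 0}"
  have "finite {j. j \<le> d \<and> q j \<noteq> 0}" "{j. j \<le> d \<and> q j \<noteq> 0} \<noteq> {}"
    using q by auto
  from Max_in[OF this] Max_ge[OF this(1)] have j: "j \<le> d" "q j \<noteq> 0"
    and large: "\<And>i. i \<le> d \<Longrightarrow> q i \<noteq> 0 \<Longrightarrow> i \<le> j"
    by (auto simp: j_def)
  have "(\<Sum>i\<le>d. of_rat (q i) * x ^ i) = (\<Sum>i\<le>j. of_rat (q i) * x ^ i)"
    using j large by (intro sum.mono_neutral_right) (auto simp: not_le dest: leD)
  then have rel: "of_rat (q j) * x ^ j + (\<Sum>i<j. of_rat (q i) * x ^ i) = 0"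
    using q(3) by (simp add: lessThan_Suc_atMost[symmetric] add.commute)
  have "j \<noteq> 0"
    using rel j(2) by (intro notI) simp
  then obtain k where k: "j = Suc k" by (cases j) auto
  have "x ^ j = - (\<Sum>i<j. of_rat (q i / q j) * x ^ i)"
    using rel j(2) by (simp add: of_rat_divide field_simps eq_neg_iff_add_eq_0 flip: sum_divide_distrib)
  then have "x ^ j * inverse x ^ k = - (\<Sum>i<j. of_rat (q i / q j) * x ^ i) * inverse x ^ k"
    by (rule arg_cong)
  also have "\<dots> = - (\<Sum>i<j. of_rat (q i / q j) * inverse x ^ (k - i))"
    unfolding minus_mult_left[symmetric] sum_distrib_right using nonzero k
    by (intro arg_cong[of _ _ uminus] sum.cong refl)
      (simp add: power_diff power_inverse divide_inverse mult.assoc mult.commute)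
  also have "x ^ j * inverse x ^ k = x"
    using nonzero by (simp add: k power_inverse)
  also have "- (\<Sum>i<j. of_rat (q i / q j) * inverse x ^ (k - i)) \<in> R"
    using inverse_mem rat by (intro uminus sum mult power)
  finally show False
    using not_mem by simp
qed

theorem nonarch_place_of_not_algebraic_int:
  assumes nf: "number_field TYPE('a::field_char_0)" and x: "\<not> algebraic_int (x :: 'a)"
  obtains w where "w \<in> nonarch_places" "place_norm w x > 1"
proof -
  interpret Z: subring_of_field "\<int> :: 'a set" by (rule subring_Ints)
  obtain R where R: "maximal_excluding R x"
    using maximal_excluding_exists[OF Z.subring_adjoin Z.adjoin_self not_mem_adjoin_inverse[OF x]] by blast
  interpret maximal_excluding R x by (rule R)
  obtain l where l: "prime l" "inverse (of_nat l) \<notin> R"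
    using nf R by (rule maximal_excluding_prime)
  interpret valuation_ring R by (rule valuation_ring)
  interpret valuation_ring_over_prime R l
    using nf l by unfold_locales
  interpret ultra_val valuation_abs by (rule ultra_val_valuation_abs)
  have gt: "valuation_abs x > 1"
    using valuation_abs_le_one_iff[of x] not_mem by simp
  then have nt: "valuation_abs \<in> nontrivial_abs"
    using abs_val_axioms nonzero by (auto simp: nontrivial_abs_iff)
  define w where "w = abs_equiv `` {valuation_abs}"
  have w: "w \<in> places" "valuation_abs \<in> w"
    unfolding w_def using nt by (rule place_of_abs)+
  \<comment> \<open>The inequality is required of every member of the place, and each is a positive
    power of \<open>valuation_abs\<close>.\<close>
  have "nonarchimedean w"
    unfolding nonarchimedean_def
  proof (intro ballI allI)
    fix g y z assume "g \<in> w"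
    then obtain s where s: "s > 0" "\<And>x. g x = valuation_abs x powr s"
      using place_powr[OF w] by blast
    have "valuation_abs (y + z) powr s \<le> max (valuation_abs y) (valuation_abs z) powr s"
      using s(1) ultra by (intro powr_mono2) auto
    also have "\<dots> \<le> max (g y) (g z)"
      by (simp add: s(2) max_def)
    finally show "g (y + z) \<le> max (g y) (g z)"
      by (simp add: s(2))
  qed
  then have "w \<in> nonarch_places"
    using w by (simp add: nonarch_places_def)
  moreover obtain s where "s > 0" "\<And>y. place_norm w y = valuation_abs y powr s"
    using place_powr[OF w place_norm(1)[OF nf w(1)]] by blast
  then have "place_norm w x > 1"
    using gt by simp
  ultimately show ?thesis by (rule that)
qed

section \<open>Supports and weighted logarithms\<close>

text \<open>If the value exceeded 1, the leading term of the monic equation would strictly dominate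
  all others, whose coefficients are integers of value at most 1.\<close>

lemma (in ultra_val) algebraic_int_le_one:
  assumes "algebraic_int x"
  shows "f x \<le> 1"
proof (rule ccontr)
  assume "\<not> f x \<le> 1"
  then have gt: "f x > 1" by simp
  obtain p where p: "lead_coeff p = 1" "\<And>i. coeff p i \<in> \<int>" "poly p x = 0"
    using assms by (auto elim: algebraic_int.cases)
  have "degree p \<noteq> 0"
  proof
    assume "degree p = 0"
    then obtain c where "p = [:c:]" by (rule degree_eq_zeroE)
    with p(1,3) show False by simp
  qed
  then obtain k where k: "degree p = Suc k"
    by (cases "degree p") auto
  have "x ^ Suc k + (\<Sum>i\<le>k. coeff p i * x ^ i) = 0"
    using p(1,3) by (simp add: poly_altdef k add.commute)
  then have "x ^ Suc k = - (\<Sum>i\<le>k. coeff p i * x ^ i)"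
    by (simp only: eq_neg_iff_add_eq_0)
  then have "f x ^ Suc k = f (\<Sum>i\<le>k. coeff p i * x ^ i)"
    by (simp only: minus flip: power)
  also have "\<dots> \<le> f x ^ k"
  proof (rule sum_le_bound)
    fix i assume "i \<in> {..k}"
    have "f (coeff p i) \<le> 1"
      using p(2)[of i] by (auto elim: Ints_cases)
    then have "f (coeff p i) * f x ^ i \<le> 1 * f x ^ k"
      using \<open>i \<in> {..k}\<close> gt by (intro mult_mono power_increasing) auto
    then show "f (coeff p i * x ^ i) \<le> f x ^ k"
      by (simp add: mult power)
  qed simp
  finally have "f x ^ Suc k \<le> f x ^ k" .
  with power_strict_increasing[of k "Suc k" "f x"] gt show False by simp
qed

lemma (in ultra_val) norm_of_unit_elem:
  assumes "valuation_ring.unit_elem {x. f x \<le> 1} z"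
  shows "f z = 1"
proof -
  interpret valuation_ring "{x. f x \<le> 1}" by (rule valuation_ring)
  have "z \<noteq> 0" "f z \<le> 1" "f (inverse z) \<le> 1"
    using assms by (simp_all add: unit_elem_def)
  then have "f z \<le> 0 \<or> f z = 1"
    by (auto simp: inverse inverse_le_1_iff)
  moreover have "\<not> f z \<le> 0"
    using \<open>z \<noteq> 0\<close> by (simp add: not_le)
  ultimately show ?thesis by blast
qed

text \<open>Among the usual absolute values the Archimedean one is excluded by its value 2 at the
  integer 2.\<close>

lemma nonarch_place_norm:
  assumes nf: "number_field TYPE('a::field_char_0)" and w: "(w :: 'a place) \<in> nonarch_places"
  shows "ultra_val (place_norm w)" "\<exists>l. prime l \<and> (\<forall>q. place_norm w (of_rat q) = padic_abs l q)"
proof -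
  have w: "w \<in> places" "nonarchimedean w"
    using assms by (auto simp: nonarch_places_def)
  note norm = place_norm[OF nf w(1)]
  interpret abs_val "place_norm w"
    using w(1) norm(1) by (rule place_abs_val)
  show "ultra_val (place_norm w)"
    using w(2) norm(1) by unfold_locales (auto simp: nonarchimedean_def)
  then interpret ultra_val "place_norm w" .
  have "place_norm w \<circ> of_rat \<noteq> (\<lambda>q. \<bar>real_of_rat q\<bar>)"
  proof
    assume "place_norm w \<circ> of_rat = (\<lambda>q. \<bar>real_of_rat q\<bar>)"
    then have "(place_norm w \<circ> of_rat) (of_nat 2) = 2"
      by simp
    then show False
      using of_nat_le_one[of 2] by simp
  qed
  then show "\<exists>l. prime l \<and> (\<forall>q. place_norm w (of_rat q) = padic_abs l q)"
    using norm(2) by (auto simp: standard_abs_def fun_eq_iff)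
qed

lemma algebraic_int_of_nonarch_le_one:
  assumes "number_field TYPE('a::field_char_0)"
    and "\<And>w. w \<in> nonarch_places \<Longrightarrow> place_norm w (x :: 'a) \<le> 1"
  shows "algebraic_int x"
  using nonarch_place_of_not_algebraic_int[OF assms(1)] assms(2) by (metis not_le)

lemma padic_abs_eq_one: "prime l \<Longrightarrow> \<not> l dvd n \<Longrightarrow> padic_abs l (of_nat n) = 1"
  using padic_abs_of_nat_power_mult[of l n 0] by simp

text \<open>The reciprocal of \<open>l\<close> is rational but not an integer, hence not integral; a
  place at which it exceeds 1 lies over \<open>l\<close>.\<close>

lemma nonarch_place_over_prime:
  assumes "number_field TYPE('a::field_char_0)" "prime l"
  obtains w :: "'a::field_char_0 place" where "w \<in> nonarch_places" "place_norm w (of_nat l) < 1"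
proof -
  have "\<not> algebraic_int (inverse (of_nat l) :: 'a)"
  proof
    assume "algebraic_int (inverse (of_nat l) :: 'a)"
    then have "inverse (of_nat l :: 'a) \<in> \<int>"
      by (rule rational_algebraic_int_is_int) simp
    then obtain i where "inverse (of_nat l :: 'a) = of_int i"
      by (auto elim: Ints_cases)
    then have "(of_int (i * int l) :: 'a) = of_int 1"
      using assms(2) by (simp add: field_simps)
    then have "i * int l = 1"
      by (simp only: of_int_eq_iff)
    then show False
      using assms(2) by (auto simp: zmult_eq_1_iff)
  qed
  then obtain w :: "'a place" where w: "w \<in> nonarch_places" "place_norm w (inverse (of_nat l)) > 1"
    using nonarch_place_of_not_algebraic_int[OF assms(1)] by blast
  interpret ultra_val "place_norm w"
    using assms(1) w(1) by (rule nonarch_place_norm)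
  have "place_norm w (of_nat l) < 1"
    using w(2) assms(2) by (simp add: inverse one_less_inverse_iff)
  with w(1) show ?thesis by (rule that)
qed

section \<open>Finiteness of supports\<close>

locale separated_places =
  fixes \<beta> :: "'a::field_char_0 place \<Rightarrow> 'a"
  assumes number_field: "number_field TYPE('a)"
    and less_one: "w \<in> nonarch_places \<Longrightarrow> place_norm w (\<beta> w) < 1"
    and eq_one: "u \<in> nonarch_places \<Longrightarrow> w \<in> nonarch_places \<Longrightarrow> w \<noteq> u \<Longrightarrow> place_norm w (\<beta> u) = 1"
begin

text \<open>The condition at \<open>u\<close> itself would allow 0, so a second nonarchimedean place
  is required, where the norm is 1. Places over 2 and over 3 are distinct because 1 = 3 - 2.\<close>

lemma beta_nonzero:
  assumes u: "u \<in> nonarch_places"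
  shows "\<beta> u \<noteq> 0"
proof -
  obtain w2 :: "'a place" where w2: "w2 \<in> nonarch_places" "place_norm w2 (of_nat 2) < 1"
    by (rule nonarch_place_over_prime[OF number_field two_is_prime_nat])
  obtain w3 :: "'a place" where w3: "w3 \<in> nonarch_places" "place_norm w3 (of_nat 3) < 1"
    by (rule nonarch_place_over_prime[OF number_field, of 3]) (simp, rule that)
  have "w2 \<noteq> w3"
  proof
    assume "w2 = w3"
    interpret ultra_val "place_norm w2"
      using number_field w2(1) by (rule nonarch_place_norm)
    have "1 \<le> max (place_norm w2 (of_nat 3)) (place_norm w2 (of_nat 2))"
      using ultra[of "of_nat 3" "- of_nat 2"] by simp
    then show False
      using w2(2) w3(2) \<open>w2 = w3\<close> by simp
  qed
  then obtain w where w: "w \<in> nonarch_places" "w \<noteq> u"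
    using w2 w3 by metis
  interpret ultra_val "place_norm w"
    using number_field w(1) by (rule nonarch_place_norm)
  show ?thesis
    using eq_one[OF u w] by auto
qed

text \<open>Places over the same prime give rationally independent products of the \<open>\<beta> w\<close>.\<close>

lemma finite_over_prime:
  assumes l: "prime l"
  shows "finite {w \<in> nonarch_places. \<forall>q. place_norm w (of_rat q :: 'a) = padic_abs l q}"
proof (rule ccontr)
  assume inf: "infinite {w \<in> nonarch_places. \<forall>q. place_norm w (of_rat q :: 'a) = padic_abs l q}"
  from number_field obtain B :: "'a set"
    where B: "finite_dimensional_vector_space (\<lambda>(q::rat) (x::'a). of_rat q * x) B"
    by (auto simp: number_field_def)
  obtain W where W: "W \<subseteq> {w \<in> nonarch_places. \<forall>q. place_norm w (of_rat q :: 'a) = padic_abs l q}"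
    "finite W" "card W = Suc (card B)"
    using infinite_arbitrarily_large[OF inf] by blast
  have nonarch: "w \<in> nonarch_places" and padic: "place_norm w (of_rat q) = padic_abs l q" if "w \<in> W" for w q
    using W(1) that by auto
  \<comment> \<open>Omitting only \<open>\<beta> w\<close> gives \<open>x w\<close> norm 1 at
    \<open>w\<close> and norm below 1 at every other place of \<open>W\<close>.\<close>
  define x where "x w = (\<Prod>u\<in>W - {w}. \<beta> u)" for w
  obtain q j where j: "j \<in> W" "q j \<noteq> 0" and rel: "(\<Sum>w\<in>W. of_rat (q w) * x w) = 0"
    by (rule number_field_dependent[OF B W(2), of x]) (use W(3) in \<open>auto intro: that\<close>)
  \<comment> \<open>All places of \<open>W\<close> induce the same absolute value on the
    coefficients. At a place \<open>i\<close> whose coefficient is largest, the term of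
    \<open>i\<close> strictly dominates the relation.\<close>
  obtain i where i: "i \<in> W" and max: "\<And>w. w \<in> W \<Longrightarrow> padic_abs l (q w) \<le> padic_abs l (q i)"
  proof -
    have "Max ((\<lambda>w. padic_abs l (q w)) ` W) \<in> (\<lambda>w. padic_abs l (q w)) ` W"
      using W(2) j(1) by (intro Max_in) auto
    then obtain i where "i \<in> W" "Max ((\<lambda>w. padic_abs l (q w)) ` W) = padic_abs l (q i)"
      by auto
    moreover have "padic_abs l (q w) \<le> Max ((\<lambda>w. padic_abs l (q w)) ` W)" if "w \<in> W" for w
      using W(2) that by (intro Max_ge) auto
    ultimately show ?thesis
      using that by metis
  qed
  have pos: "padic_abs l (q i) > 0"
    using max[OF j(1)] padic_abs_pos[OF l j(2)] by simp
  interpret ultra_val "place_norm i"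
    using number_field nonarch[OF i] by (rule nonarch_place_norm)
  have "place_norm i (\<Sum>w\<in>W - {i}. of_rat (q w) * x w) < padic_abs l (q i)"
  proof (rule sum_less_bound[OF _ pos])
    fix w assume w: "w \<in> W - {i}"
    have "place_norm i (x w) = place_norm i (\<beta> i) * (\<Prod>u\<in>W - {w} - {i}. place_norm i (\<beta> u))"
      unfolding x_def prod using w i W(2) by (intro prod.remove) auto
    also have "(\<Prod>u\<in>W - {w} - {i}. place_norm i (\<beta> u)) = 1"
      using eq_one nonarch i by (intro prod.neutral) auto
    finally have xw: "place_norm i (x w) < 1"
      using less_one nonarch i by simp
    have "place_norm i (of_rat (q w) * x w) = padic_abs l (q w) * place_norm i (x w)"
      by (simp add: mult padic i)
    also have "\<dots> \<le> padic_abs l (q i) * place_norm i (x w)"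
      using max[of w] w by (intro mult_right_mono) auto
    also have "\<dots> < padic_abs l (q i)"
      using pos xw by simp
    finally show "place_norm i (of_rat (q w) * x w) < padic_abs l (q i)" .
  qed
  also have "(\<Sum>w\<in>W - {i}. of_rat (q w) * x w) = - (of_rat (q i) * x i)"
    using rel W(2) i by (simp add: sum.remove[of W i] eq_neg_iff_add_eq_0 add.commute)
  also have "place_norm i (x i) = 1"
    unfolding x_def prod using eq_one nonarch i by (intro prod.neutral) auto
  then have "place_norm i (- (of_rat (q i) * x i)) = padic_abs l (q i)"
    by (simp add: mult padic i)
  finally show False by simp
qed

text \<open>Such a place lies over one of the finitely many prime divisors of
  \<open>n\<close>.\<close>

lemma finite_of_nat:
  assumes "n > 0"
  shows "finite {w \<in> nonarch_places. place_norm w (of_nat n :: 'a) \<noteq> 1}"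
proof (rule finite_subset)
  show "{w \<in> nonarch_places. place_norm w (of_nat n :: 'a) \<noteq> 1}
      \<subseteq> (\<Union>l\<in>{l. l dvd n \<and> prime l}. {w \<in> nonarch_places. \<forall>q. place_norm w (of_rat q :: 'a) = padic_abs l q})"
  proof
    fix w assume "w \<in> {w \<in> nonarch_places. place_norm w (of_nat n :: 'a) \<noteq> 1}"
    then have w: "w \<in> nonarch_places" "place_norm w (of_nat n :: 'a) \<noteq> 1" by auto
    obtain l where l: "prime l" "\<And>q. place_norm w (of_rat q :: 'a) = padic_abs l q"
      using nonarch_place_norm(2)[OF number_field w(1)] by blast
    have "padic_abs l (of_nat n) \<noteq> 1"
      using w(2) l(2)[of "of_nat n"] by simp
    then have "l dvd n"
      using padic_abs_eq_one[OF l(1)] by blast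
    with l w(1) show "w \<in> (\<Union>l\<in>{l. l dvd n \<and> prime l}. {w \<in> nonarch_places. \<forall>q. place_norm w (of_rat q :: 'a) = padic_abs l q})"
      by blast
  qed
  have "finite {l. l dvd n \<and> prime l}"
    using assms by (auto intro: finite_subset[OF _ finite_divisors_nat])
  then show "finite (\<Union>l\<in>{l. l dvd n \<and> prime l}. {w \<in> nonarch_places. \<forall>q. place_norm w (of_rat q :: 'a) = padic_abs l q})"
    using finite_over_prime by auto
qed

lemma finite_of_rat:
  assumes "q \<noteq> 0"
  shows "finite {w \<in> nonarch_places. place_norm w (of_rat q :: 'a) \<noteq> 1}"
proof -
  obtain a b where ab: "q = of_int a / of_int b" "b > 0"
    using quotient_of_div[of q] quotient_of_denom_pos[of q] by (cases "quotient_of q") auto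
  define m n where "m = nat \<bar>a\<bar>" and "n = nat \<bar>b\<bar>"
  have "m > 0" "n > 0"
    using ab assms by (auto simp: m_def n_def)
  have "place_norm w (of_rat q :: 'a) = place_norm w (of_nat m :: 'a) / place_norm w (of_nat n)" if "w \<in> nonarch_places" for w :: "'a place"
  proof -
    interpret ultra_val "place_norm w"
      using number_field that by (rule nonarch_place_norm)
    have "of_rat q = (of_int a / of_int b :: 'a)"
      by (simp add: ab(1) of_rat_divide)
    then show ?thesis
      by (simp only: divide of_int_eq_of_nat m_def n_def)
  qed
  then have "{w \<in> nonarch_places. place_norm w (of_rat q :: 'a) \<noteq> 1}
      \<subseteq> {w \<in> nonarch_places. place_norm w (of_nat m :: 'a) \<noteq> 1} \<union> {w \<in> nonarch_places. place_norm w (of_nat n :: 'a) \<noteq> 1}"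
    by auto
  then show ?thesis
    using finite_of_nat[OF \<open>m > 0\<close>] finite_of_nat[OF \<open>n > 0\<close>] by (meson finite_UnI finite_subset)
qed

text \<open>Where all nonzero coefficients of a relation among the powers of \<open>a\<close> have
  norm 1, two different powers of \<open>a\<close> have equal norm, so \<open>a\<close> has norm 1.
  The support is thus covered by the supports of those coefficients.\<close>

lemma finite_support:
  assumes "a \<noteq> (0 :: 'a)"
  shows "finite {w \<in> nonarch_places. place_norm w a \<noteq> 1}"
proof -
  obtain d where "\<And>z::'a. \<exists>q j. j \<le> d \<and> q j \<noteq> 0 \<and> (\<Sum>i\<le>d. of_rat (q i) * z ^ i) = 0"
    using number_field by (rule number_field_power_relation) blast
  then obtain q m where q: "m \<le> d" "q m \<noteq> 0" "(\<Sum>i\<le>d. of_rat (q i) * a ^ i) = 0"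
    by blast
  have "{w \<in> nonarch_places. place_norm w a \<noteq> 1} \<subseteq>
      (\<Union>i\<in>{i. i \<le> d \<and> q i \<noteq> 0}. {w \<in> nonarch_places. place_norm w (of_rat (q i) :: 'a) \<noteq> 1})"
  proof
    fix w assume "w \<in> {w \<in> nonarch_places. place_norm w a \<noteq> 1}"
    then have w: "w \<in> nonarch_places" "place_norm w a \<noteq> 1" by auto
    interpret norm: ultra_val "place_norm w"
      using number_field w(1) by (rule nonarch_place_norm)
    interpret valuation_ring "{x. place_norm w x \<le> 1}"
      by (rule norm.valuation_ring)
    obtain i j where ij: "i \<le> d" "j \<le> d" "i \<noteq> j" "q i \<noteq> 0" "q j \<noteq> 0"
      and unit: "unit_elem ((of_rat (q i) * a ^ i) / (of_rat (q j) * a ^ j))"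
      by (rule sum_eq_0_ratio_unit[OF finite_atMost q(3), of m]) (use q assms in \<open>simp, simp, auto intro: that\<close>)
    have "place_norm w ((of_rat (q i) * a ^ i) / (of_rat (q j) * a ^ j)) = 1"
      using unit by (rule norm.norm_of_unit_elem)
    then have "place_norm w (of_rat (q i) * a ^ i) / place_norm w (of_rat (q j) * a ^ j) = 1"
      by (simp only: norm.divide)
    then have "place_norm w (of_rat (q i) * a ^ i) = place_norm w (of_rat (q j) * a ^ j)"
      by (simp only: divide_eq_1_iff)
    then have eq: "place_norm w (of_rat (q i)) * place_norm w a ^ i = place_norm w (of_rat (q j)) * place_norm w a ^ j"
      by (simp only: norm.mult norm.power)
    have "place_norm w (of_rat (q i)) \<noteq> 1 \<or> place_norm w (of_rat (q j)) \<noteq> 1"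
    proof (rule ccontr)
      assume "\<not> ?thesis"
      with eq have "place_norm w a ^ i = place_norm w a ^ j" by simp
      moreover have "place_norm w a > 0" using assms by simp
      ultimately show False
        using w(2) ij(3) by (simp add: power_inject_exp')
    qed
    with ij w(1) show "w \<in> (\<Union>i\<in>{i. i \<le> d \<and> q i \<noteq> 0}. {w \<in> nonarch_places. place_norm w (of_rat (q i) :: 'a) \<noteq> 1})"
      by blast
  qed
  moreover have "finite (\<Union>i\<in>{i. i \<le> d \<and> q i \<noteq> 0}. {w \<in> nonarch_places. place_norm w (of_rat (q i) :: 'a) \<noteq> 1})"
    using finite_of_rat by auto
  ultimately show ?thesis
    by (rule finite_subset)
qed

end

text \<open>The closed unit ball of the norm is a valuation ring over \<open>l\<close>, and taking
  norms in the unit representation of a power of \<open>a\<close> gives the claim. The sign of the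
  exponent changes because \<open>l\<close> has norm 1 / l.\<close>

lemma nonarch_norm_power:
  assumes nf: "number_field TYPE('a::field_char_0)" and w: "w \<in> nonarch_places" and a: "(a :: 'a) \<noteq> 0"
    and l: "prime l" and padic: "\<And>q. place_norm w (of_rat q :: 'a) = padic_abs l q"
  obtains n k where "n > 0" "place_norm w a ^ n = real l powi k"
proof -
  interpret norm: ultra_val "place_norm w"
    using nf w by (rule nonarch_place_norm)
  interpret valuation_ring "{x. place_norm w x \<le> 1}"
    by (rule norm.valuation_ring)
  have l1: "real l > 1"
    using prime_gt_1_nat[OF l] by simp
  have "padic_abs l (of_nat l) = inverse (real l)"
    using padic_abs_of_nat_power_mult[OF l, of 1 1] prime_gt_1_nat[OF l] by (simp add: power_int_minus)
  then have norm_l: "place_norm w (of_nat l) = inverse (real l)"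
    using padic[of "of_nat l"] by simp
  interpret valuation_ring_over_prime "{x. place_norm w x \<le> 1}" l
    using nf l l1 by unfold_locales (simp_all add: norm.inverse norm_l)
  obtain n k where n: "n > 0" and unit: "unit_elem (a ^ n / of_nat l powi k)"
    using power_unit[OF a] by blast
  have "place_norm w (a ^ n / of_nat l powi k) = 1"
    using unit by (rule norm.norm_of_unit_elem)
  then have "place_norm w a ^ n / inverse (real l) powi k = 1"
    by (simp only: norm.divide norm.power norm.power_int norm_l)
  then have "place_norm w a ^ n = inverse (real l) powi k"
    by (simp only: divide_eq_1_iff)
  also have "\<dots> = real l powi (- k)"
    by (simp add: power_int_inverse power_int_minus)
  finally show ?thesis
    using n that by blast
qed

text \<open>Suitable powers of both norms are powers of \<open>l\<close>, and the exponent for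
  \<open>\<beta> w\<close> is nonzero because its norm is below 1; so the two norms are
  commensurable.\<close>

lemma (in separated_places) norm_power_beta:
  assumes w: "w \<in> nonarch_places" and a: "a \<noteq> 0"
  obtains n k where "n > 0" "place_norm w (a ^ n * \<beta> w powi k) = 1"
proof -
  interpret ultra_val "place_norm w"
    using number_field w by (rule nonarch_place_norm)
  obtain l where l: "prime l" "\<And>q. place_norm w (of_rat q :: 'a) = padic_abs l q"
    using nonarch_place_norm(2)[OF number_field w] by blast
  have l1: "real l > 1"
    using prime_gt_1_nat[OF l(1)] by simp
  obtain m i where m: "m > 0" "place_norm w a ^ m = real l powi i"
    using nonarch_norm_power[OF number_field w a l] by blast
  obtain m' j where m': "m' > 0" "place_norm w (\<beta> w) ^ m' = real l powi j"
    using nonarch_norm_power[OF number_field w beta_nonzero[OF w] l] by blast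
  have "j \<noteq> 0"
  proof
    assume "j = 0"
    then have "place_norm w (\<beta> w) ^ m' = 1" using m' by simp
    then have "place_norm w (\<beta> w) = 1"
      using m'(1) power_eq_imp_eq_base[of "place_norm w (\<beta> w)" m' 1] by simp
    with less_one[OF w] show False by simp
  qed
  \<comment> \<open>The exponent of \<open>a\<close> has to be a positive natural number, hence
    \<open>\<bar>j\<bar>\<close>; the sign of \<open>j\<close> moves into \<open>k\<close>. The two
    norms are then \<open>l\<close> to the powers \<open>i * \<bar>j\<bar>\<close> and
    \<open>- (i * \<bar>j\<bar>)\<close>.\<close>
  define n where "n = m * nat \<bar>j\<bar>"
  define k where "k = - (sgn j * i * int m')"
  have "place_norm w (a ^ n) = real l powi (i * \<bar>j\<bar>)"
    by (simp add: n_def power power_mult m(2) power_int_power')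
  moreover have "place_norm w (\<beta> w powi k) = real l powi (- (i * \<bar>j\<bar>))"
  proof -
    have "place_norm w (\<beta> w powi k) = (place_norm w (\<beta> w) ^ m') powi (- (sgn j * i))"
      by (simp add: power_int k_def power_int_power mult_ac)
    also have "\<dots> = real l powi (j * (- (sgn j * i)))"
      unfolding m'(2) power_int_mult ..
    also have "j * (- (sgn j * i)) = - (i * \<bar>j\<bar>)"
      by (simp add: abs_sgn mult_ac)
    finally show ?thesis .
  qed
  ultimately have "place_norm w (a ^ n * \<beta> w powi k) = 1"
    using l1 by (simp add: mult power_int_minus)
  moreover have "n > 0"
    using m(1) \<open>j \<noteq> 0\<close> by (simp add: n_def)
  ultimately show ?thesis
    using that by blast
qed

section \<open>The weighted logarithm as a homomorphism\<close>

lemma places_eq: "places = arch_places \<union> nonarch_places" "arch_places \<inter> nonarch_places = {}"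
  by (auto simp: arch_places_def nonarch_places_def)

locale weighted_places = separated_places \<beta> for \<beta> :: "'a::field_char_0 place \<Rightarrow> 'a" +
  fixes y :: "'a place \<Rightarrow> real"
  assumes finite_arch: "finite (arch_places :: 'a place set)"
begin

definition weighted_log :: "'a \<Rightarrow> real" where
  "weighted_log a = (\<Sum>\<^sub>\<infinity>u\<in>places. y u * ln (place_norm u a))"

definition support :: "'a \<Rightarrow> 'a place set" where
  "support a = {w \<in> nonarch_places. place_norm w a \<noteq> 1}"

text \<open>\<open>infsum\<close> returns 0 for families that are not summable; here it is a genuine
  finite sum, since \<open>ln 1 = 0\<close> off the support. \<open>S\<close> may exceed the support
  so that several elements share one index set.\<close>

lemma weighted_log_eq_sum:
  assumes "finite S" "support a \<subseteq> S" "S \<subseteq> nonarch_places"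
  shows "weighted_log a = (\<Sum>u\<in>arch_places \<union> S. y u * ln (place_norm u a))"
proof -
  have "weighted_log a = infsum (\<lambda>u. y u * ln (place_norm u a)) (arch_places \<union> S)"
    unfolding weighted_log_def
    by (rule infsum_cong_neutral) (use assms places_eq(1) in \<open>auto simp: support_def\<close>)
  then show ?thesis
    using assms(1) finite_arch by simp
qed

lemma abs_val_place_norm: "u \<in> places \<Longrightarrow> abs_val (place_norm u :: 'a \<Rightarrow> real)"
  using place_norm(1)[OF number_field] by (intro place_abs_val)

lemma weighted_log_mult:
  assumes "a \<noteq> 0" "b \<noteq> 0"
  shows "weighted_log (a * b) = weighted_log a + weighted_log b"
proof -
  define S where "S = support a \<union> support b"
  have S: "finite S" "S \<subseteq> nonarch_places"
    using finite_support assms by (auto simp: S_def support_def)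
  have norm: "place_norm u (a * b) = place_norm u a * place_norm u b" "place_norm u a > 0" "place_norm u b > 0"
    if "u \<in> places" for u
    using abs_val.mult[OF abs_val_place_norm[OF that]] abs_val.pos_iff[OF abs_val_place_norm[OF that]] assms by simp_all
  have sup: "support (a * b) \<subseteq> S"
  proof
    fix u assume "u \<in> support (a * b)"
    then have u: "u \<in> nonarch_places" "place_norm u (a * b) \<noteq> 1"
      by (auto simp: support_def)
    then have "u \<in> places"
      by (simp add: nonarch_places_def)
    with u(2) have "place_norm u a \<noteq> 1 \<or> place_norm u b \<noteq> 1"
      using norm(1)[of u] by auto
    with u(1) show "u \<in> S"
      by (auto simp: support_def S_def)
  qed
  have "weighted_log (a * b) = (\<Sum>u\<in>arch_places \<union> S. y u * ln (place_norm u a) + y u * ln (place_norm u b))"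
    unfolding weighted_log_eq_sum[OF S(1) sup S(2)]
  proof (rule sum.cong)
    fix u assume "u \<in> arch_places \<union> S"
    then have "u \<in> places" using S(2) places_eq(1) by auto
    from norm[OF this] show "y u * ln (place_norm u (a * b)) = y u * ln (place_norm u a) + y u * ln (place_norm u b)"
      by (simp add: ln_mult distrib_left)
  qed simp
  also have "\<dots> = weighted_log a + weighted_log b"
    using weighted_log_eq_sum[OF S(1) _ S(2), of a] weighted_log_eq_sum[OF S(1) _ S(2), of b]
    by (simp add: sum.distrib S_def)
  finally show ?thesis .
qed

lemma weighted_log_1: "weighted_log 1 = 0"
  using weighted_log_mult[of 1 1] by simp

lemma weighted_log_power: "a \<noteq> 0 \<Longrightarrow> weighted_log (a ^ n) = real n * weighted_log a"
  by (induction n) (simp_all add: weighted_log_1 weighted_log_mult algebra_simps)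

lemma weighted_log_inverse:
  assumes "a \<noteq> 0"
  shows "weighted_log (inverse a) = - weighted_log a"
  using weighted_log_mult[of a "inverse a"] assms by (simp add: weighted_log_1)

lemma weighted_log_power_int: "a \<noteq> 0 \<Longrightarrow> weighted_log (a powi k) = of_int k * weighted_log a"
  by (simp add: power_int_def weighted_log_power weighted_log_inverse)

lemma weighted_log_of_power:
  assumes "a \<noteq> 0" "n > 0" "weighted_log (a ^ n) \<in> \<rat>"
  shows "weighted_log a \<in> \<rat>"
proof -
  have "weighted_log a = weighted_log (a ^ n) / real n"
    using assms by (simp add: weighted_log_power)
  then show ?thesis
    using assms(3) by simp
qed

text \<open>Induction on the number of nonarchimedean places in the support: a suitable power of \<open>\<beta> w\<close>
  removes \<open>w\<close> from the support of a power of \<open>a\<close> and leaves the other places alone.\<close>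

lemma weighted_log_rational:
  assumes a: "a \<noteq> 0" and units: "\<And>b. b \<noteq> 0 \<Longrightarrow> support b = {} \<Longrightarrow> weighted_log b \<in> \<rat>"
    and betas: "\<And>w. w \<in> nonarch_places \<Longrightarrow> weighted_log (\<beta> w) \<in> \<rat>"
  shows "weighted_log a \<in> \<rat>"
  using a
proof (induction "card (support a)" arbitrary: a rule: less_induct)
  case less
  have fin: "finite (support a)"
    using finite_support[OF less.prems] by (simp add: support_def)
  show ?case
  proof (cases "support a = {}")
    case False
    then obtain w where w: "w \<in> support a" by blast
    then have wn: "w \<in> nonarch_places" by (simp add: support_def)
    note \<beta>0 = beta_nonzero[OF wn]
    obtain n k where n: "n > 0" and one: "place_norm w (a ^ n * \<beta> w powi k) = 1"
      using norm_power_beta[OF wn less.prems] by blast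
    define b where "b = a ^ n * \<beta> w powi k"
    have b0: "b \<noteq> 0"
      using less.prems \<beta>0 by (simp add: b_def)
    have "support b \<subseteq> support a - {w}"
    proof
      fix u assume "u \<in> support b"
      then have u: "u \<in> nonarch_places" "place_norm u b \<noteq> 1"
        by (auto simp: support_def)
      then have "u \<noteq> w"
        using one by (auto simp: b_def)
      interpret ultra_val "place_norm u"
        using number_field u(1) by (rule nonarch_place_norm)
      have "place_norm u b = place_norm u a ^ n"
        using eq_one[OF wn u(1) \<open>u \<noteq> w\<close>] by (simp add: b_def mult power power_int)
      with u have "place_norm u a \<noteq> 1" by auto
      with u \<open>u \<noteq> w\<close> show "u \<in> support a - {w}"
        by (simp add: support_def)
    qed
    then have "card (support b) < card (support a)"
      using fin w by (intro psubset_card_mono) auto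
    then have "weighted_log b \<in> \<rat>"
      using b0 less.hyps by blast
    moreover have "weighted_log b = weighted_log (a ^ n) + of_int k * weighted_log (\<beta> w)"
      using less.prems \<beta>0 by (simp add: b_def weighted_log_mult weighted_log_power_int)
    then have "weighted_log (a ^ n) = weighted_log b - of_int k * weighted_log (\<beta> w)"
      by simp
    ultimately have "weighted_log (a ^ n) \<in> \<rat>"
      using betas[OF wn] by simp
    then show ?thesis
      by (rule weighted_log_of_power[OF less.prems n])
  qed (use units less.prems in blast)
qed

end

section \<open>Units of the ring of integers and the equivalence\<close>

lemma Units_ring_of_integers:
  "u \<in> Units (ring_of_integers :: 'a::field_char_0 ring) \<longleftrightarrow> u \<noteq> 0 \<and> algebraic_int u \<and> algebraic_int (inverse u)"
proof
  assume "u \<in> Units (ring_of_integers :: 'a ring)"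
  then obtain w where w: "algebraic_int u" "algebraic_int w" "w * u = 1"
    by (auto simp: Units_def ring_of_integers_def cring_class_ops_def)
  then have "w = inverse u"
    by (metis inverse_unique mult.commute)
  with w show "u \<noteq> 0 \<and> algebraic_int u \<and> algebraic_int (inverse u)" by auto
next
  assume "u \<noteq> 0 \<and> algebraic_int u \<and> algebraic_int (inverse u)"
  then show "u \<in> Units (ring_of_integers :: 'a ring)"
    by (auto simp: Units_def ring_of_integers_def cring_class_ops_def intro: bexI[of _ "inverse u"])
qed

lemma inv_units_of_ring_of_integers:
  assumes "u \<in> Units (ring_of_integers :: 'a::field_char_0 ring)"
  shows "inv\<^bsub>units_of ring_of_integers\<^esub> u = inverse u"
proof -
  have "inverse u \<in> Units (ring_of_integers :: 'a ring)" "u \<noteq> 0"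
    using assms by (auto simp: Units_ring_of_integers)
  then show ?thesis
    unfolding m_inv_def
    by (intro the_equality)
      (auto simp: units_of_def ring_of_integers_def cring_class_ops_def dest: inverse_unique)
qed

context separated_places
begin

text \<open>Integral elements have norm at most 1 and nonintegral ones are detected by some place;
  both facts are applied to \<open>u\<close> and to its inverse.\<close>

lemma unit_iff: "u \<in> Units (ring_of_integers :: 'a ring) \<longleftrightarrow> u \<noteq> 0 \<and> (\<forall>w\<in>nonarch_places. place_norm w u = 1)"
proof
  assume u: "u \<in> Units (ring_of_integers :: 'a ring)"
  then have u': "u \<noteq> 0" "algebraic_int u" "algebraic_int (inverse u)"
    by (auto simp: Units_ring_of_integers)
  have "place_norm w u = 1" if "w \<in> nonarch_places" for w
  proof -
    interpret ultra_val "place_norm w"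
      using number_field that by (rule nonarch_place_norm)
    have "place_norm w u \<le> 1" "inverse (place_norm w u) \<le> 1"
      using algebraic_int_le_one u'(2,3) by (auto simp flip: inverse)
    then show ?thesis
      using u'(1) by (simp add: inverse_le_1_iff) (metis less_le_not_le nonneg eq_0_iff order_antisym)
  qed
  with u'(1) show "u \<noteq> 0 \<and> (\<forall>w\<in>nonarch_places. place_norm w u = 1)" by blast
next
  assume u: "u \<noteq> 0 \<and> (\<forall>w\<in>nonarch_places. place_norm w u = 1)"
  have "place_norm w (inverse u) = 1" if "w \<in> nonarch_places" for w
  proof -
    interpret ultra_val "place_norm w"
      using number_field that by (rule nonarch_place_norm)
    show ?thesis using u that by (simp add: inverse)
  qed
  then show "u \<in> Units (ring_of_integers :: 'a ring)"
    using u algebraic_int_of_nonarch_le_one[OF number_field, of u]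
      algebraic_int_of_nonarch_le_one[OF number_field, of "inverse u"]
    by (auto simp: Units_ring_of_integers)
qed

end

theorem theorem1p4:
  fixes v :: "nat \<Rightarrow> 'a::field_char_0 place"
    and n :: nat
    and \<alpha> :: "nat \<Rightarrow> 'a"
    and \<beta> :: "'a place \<Rightarrow> 'a"
    and y :: "'a place \<Rightarrow> real"
  assumes "number_field TYPE('a)"
    and "bij_betw v {1..n} arch_places"
    and "fundamental_units \<alpha>"
    and "\<And>u. u \<in> nonarch_places \<Longrightarrow> \<beta> u \<in> carrier ring_of_integers"
    and "\<And>u. u \<in> nonarch_places \<Longrightarrow> place_norm u (\<beta> u) < 1"
    and "\<And>u w. u \<in> nonarch_places \<Longrightarrow> w \<in> nonarch_places \<Longrightarrow> w \<noteq> u \<Longrightarrow> place_norm w (\<beta> u) = 1"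
  shows "(\<forall>a::'a. a \<noteq> 0 \<longrightarrow> (\<Sum>\<^sub>\<infinity>u\<in>places. y u * ln (place_norm u a)) \<in> \<rat>) \<longleftrightarrow>
    (\<forall>i\<in>{1..<n}. (\<Sum>j=1..n. ln (place_norm (v j) (\<alpha> i)) * y (v j)) \<in> \<rat>) \<and>
    (\<forall>u\<in>nonarch_places.
       y u * ln (place_norm u (\<beta> u)) + (\<Sum>i=1..n. y (v i) * ln (place_norm (v i) (\<beta> u))) \<in> \<rat>)"
proof -
  have fin: "finite (arch_places :: 'a place set)"
    using assms(2) bij_betw_finite by blast
  interpret weighted_places \<beta> y
    by unfold_locales (use assms fin in auto)
  have card: "card (arch_places :: 'a place set) = n"
    using bij_betw_same_card[OF assms(2)] by simp
  obtain \<zeta> m where \<zeta>: "m > 0" "\<zeta> ^ m = 1"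
    and units: "\<alpha> ` {1..<n} \<subseteq> Units ring_of_integers"
    and gen: "generate (units_of ring_of_integers) (insert \<zeta> (\<alpha> ` {1..<n})) = Units ring_of_integers"
    using assms(3) by (auto simp: fundamental_units_def card Let_def)
  have arch_sum: "(\<Sum>u\<in>arch_places. g u) = (\<Sum>j=1..n. g (v j))" for g :: "'a place \<Rightarrow> real"
    using sum.reindex_bij_betw[OF assms(2), of g] by simp
  \<comment> \<open>Only Archimedean terms survive for a unit, so the entries of the matrix product
    in (i) are the weighted logarithms of the fundamental units.\<close>
  have log_unit: "weighted_log b = (\<Sum>j=1..n. ln (place_norm (v j) b) * y (v j))"
    if "b \<in> Units ring_of_integers" for b
  proof -
    have "support b \<subseteq> {}"
      using that by (auto simp: unit_iff support_def)
    from weighted_log_eq_sum[OF _ this] show ?thesis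
      by (simp add: arch_sum mult.commute)
  qed
  \<comment> \<open>Among the nonarchimedean places only \<open>u\<close> contributes, which leaves
    the expression in (ii).\<close>
  have log_beta: "weighted_log (\<beta> u) = y u * ln (place_norm u (\<beta> u)) + (\<Sum>i=1..n. y (v i) * ln (place_norm (v i) (\<beta> u)))"
    if u: "u \<in> nonarch_places" for u
  proof -
    have "support (\<beta> u) \<subseteq> {u}"
      using eq_one[OF u] by (auto simp: support_def)
    from weighted_log_eq_sum[OF _ this] u have "weighted_log (\<beta> u) = (\<Sum>w\<in>insert u arch_places. y w * ln (place_norm w (\<beta> u)))"
      by simp
    also have "\<dots> = y u * ln (place_norm u (\<beta> u)) + (\<Sum>w\<in>arch_places. y w * ln (place_norm w (\<beta> u)))"
      using u fin places_eq(2) by (intro sum.insert) auto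
    finally show ?thesis
      by (simp add: arch_sum)
  qed
  have "(\<forall>a. a \<noteq> 0 \<longrightarrow> weighted_log a \<in> \<rat>) \<longleftrightarrow>
      (\<forall>i\<in>{1..<n}. weighted_log (\<alpha> i) \<in> \<rat>) \<and> (\<forall>u\<in>nonarch_places. weighted_log (\<beta> u) \<in> \<rat>)"
  proof
    assume "\<forall>a. a \<noteq> 0 \<longrightarrow> weighted_log a \<in> \<rat>"
    then show "(\<forall>i\<in>{1..<n}. weighted_log (\<alpha> i) \<in> \<rat>) \<and> (\<forall>u\<in>nonarch_places. weighted_log (\<beta> u) \<in> \<rat>)"
      using units beta_nonzero by (auto simp: Units_ring_of_integers)
  next
    assume rat: "(\<forall>i\<in>{1..<n}. weighted_log (\<alpha> i) \<in> \<rat>) \<and> (\<forall>u\<in>nonarch_places. weighted_log (\<beta> u) \<in> \<rat>)"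
    have "\<zeta> \<noteq> 0"
      using \<zeta> by (metis zero_neq_one zero_power)
    moreover have "weighted_log (\<zeta> ^ m) \<in> \<rat>"
      using \<zeta> by (simp add: weighted_log_1)
    ultimately have rat_zeta: "weighted_log \<zeta> \<in> \<rat>"
      by (rule weighted_log_of_power[OF _ \<zeta>(1)])
    have rat_gen: "weighted_log h \<in> \<rat>" if "h \<in> insert \<zeta> (\<alpha> ` {1..<n})" for h
      using that rat rat_zeta by auto
    have gen_unit: "h \<in> Units ring_of_integers" if "h \<in> insert \<zeta> (\<alpha> ` {1..<n})" for h
      using generate.incl[OF that, of "units_of ring_of_integers"] gen by simp
    \<comment> \<open>Nonvanishing is carried through the induction because additivity of
      \<open>weighted_log\<close> is available for nonzero arguments.\<close>
    have unit_rat: "b \<noteq> 0 \<and> weighted_log b \<in> \<rat>"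
      if "b \<in> generate (units_of ring_of_integers) (insert \<zeta> (\<alpha> ` {1..<n}))" for b
      using that
    proof (induction b rule: generate.induct)
      case one
      show ?case
        by (simp add: weighted_log_1 units_of_def ring_of_integers_def cring_class_ops_def)
    next
      case (incl h)
      then show ?case
        using rat_gen gen_unit by (auto simp: Units_ring_of_integers)
    next
      case (inv h)
      then have "h \<noteq> 0" "inv\<^bsub>units_of ring_of_integers\<^esub> h = inverse h"
        using gen_unit inv_units_of_ring_of_integers by (auto simp: Units_ring_of_integers)
      then show ?case
        using rat_gen[OF inv] by (simp add: weighted_log_inverse)
    next
      case (eng h1 h2)
      then show ?case
        by (simp add: weighted_log_mult units_of_def ring_of_integers_def cring_class_ops_def)
    qed
    show "\<forall>a. a \<noteq> 0 \<longrightarrow> weighted_log a \<in> \<rat>"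
    proof (intro allI impI)
      fix a :: 'a assume "a \<noteq> 0"
      then show "weighted_log a \<in> \<rat>"
      proof (rule weighted_log_rational)
        fix b :: 'a assume "b \<noteq> 0" "support b = {}"
        then have "b \<in> Units ring_of_integers"
          by (auto simp: unit_iff support_def)
        then show "weighted_log b \<in> \<rat>"
          using unit_rat gen by blast
      qed (use rat in auto)
    qed
  qed
  moreover have "weighted_log (\<alpha> i) = (\<Sum>j=1..n. ln (place_norm (v j) (\<alpha> i)) * y (v j))" if "i \<in> {1..<n}" for i
    using units that by (intro log_unit) auto
  ultimately show ?thesis
    unfolding weighted_log_def[symmetric] using log_beta by simp
qed

end
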